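(* Let $\mathcal{F}$ and $\mathcal{F}'$ be saturated fusion systems over finite $p$-groups $S$ and $S'$. Let $(\mathcal{T},\delta,\pi)$ and $(\mathcal{T}',\delta',\pi')$ be transporter systems associated to $\mathcal{F}$ and $\mathcal{F}'$ with object sets $\Delta$ and $\Delta'$ which contain $\mathcal{F}^{cr}$ and $\mathcal{F}'^{cr}$, respectively. Given an isomorphism of transporter systems $\alpha\colon\mathcal{T}\to\mathcal{T}'$, there is a unique isomorphism $\beta\colon S\to S'$, a unique functor $\beta_*\colon\mathcal{T}_\Delta(S)\to\mathcal{T}_{\Delta'}(S')$, and a unique isomorphism $c_\beta\colon\mathcal{F}\to\mathcal{F}'$ of fusion systems such that $$\delta'\circ\beta_*=\alpha\circ\delta,\qquad \pi'\circ\alpha=c_\beta\circ\pi,$$ and $\beta=(\beta_* )_S$ (the map induced by $\beta_*$ from $\mathrm{Aut}_{\mathcal{T}_\Delta(S)}(S)=S$ to $\mathrm{Aut}_{\mathcal{T}_{\Delta'}(S')}(S')=S'$). Moreover, $\alpha$ is a rigid isomorphism if and only if both $\beta_*$ and $c_\beta$ are the identity functors.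
   Context: Fix a prime $p$. For a nonempty collection $\Delta$ of subgroups of a finite $p$-group $S$, $\mathcal{T}_\Delta(S)$ is the category with object set $\Delta$ and $\mathrm{Mor}(P,Q)=N_S(P,Q)=\{s\in S:{}^sP\le Q\}$ (where ${}^sP=sPs^{-1}$), with composition given by multiplication. Transporter systems. Let $\mathcal{F}$ be a saturated fusion system over $S$. A transporter system associated with $\mathcal{F}$ is a nonempty category $\mathcal{T}$ (with finite morphism sets) with object set $\Delta$, together with functors $\mathcal{T}_\Delta(S)\xrightarrow{\delta}\mathcal{T}\xrightarrow{\pi}\mathcal{F}$ such that: (A1) $\Delta$ is closed under $\mathcal{F}$-conjugacy and passing to overgroups in $S$, $\delta$ is the identity on objects and $\pi$ is the inclusion on objects. (A2) For $P,Q\in\Delta$, the kernel $E(P)$ of $\pi_P\colon\mathrm{Aut}_{\mathcal{T}}(P)=\mathrm{Mor}_{\mathcal{T}}(P,P)\to\mathrm{Aut}_{\mathcal{F}}(P)$ acts freely on $\mathrm{Mor}_{\mathcal{T}}(P,Q)$ by right composition, and $\pi_{P,Q}$ is the orbit map for this action (in particular, surjective onto $\mathrm{Hom}_{\mathcal F}(P,Q)$); also $E(Q)$ acts freely on $\mathrm{Mor}_{\mathcal{T}}(P,Q)$ by left composition. (B) For $P,Q\in\Delta$, $\delta_{P,Q}\colon N_S(P,Q)\to\mathrm{Mor}_{\mathcal{T}}(P,Q)$ is injective and $\pi_{P,Q}\circ\delta_{P,Q}$ sends $g$ to $c_g\colon x\mapsto gxg^{-1}$. (C) For $\varphi\in\mathrm{Mor}_{\mathcal{T}}(P,Q)$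 and $g\in P$, $\varphi\circ\delta_P(g)=\delta_Q(\pi(\varphi)(g))\circ\varphi$. (I) $\delta_S(S)$ is a Sylow $p$-subgroup of $\mathrm{Aut}_{\mathcal{T}}(S)$. (II) If $\varphi\in\mathrm{Iso}_{\mathcal{T}}(P,Q)$, $P\trianglelefteq\bar P\le S$, $Q\trianglelefteq\bar Q\le S$ and $\varphi\circ\delta_P(\bar P)\circ\varphi^{-1}\le\delta_Q(\bar Q)$, then there is $\bar\varphi\in\mathrm{Mor}_{\mathcal{T}}(\bar P,\bar Q)$ with $\bar\varphi\circ\delta_{P,\bar P}(1)=\delta_{Q,\bar Q}(1)\circ\varphi$. Here $\delta_P=\delta_{P,P}$, and similarly for other functors. $\mathcal{F}^{cr}$ is the set of subgroups $P\le S$ that are $\mathcal{F}$-centric ($C_S(Q)\le Q$ for every $\mathcal{F}$-conjugate $Q$ of $P$) and $\mathcal{F}$-radical ($O_p(\mathrm{Aut}_{\mathcal{F}}(P)/\mathrm{Inn}(P))=1$). A morphism of fusion systems $\mathcal{F}\to\mathcal{F}'$ is a pair $(\alpha,\Phi)$ with $\alpha\colon S\to S'$ a homomorphism and $\Phi\colon\mathcal{F}\to\mathcal{F}'$ a functor such that $\Phi(P)=\alpha(P)$ on objects and $\Phi(\varphi)\circ\alpha=\alpha\circ\varphi$ for each morphism $\varphi$; for an isomorphism, $\Phi$ is determined by $\alpha$. An isomorphism of transporter systems $\mathcal{T}\to\mathcal{T}'$ is an equivalence of categories $\alpha$ which is isotypical, i.e. $\alpha(\delta_P(P))=\delta'_{\alpha(P)}(\alpha(P))$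 for all $P\in\Delta$, and sends inclusions to inclusions, i.e. $\alpha(\delta_{P,Q}(1))=\delta'_{\alpha(P),\alpha(Q)}(1)$ for all $P\le Q$ in $\Delta$. It is rigid if $S=S'$ and $\alpha_S\circ\delta_S=\delta'_S$ as homomorphisms $S\to\mathrm{Aut}_{\mathcal{T}'}(S)$. *)

theory Defs
  imports "HOL-Algebra.Sylow" "HOL-Algebra.Generated_Groups"
begin

section \<open>Categories and functors\<close>

text \<open>
  Categories are given by families of hom-sets, which need not be disjoint (the same element of a
  group \<open>S\<close> lies in many of the sets \<open>N\<^sub>S(P,Q)\<close>). For this reason composition and the morphism
  part of a functor are indexed by the objects involved: \<open>Comp C x y z g f\<close> is \<open>g \<circ> f\<close> for
  \<open>f\<close> in \<open>Mor(x,y)\<close> and \<open>g\<close> in \<open>Mor(y,z)\<close>, and \<open>fmor F x y\<close> is the map usually written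
  \<open>F\<^bsub>x,y\<^esub>\<close>.
\<close>

record ('o, 'm) cat =
  Obj :: "'o set"
  Hom :: "'o \<Rightarrow> 'o \<Rightarrow> 'm set"
  Comp :: "'o \<Rightarrow> 'o \<Rightarrow> 'o \<Rightarrow> 'm \<Rightarrow> 'm \<Rightarrow> 'm"
  Id :: "'o \<Rightarrow> 'm"

locale category =
  fixes C :: "('o, 'm) cat"
  assumes Id_in_Hom: "x \<in> Obj C \<Longrightarrow> Id C x \<in> Hom C x x"
    and Comp_in_Hom:
      "\<lbrakk>x \<in> Obj C; y \<in> Obj C; z \<in> Obj C; f \<in> Hom C x y; g \<in> Hom C y z\<rbrakk>
        \<Longrightarrow> Comp C x y z g f \<in> Hom C x z"
    and Comp_Id_right:
      "\<lbrakk>x \<in> Obj C; y \<in> Obj C; f \<in> Hom C x y\<rbrakk> \<Longrightarrow> Comp C x x y f (Id C x) = f"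
    and Comp_Id_left:
      "\<lbrakk>x \<in> Obj C; y \<in> Obj C; f \<in> Hom C x y\<rbrakk> \<Longrightarrow> Comp C x y y (Id C y) f = f"
    and Comp_assoc:
      "\<lbrakk>w \<in> Obj C; x \<in> Obj C; y \<in> Obj C; z \<in> Obj C;
        f \<in> Hom C w x; g \<in> Hom C x y; h \<in> Hom C y z\<rbrakk>
        \<Longrightarrow> Comp C w y z h (Comp C w x y g f) = Comp C w x z (Comp C x y z h g) f"

definition inverse_mor :: "('o, 'm) cat \<Rightarrow> 'o \<Rightarrow> 'o \<Rightarrow> 'm \<Rightarrow> 'm \<Rightarrow> bool" where
  "inverse_mor C x y f g \<longleftrightarrow>
     f \<in> Hom C x y \<and> g \<in> Hom C y x \<and>
     Comp C x y x g f = Id C x \<and> Comp C y x y f g = Id C y"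

definition Iso :: "('o, 'm) cat \<Rightarrow> 'o \<Rightarrow> 'o \<Rightarrow> 'm set" where
  "Iso C x y = {f. \<exists>g. inverse_mor C x y f g}"

text \<open>
  The carrier consists of all endomorphisms. In fusion systems and in transporter systems these
  are all invertible, so that this is the automorphism group.
\<close>

definition Aut :: "('o, 'm) cat \<Rightarrow> 'o \<Rightarrow> 'm monoid" where
  "Aut C x = \<lparr>carrier = Hom C x x, monoid.mult = Comp C x x x, one = Id C x\<rparr>"

record ('o, 'm, 'p, 'n) func =
  fobj :: "'o \<Rightarrow> 'p"
  fmor :: "'o \<Rightarrow> 'o \<Rightarrow> 'm \<Rightarrow> 'n"

text \<open>
  Functors are normalized to be \<^const>\<open>undefined\<close> outside their source category, so that two
  functors with the same source are equal as records iff they agree on all objects and morphisms.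
\<close>

definition restrict_func :: "('o, 'm) cat \<Rightarrow> ('o, 'm, 'p, 'n) func \<Rightarrow> ('o, 'm, 'p, 'n) func" where
  "restrict_func C F =
     \<lparr>fobj = restrict (fobj F) (Obj C),
      fmor = (\<lambda>x y f. if x \<in> Obj C \<and> y \<in> Obj C \<and> f \<in> Hom C x y then fmor F x y f else undefined)\<rparr>"

locale cat_functor = source: category C + target: category D
  for C :: "('o, 'm) cat" and D :: "('p, 'n) cat" +
  fixes F :: "('o, 'm, 'p, 'n) func"
  assumes normalized: "restrict_func C F = F"
    and fobj_in_Obj: "x \<in> Obj C \<Longrightarrow> fobj F x \<in> Obj D"
    and fmor_in_Hom:
      "\<lbrakk>x \<in> Obj C; y \<in> Obj C; f \<in> Hom C x y\<rbrakk>
        \<Longrightarrow> fmor F x y f \<in> Hom D (fobj F x) (fobj F y)"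
    and fmor_Id: "x \<in> Obj C \<Longrightarrow> fmor F x x (Id C x) = Id D (fobj F x)"
    and fmor_Comp:
      "\<lbrakk>x \<in> Obj C; y \<in> Obj C; z \<in> Obj C; f \<in> Hom C x y; g \<in> Hom C y z\<rbrakk>
        \<Longrightarrow> fmor F x z (Comp C x y z g f) =
            Comp D (fobj F x) (fobj F y) (fobj F z) (fmor F y z g) (fmor F x y f)"

definition id_func :: "('o, 'm) cat \<Rightarrow> ('o, 'm, 'o, 'm) func" where
  "id_func C = restrict_func C \<lparr>fobj = (\<lambda>x. x), fmor = (\<lambda>x y f. f)\<rparr>"

definition comp_func ::
    "('o, 'm) cat \<Rightarrow> ('p, 'n, 'q, 'r) func \<Rightarrow> ('o, 'm, 'p, 'n) func \<Rightarrow> ('o, 'm, 'q, 'r) func" where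
  "comp_func C G F = restrict_func C
     \<lparr>fobj = (\<lambda>x. fobj G (fobj F x)),
      fmor = (\<lambda>x y f. fmor G (fobj F x) (fobj F y) (fmor F x y f))\<rparr>"

definition natural_iso ::
    "('o, 'm) cat \<Rightarrow> ('p, 'n) cat \<Rightarrow> ('o, 'm, 'p, 'n) func \<Rightarrow> ('o, 'm, 'p, 'n) func
      \<Rightarrow> ('o \<Rightarrow> 'n) \<Rightarrow> bool" where
  "natural_iso C D F G \<eta> \<longleftrightarrow>
     (\<forall>x\<in>Obj C. \<eta> x \<in> Iso D (fobj F x) (fobj G x)) \<and>
     (\<forall>x\<in>Obj C. \<forall>y\<in>Obj C. \<forall>f\<in>Hom C x y.
        Comp D (fobj F x) (fobj F y) (fobj G y) (\<eta> y) (fmor F x y f) =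
        Comp D (fobj F x) (fobj G x) (fobj G y) (fmor G x y f) (\<eta> x))"

definition cat_equivalence ::
    "('o, 'm) cat \<Rightarrow> ('p, 'n) cat \<Rightarrow> ('o, 'm, 'p, 'n) func \<Rightarrow> bool" where
  "cat_equivalence C D F \<longleftrightarrow>
     cat_functor C D F \<and>
     (\<exists>G \<eta> \<epsilon>. cat_functor D C G \<and>
        natural_iso C C (id_func C) (comp_func C G F) \<eta> \<and>
        natural_iso D D (comp_func D F G) (id_func D) \<epsilon>)"

definition same_cat :: "('o, 'm) cat \<Rightarrow> ('o, 'm) cat \<Rightarrow> bool" where
  "same_cat C D \<longleftrightarrow>
     Obj C = Obj D \<and>
     (\<forall>x\<in>Obj C. \<forall>y\<in>Obj C. Hom C x y = Hom D x y) \<and>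
     (\<forall>x\<in>Obj C. Id C x = Id D x) \<and>
     (\<forall>x\<in>Obj C. \<forall>y\<in>Obj C. \<forall>z\<in>Obj C. \<forall>f\<in>Hom C x y. \<forall>g\<in>Hom C y z.
        Comp C x y z g f = Comp D x y z g f)"

definition is_identity_functor ::
    "('o, 'm) cat \<Rightarrow> ('o, 'm) cat \<Rightarrow> ('o, 'm, 'o, 'm) func \<Rightarrow> bool" where
  "is_identity_functor C D F \<longleftrightarrow> same_cat C D \<and> F = id_func C"

section \<open>Finite groups\<close>

definition finite_p_group :: "nat \<Rightarrow> 'a monoid \<Rightarrow> bool" where
  "finite_p_group p G \<longleftrightarrow> group G \<and> (\<exists>n. order G = p ^ n)"

definition sylow_subgroup :: "nat \<Rightarrow> 'a set \<Rightarrow> 'a monoid \<Rightarrow> bool" where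
  "sylow_subgroup p H G \<longleftrightarrow> subgroup H G \<and> card H = p ^ multiplicity p (order G)"

text \<open>\<open>O\<^sub>p(G)\<close>, the subgroup generated by all normal \<open>p\<close>-subgroups.\<close>

definition p_core :: "nat \<Rightarrow> 'a monoid \<Rightarrow> 'a set" where
  "p_core p G = generate G (\<Union>{N. N \<lhd> G \<and> (\<exists>n. card N = p ^ n)})"

definition centralizer :: "'a monoid \<Rightarrow> 'a set \<Rightarrow> 'a set" where
  "centralizer G Q = {g \<in> carrier G. \<forall>x\<in>Q. g \<otimes>\<^bsub>G\<^esub> x = x \<otimes>\<^bsub>G\<^esub> g}"

definition same_group :: "'a monoid \<Rightarrow> 'a monoid \<Rightarrow> bool" where
  "same_group G H \<longleftrightarrow>
     carrier G = carrier H \<and> (\<forall>x\<in>carrier G. \<forall>y\<in>carrier G. x \<otimes>\<^bsub>G\<^esub> y = x \<otimes>\<^bsub>H\<^esub> y)"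

definition conj_map :: "'a monoid \<Rightarrow> 'a set \<Rightarrow> 'a \<Rightarrow> 'a \<Rightarrow> 'a" where
  "conj_map S P g = (\<lambda>x\<in>P. g \<otimes>\<^bsub>S\<^esub> x \<otimes>\<^bsub>S\<^esub> inv\<^bsub>S\<^esub> g)"

text \<open>\<open>N\<^sub>S(P,Q)\<close>; for \<open>P = Q\<close> a subgroup of a finite group it is the normalizer.\<close>

definition transporter :: "'a monoid \<Rightarrow> 'a set \<Rightarrow> 'a set \<Rightarrow> 'a set" where
  "transporter S P Q = {s \<in> carrier S. conj_map S P s ` P \<subseteq> Q}"

definition transporter_cat :: "'a monoid \<Rightarrow> 'a set set \<Rightarrow> ('a set, 'a) cat" where
  "transporter_cat S \<Delta> =
     \<lparr>Obj = \<Delta>, Hom = transporter S, Comp = (\<lambda>P Q R g f. g \<otimes>\<^bsub>S\<^esub> f), Id = (\<lambda>P. \<one>\<^bsub>S\<^esub>)\<rparr>"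

section \<open>Saturated fusion systems\<close>

text \<open>
  A fusion system is given by its hom-sets \<open>\<F> P Q\<close>, for subgroups \<open>P\<close>, \<open>Q\<close> of \<open>S\<close>. Morphisms
  are functions which are \<^const>\<open>undefined\<close> outside \<open>P\<close>.
\<close>

type_synonym 'a fusion = "'a set \<Rightarrow> 'a set \<Rightarrow> ('a \<Rightarrow> 'a) set"

definition fusion_cat :: "'a monoid \<Rightarrow> 'a fusion \<Rightarrow> ('a set, 'a \<Rightarrow> 'a) cat" where
  "fusion_cat S \<F> =
     \<lparr>Obj = {P. subgroup P S}, Hom = \<F>,
      Comp = (\<lambda>P Q R g f. compose P g f), Id = (\<lambda>P. \<lambda>x\<in>P. x)\<rparr>"

locale fusion_system =
  fixes p :: nat and S :: "'a monoid" and \<F> :: "'a fusion"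
  assumes prime_p: "Factorial_Ring.prime p"
    and p_group: "finite_p_group p S"
    and injective_hom:
      "\<lbrakk>subgroup P S; subgroup Q S; \<phi> \<in> \<F> P Q\<rbrakk>
        \<Longrightarrow> \<phi> \<in> hom (S\<lparr>carrier := P\<rparr>) (S\<lparr>carrier := Q\<rparr>) \<and> inj_on \<phi> P \<and> \<phi> \<in> extensional P"
    and conj_map_in:
      "\<lbrakk>subgroup P S; subgroup Q S; s \<in> transporter S P Q\<rbrakk> \<Longrightarrow> conj_map S P s \<in> \<F> P Q"
    and compose_in:
      "\<lbrakk>subgroup P S; subgroup Q S; subgroup R S; \<phi> \<in> \<F> P Q; \<psi> \<in> \<F> Q R\<rbrakk>
        \<Longrightarrow> compose P \<psi> \<phi> \<in> \<F> P R"
    and onto_image_in: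
      "\<lbrakk>subgroup P S; subgroup Q S; \<phi> \<in> \<F> P Q\<rbrakk> \<Longrightarrow> \<phi> \<in> \<F> P (\<phi> ` P)"
    and inverse_in:
      "\<lbrakk>subgroup P S; subgroup Q S; \<phi> \<in> \<F> P Q\<rbrakk>
        \<Longrightarrow> restrict (inv_into P \<phi>) (\<phi> ` P) \<in> \<F> (\<phi> ` P) P"

definition Iso\<^sub>F :: "'a monoid \<Rightarrow> 'a fusion \<Rightarrow> 'a set \<Rightarrow> 'a set \<Rightarrow> ('a \<Rightarrow> 'a) set" where
  "Iso\<^sub>F S \<F> = Iso (fusion_cat S \<F>)"

definition Aut\<^sub>F :: "'a monoid \<Rightarrow> 'a fusion \<Rightarrow> 'a set \<Rightarrow> ('a \<Rightarrow> 'a) monoid" where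
  "Aut\<^sub>F S \<F> = Aut (fusion_cat S \<F>)"

definition Aut\<^sub>S :: "'a monoid \<Rightarrow> 'a set \<Rightarrow> ('a \<Rightarrow> 'a) set" where
  "Aut\<^sub>S S P = conj_map S P ` transporter S P P"

definition Inn :: "'a monoid \<Rightarrow> 'a set \<Rightarrow> ('a \<Rightarrow> 'a) set" where
  "Inn S P = conj_map S P ` P"

definition F_conjugate :: "'a monoid \<Rightarrow> 'a fusion \<Rightarrow> 'a set \<Rightarrow> 'a set \<Rightarrow> bool" where
  "F_conjugate S \<F> P Q \<longleftrightarrow> subgroup P S \<and> subgroup Q S \<and> Iso\<^sub>F S \<F> P Q \<noteq> {}"

definition fully_automized :: "nat \<Rightarrow> 'a monoid \<Rightarrow> 'a fusion \<Rightarrow> 'a set \<Rightarrow> bool" where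
  "fully_automized p S \<F> P \<longleftrightarrow> sylow_subgroup p (Aut\<^sub>S S P) (Aut\<^sub>F S \<F> P)"

text \<open>For \<open>\<phi>\<close> in \<open>Iso\<^sub>F(Q,P)\<close>, the set \<open>N\<^sub>\<phi>\<close> of all \<open>g\<close> in \<open>N\<^sub>S(Q)\<close> with
  \<open>\<phi> c\<^sub>g \<phi>\<^sup>-\<^sup>1\<close> in \<open>Aut\<^sub>S(P)\<close>.\<close>

definition extension_domain :: "'a monoid \<Rightarrow> 'a set \<Rightarrow> 'a set \<Rightarrow> ('a \<Rightarrow> 'a) \<Rightarrow> 'a set" where
  "extension_domain S Q P \<phi> =
     {g \<in> transporter S Q Q. (\<lambda>x\<in>P. \<phi> (conj_map S Q g (inv_into Q \<phi> x))) \<in> Aut\<^sub>S S P}"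

definition receptive :: "'a monoid \<Rightarrow> 'a fusion \<Rightarrow> 'a set \<Rightarrow> bool" where
  "receptive S \<F> P \<longleftrightarrow>
     (\<forall>Q \<phi>. subgroup Q S \<longrightarrow> \<phi> \<in> Iso\<^sub>F S \<F> Q P \<longrightarrow>
        (\<exists>\<psi> \<in> \<F> (extension_domain S Q P \<phi>) (carrier S). \<forall>x\<in>Q. \<psi> x = \<phi> x))"

locale saturated_fusion_system = fusion_system +
  assumes saturated:
    "subgroup P S \<Longrightarrow>
       \<exists>Q. F_conjugate S \<F> P Q \<and> fully_automized p S \<F> Q \<and> receptive S \<F> Q"

definition F_centric :: "'a monoid \<Rightarrow> 'a fusion \<Rightarrow> 'a set \<Rightarrow> bool" where
  "F_centric S \<F> P \<longleftrightarrow> (\<forall>Q. F_conjugate S \<F> P Q \<longrightarrow> centralizer S Q \<subseteq> Q)"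

definition F_radical :: "nat \<Rightarrow> 'a monoid \<Rightarrow> 'a fusion \<Rightarrow> 'a set \<Rightarrow> bool" where
  "F_radical p S \<F> P \<longleftrightarrow>
     p_core p (Aut\<^sub>F S \<F> P Mod Inn S P) = {\<one>\<^bsub>Aut\<^sub>F S \<F> P Mod Inn S P\<^esub>}"

definition centric_radicals :: "nat \<Rightarrow> 'a monoid \<Rightarrow> 'a fusion \<Rightarrow> 'a set set" where
  "centric_radicals p S \<F> = {P. subgroup P S \<and> F_centric S \<F> P \<and> F_radical p S \<F> P}"

definition fusion_morphism ::
    "'a monoid \<Rightarrow> 'a fusion \<Rightarrow> 'b monoid \<Rightarrow> 'b fusion
      \<Rightarrow> ('a \<Rightarrow> 'b) \<Rightarrow> ('a set, 'a \<Rightarrow> 'a, 'b set, 'b \<Rightarrow> 'b) func \<Rightarrow> bool" where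
  "fusion_morphism S \<F> S' \<F>' \<gamma> \<Phi> \<longleftrightarrow>
     \<gamma> \<in> hom S S' \<and> \<gamma> \<in> extensional (carrier S) \<and>
     cat_functor (fusion_cat S \<F>) (fusion_cat S' \<F>') \<Phi> \<and>
     (\<forall>P. subgroup P S \<longrightarrow> fobj \<Phi> P = \<gamma> ` P) \<and>
     (\<forall>P Q. subgroup P S \<longrightarrow> subgroup Q S \<longrightarrow>
        (\<forall>\<phi>\<in>\<F> P Q. \<forall>x\<in>P. fmor \<Phi> P Q \<phi> (\<gamma> x) = \<gamma> (\<phi> x)))"

definition fusion_isomorphism ::
    "'a monoid \<Rightarrow> 'a fusion \<Rightarrow> 'b monoid \<Rightarrow> 'b fusion
      \<Rightarrow> ('a \<Rightarrow> 'b) \<Rightarrow> ('a set, 'a \<Rightarrow> 'a, 'b set, 'b \<Rightarrow> 'b) func \<Rightarrow> bool" where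
  "fusion_isomorphism S \<F> S' \<F>' \<gamma> \<Phi> \<longleftrightarrow>
     fusion_morphism S \<F> S' \<F>' \<gamma> \<Phi> \<and>
     (\<exists>\<gamma>' \<Phi>'. fusion_morphism S' \<F>' S \<F> \<gamma>' \<Phi>' \<and>
        compose (carrier S) \<gamma>' \<gamma> = (\<lambda>x\<in>carrier S. x) \<and>
        compose (carrier S') \<gamma> \<gamma>' = (\<lambda>x\<in>carrier S'. x) \<and>
        comp_func (fusion_cat S \<F>) \<Phi>' \<Phi> = id_func (fusion_cat S \<F>) \<and>
        comp_func (fusion_cat S' \<F>') \<Phi> \<Phi>' = id_func (fusion_cat S' \<F>'))"

section \<open>Transporter systems\<close>

locale transporter_system = saturated_fusion_system p S \<F> + category T
  for p :: nat and S :: "'a monoid" and \<F> :: "'a fusion" and T :: "('a set, 'm) cat" +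
  fixes \<Delta> :: "'a set set"
    and \<delta> :: "('a set, 'a, 'a set, 'm) func"
    and \<pi> :: "('a set, 'm, 'a set, 'a \<Rightarrow> 'a) func"
    and E :: "'a set \<Rightarrow> 'm set"
  defines "E P \<equiv> {e \<in> Hom T P P. fmor \<pi> P P e = (\<lambda>x\<in>P. x)}"
  assumes Obj_T: "Obj T = \<Delta>"
    and nonempty: "\<Delta> \<noteq> {}"
    and finite_Hom: "\<lbrakk>P \<in> \<Delta>; Q \<in> \<Delta>\<rbrakk> \<Longrightarrow> finite (Hom T P Q)"
    and functor_delta: "cat_functor (transporter_cat S \<Delta>) T \<delta>"
    and functor_pi: "cat_functor T (fusion_cat S \<F>) \<pi>"
    and A1_subgroups: "P \<in> \<Delta> \<Longrightarrow> subgroup P S"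
    and A1_conjugates: "\<lbrakk>P \<in> \<Delta>; F_conjugate S \<F> P Q\<rbrakk> \<Longrightarrow> Q \<in> \<Delta>"
    and A1_overgroups: "\<lbrakk>P \<in> \<Delta>; subgroup Q S; P \<subseteq> Q\<rbrakk> \<Longrightarrow> Q \<in> \<Delta>"
    and A1_delta: "P \<in> \<Delta> \<Longrightarrow> fobj \<delta> P = P"
    and A1_pi: "P \<in> \<Delta> \<Longrightarrow> fobj \<pi> P = P"
    and A2_free_right:
      "\<lbrakk>P \<in> \<Delta>; Q \<in> \<Delta>; \<phi> \<in> Hom T P Q; e \<in> E P; Comp T P P Q \<phi> e = \<phi>\<rbrakk> \<Longrightarrow> e = Id T P"
    and A2_surjective:
      "\<lbrakk>P \<in> \<Delta>; Q \<in> \<Delta>\<rbrakk> \<Longrightarrow> fmor \<pi> P Q ` Hom T P Q = \<F> P Q"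
    and A2_orbits:
      "\<lbrakk>P \<in> \<Delta>; Q \<in> \<Delta>; \<phi> \<in> Hom T P Q; \<psi> \<in> Hom T P Q\<rbrakk>
        \<Longrightarrow> fmor \<pi> P Q \<phi> = fmor \<pi> P Q \<psi> \<longleftrightarrow> (\<exists>e\<in>E P. \<psi> = Comp T P P Q \<phi> e)"
    and A2_free_left:
      "\<lbrakk>P \<in> \<Delta>; Q \<in> \<Delta>; \<phi> \<in> Hom T P Q; e \<in> E Q; Comp T P Q Q e \<phi> = \<phi>\<rbrakk> \<Longrightarrow> e = Id T Q"
    and B_injective: "\<lbrakk>P \<in> \<Delta>; Q \<in> \<Delta>\<rbrakk> \<Longrightarrow> inj_on (fmor \<delta> P Q) (transporter S P Q)"
    and B_conj:
      "\<lbrakk>P \<in> \<Delta>; Q \<in> \<Delta>; g \<in> transporter S P Q\<rbrakk>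
        \<Longrightarrow> fmor \<pi> P Q (fmor \<delta> P Q g) = conj_map S P g"
    and C:
      "\<lbrakk>P \<in> \<Delta>; Q \<in> \<Delta>; \<phi> \<in> Hom T P Q; g \<in> P\<rbrakk>
        \<Longrightarrow> Comp T P P Q \<phi> (fmor \<delta> P P g) =
            Comp T P Q Q (fmor \<delta> Q Q (fmor \<pi> P Q \<phi> g)) \<phi>"
    and I: "sylow_subgroup p (fmor \<delta> (carrier S) (carrier S) ` carrier S) (Aut T (carrier S))"
    and II:
      "\<lbrakk>P \<in> \<Delta>; Q \<in> \<Delta>; inverse_mor T P Q \<phi> \<psi>;
        subgroup P' S; P \<lhd> S\<lparr>carrier := P'\<rparr>; subgroup Q' S; Q \<lhd> S\<lparr>carrier := Q'\<rparr>;
        (\<lambda>g. Comp T Q P Q (Comp T P P Q \<phi> (fmor \<delta> P P g)) \<psi>) ` P' \<subseteq> fmor \<delta> Q Q ` Q'\<rbrakk>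
        \<Longrightarrow> \<exists>\<phi>'\<in>Hom T P' Q'.
              Comp T P P' Q' \<phi>' (fmor \<delta> P P' \<one>\<^bsub>S\<^esub>) =
              Comp T P Q Q' (fmor \<delta> Q Q' \<one>\<^bsub>S\<^esub>) \<phi>"

text \<open>
  The inclusion \<open>\<alpha>(P) \<le> \<alpha>(Q)\<close> is implicit in the requirement that the image of
  \<open>\<delta>\<^bsub>P,Q\<^esub>(1)\<close> is \<open>\<delta>'\<^bsub>\<alpha>(P),\<alpha>(Q)\<^esub>(1)\<close>.
\<close>

definition transporter_isomorphism ::
    "'a monoid \<Rightarrow> ('a set, 'm) cat \<Rightarrow> ('a set, 'a, 'a set, 'm) func \<Rightarrow>
     'b monoid \<Rightarrow> ('b set, 'n) cat \<Rightarrow> ('b set, 'b, 'b set, 'n) func \<Rightarrow>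
     ('a set, 'm, 'b set, 'n) func \<Rightarrow> bool" where
  "transporter_isomorphism S T \<delta> S' T' \<delta>' \<alpha> \<longleftrightarrow>
     cat_equivalence T T' \<alpha> \<and>
     (\<forall>P\<in>Obj T. fmor \<alpha> P P ` fmor \<delta> P P ` P = fmor \<delta>' (fobj \<alpha> P) (fobj \<alpha> P) ` fobj \<alpha> P) \<and>
     (\<forall>P\<in>Obj T. \<forall>Q\<in>Obj T. P \<subseteq> Q \<longrightarrow>
        fobj \<alpha> P \<subseteq> fobj \<alpha> Q \<and>
        fmor \<alpha> P Q (fmor \<delta> P Q \<one>\<^bsub>S\<^esub>) = fmor \<delta>' (fobj \<alpha> P) (fobj \<alpha> Q) \<one>\<^bsub>S'\<^esub>)"

text \<open>
  The equation \<open>\<alpha>(S) = S\<close> is implicit in viewing \<open>\<alpha>\<^sub>S \<circ> \<delta>\<^sub>S\<close> as a map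
  to \<open>Aut\<^bsub>T'\<^esub>(S)\<close>.
\<close>

definition rigid ::
    "'a monoid \<Rightarrow> ('a set, 'a, 'a set, 'm) func \<Rightarrow> 'a monoid \<Rightarrow> ('a set, 'a, 'a set, 'n) func \<Rightarrow>
     ('a set, 'm, 'a set, 'n) func \<Rightarrow> bool" where
  "rigid S \<delta> S' \<delta>' \<alpha> \<longleftrightarrow>
     same_group S S' \<and> fobj \<alpha> (carrier S) = carrier S \<and>
     (\<forall>g\<in>carrier S.
        fmor \<alpha> (carrier S) (carrier S) (fmor \<delta> (carrier S) (carrier S) g) =
        fmor \<delta>' (carrier S) (carrier S) g)"

text \<open>
  \<open>B\<close> stands for the functor \<open>\<beta>\<^sub>*\<close>, and \<open>c\<^sub>\<beta>\<close> is the pair of the group isomorphism \<open>\<beta>\<close> and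
  the functor \<open>c\<close>. The equation \<open>\<beta>\<^sub>*(S) = S'\<close> is implicit in \<open>\<beta> = (\<beta>\<^sub>*)\<^sub>S\<close>.
\<close>

definition induced_isomorphisms ::
    "'a monoid \<Rightarrow> 'a fusion \<Rightarrow> 'a set set \<Rightarrow> ('a set, 'm) cat \<Rightarrow>
     ('a set, 'a, 'a set, 'm) func \<Rightarrow> ('a set, 'm, 'a set, 'a \<Rightarrow> 'a) func \<Rightarrow>
     'b monoid \<Rightarrow> 'b fusion \<Rightarrow> 'b set set \<Rightarrow>
     ('b set, 'b, 'b set, 'n) func \<Rightarrow> ('b set, 'n, 'b set, 'b \<Rightarrow> 'b) func \<Rightarrow>
     ('a set, 'm, 'b set, 'n) func \<Rightarrow>
     ('a \<Rightarrow> 'b) \<Rightarrow> ('a set, 'a, 'b set, 'b) func \<Rightarrow> ('a set, 'a \<Rightarrow> 'a, 'b set, 'b \<Rightarrow> 'b) func \<Rightarrow> bool"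
  where
  "induced_isomorphisms S \<F> \<Delta> T \<delta> \<pi> S' \<F>' \<Delta>' \<delta>' \<pi>' \<alpha> \<beta> B c \<longleftrightarrow>
     \<beta> \<in> iso S S' \<and> \<beta> \<in> extensional (carrier S) \<and>
     cat_functor (transporter_cat S \<Delta>) (transporter_cat S' \<Delta>') B \<and>
     fusion_isomorphism S \<F> S' \<F>' \<beta> c \<and>
     comp_func (transporter_cat S \<Delta>) \<delta>' B = comp_func (transporter_cat S \<Delta>) \<alpha> \<delta> \<and>
     comp_func T \<pi>' \<alpha> = comp_func T c \<pi> \<and>
     fobj B (carrier S) = carrier S' \<and> \<beta> = fmor B (carrier S) (carrier S)"

end

theory Submission
  imports Defs "HOL-Algebra.Group_Action"
begin

text \<open>
  Since the inclusions into \<open>S\<close> are monomorphisms of \<open>T\<close>, a morphism \<open>\<delta>\<^bsub>P,Q\<^esub>(g)\<close> is determined by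
  \<open>\<delta>\<^sub>S(g)\<close>. So everything is dictated by the homomorphism \<open>\<beta>\<close> that \<open>\<alpha>\<close> induces between
  \<open>\<delta>\<^sub>S(S)\<close> and \<open>\<delta>'\<^sub>S(S')\<close>. A cardinality argument gives \<open>\<alpha>(S) = S'\<close>, isotypicality and faithfulness of \<open>\<alpha>\<close>
  make \<open>\<beta>\<close> an isomorphism, and comparing the two factorizations of \<open>\<delta>\<^bsub>P,S\<^esub>(g)\<close>, through \<open>Q\<close> and through \<open>S\<close>,
  gives \<open>\<alpha>(P) = \<beta>(P)\<close> and \<open>\<alpha>(\<delta>\<^bsub>P,Q\<^esub>(g)) = \<delta>'\<^bsub>\<beta>(P),\<beta>(Q)\<^esub>(\<beta>(g))\<close> (\<open>\<alpha>_obj_eq\<close>, \<open>\<alpha>_delta\<close>); the common factor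
  is cancelled because all morphisms of a transporter system are monomorphisms. Therefore
  \<open>\<beta>\<^sub>*\<close> is application of \<open>\<beta>\<close> to subgroups and elements.

  Axiom (C) characterizes \<open>\<pi>(\<phi>)\<close> by how \<open>\<phi>\<close> intertwines the elements \<open>\<delta>\<^sub>P(g)\<close>. Applying
  \<open>\<alpha>\<close> to this relation shows that \<open>\<pi>'(\<alpha>(\<phi>)) = \<beta> \<pi>(\<phi>) \<beta>\<^sup>-\<^sup>1\<close> (\<open>\<pi>_\<alpha>_apply\<close>), so conjugation by
  \<open>\<beta>\<close> maps \<open>\<F>\<close> to \<open>\<F>'\<close> on the morphisms between members of \<open>\<Delta>\<close>.

  The remaining point is that conjugation by \<open>\<beta>\<close> also maps the morphisms between subgroups
  outside \<open>\<Delta>\<close> to \<open>\<F>'\<close>. This is where \<open>\<F>\<^sup>c\<^sup>r \<subseteq> \<Delta>\<close> enters, through Alperin's fusion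
  theorem (\<open>alperin_fusion\<close>): a fusion system over \<open>S\<close> that contains the \<open>\<F>\<close>-automorphisms of the
  centric radical subgroups contains \<open>\<F>\<close>. It is applied to the pullback of \<open>\<F>'\<close> along \<open>\<beta>\<close>,
  and then with the two sides exchanged, which is possible since
  \<open>\<Delta>' = \<beta>(\<Delta>)\<close> and \<open>\<alpha>\<close> is full. Alperin's theorem is proved below by downward induction on the order
  of the subgroup; the group theory it rests on, namely Sylow's second theorem and the growth of
  normalizers in \<open>p\<close>-groups, comes from counting the fixed points of a \<open>p\<close>-group on a coset space.
\<close>

section \<open>Actions of p-groups on cosets\<close>

text \<open>An orbit that consists of moved points has more than one element, and its length divides the
  order of the \<open>p\<close>-group, so it is a multiple of \<open>p\<close>. Every other orbit is a single fixed point.\<close>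

lemma (in group_action) p_dvd_card_moved_points:
  assumes p: "Factorial_Ring.prime (p::nat)" and G: "order G = p ^ n" and E: "finite E"
  shows "p dvd card {x\<in>E. \<exists>g\<in>carrier G. \<phi> g x \<noteq> x}"
proof -
  interpret gh: group_hom G "BijGroup E" \<phi> by (rule group_hom)
  let ?f = "\<lambda>x. if \<exists>g\<in>carrier G. \<phi> g x \<noteq> x then 1 else (0::nat)"
  have "p dvd (\<Sum>x\<in>X. ?f x)" if X: "X \<in> orbits G E \<phi>" for X
  proof -
    obtain y where y: "y \<in> E" "X = orbit G \<phi> y" using X unfolding orbits_def by auto
    have OE: "X \<subseteq> E" using y element_image unfolding orbit_def by auto
    then have fin: "finite X" using E finite_subset by auto
    have yO: "y \<in> X" using y orbit_refl by simp
    show ?thesis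
    proof (cases "\<exists>x\<in>X. \<forall>g\<in>carrier G. \<phi> g x = x")
      case True
      then obtain x where x: "x \<in> X" "\<And>g. g \<in> carrier G \<Longrightarrow> \<phi> g x = x" by blast
      have "X = {x}"
      proof -
        have "z = x" if "z \<in> X" for z
        proof -
          have "z \<in> orbit G \<phi> x"
            using that x y OE by (metis (full_types) orbit_sym orbit_trans subsetD)
          then show ?thesis using x(2) unfolding orbit_def by auto
        qed
        then show ?thesis using x(1) by blast
      qed
      moreover have "\<not> (\<exists>g\<in>carrier G. \<phi> g x \<noteq> x)" using x(2) by blast
      ultimately show ?thesis by simp
    next
      case False
      then have "(\<Sum>x\<in>X. ?f x) = card X" by simp
      moreover have "p dvd card X"
      proof -
        have "card X dvd p ^ n"
          using orbit_stabilizer_theorem[OF y(1)] G y(2) by (metis dvd_triv_left)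
        then obtain k where k: "card X = p ^ k" using divides_primepow_nat[OF p] by blast
        have "k \<noteq> 0"
        proof
          assume "k = 0"
          then have "card X = 1" using k by simp
          then have "X = {y}" using yO by (metis card_1_singletonE singletonD)
          then have "\<forall>g\<in>carrier G. \<phi> g y = y" using y(2) unfolding orbit_def by blast
          then show False using False yO by blast
        qed
        then show ?thesis using k by simp
      qed
      ultimately show ?thesis by simp
    qed
  qed
  then have "p dvd (\<Sum>X\<in>orbits G E \<phi>. \<Sum>x\<in>X. ?f x)" by (rule dvd_sum)
  moreover have "(\<Sum>x\<in>E. ?f x) = card {x\<in>E. \<exists>g\<in>carrier G. \<phi> g x \<noteq> x}"
    using E by (simp add: sum.If_cases Int_def)
  ultimately show ?thesis using disjoint_sum[OF E, of ?f] by simp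
qed

text \<open>Right translation by \<open>h x\<close> is a right action on the cosets \<open>K g\<close>; the inverse turns it
  into a left action.\<close>

lemma (in group) coset_action:
  assumes K: "subgroup K G" and H: "group H" and h: "h \<in> hom H G"
  shows "group_action H (rcosets K) (\<lambda>x. \<lambda>C\<in>rcosets K. C #> inv (h x))"
proof -
  interpret H: group H by fact
  interpret h: group_hom H G h using h by unfold_locales
  have sub: "C \<subseteq> carrier G" if "C \<in> rcosets K" for C
    using that subgroup.rcosets_carrier[OF K is_group] by blast
  have cl: "C #> g \<in> rcosets K" if C: "C \<in> rcosets K" and g: "g \<in> carrier G" for C g
  proof -
    obtain a where a: "a \<in> carrier G" "C = K #> a" using C by (auto simp: RCOSETS_def)
    have "C #> g = K #> (a \<otimes> g)" using a that K by (simp add: coset_mult_assoc subgroup.subset)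
    then show ?thesis using a that K by (simp add: rcosetsI subgroup.subset)
  qed
  have as: "C #> a #> b = C #> (a \<otimes> b)"
    if "C \<in> rcosets K" "a \<in> carrier G" "b \<in> carrier G" for C a b
    using coset_mult_assoc sub that by blast
  have bij: "(\<lambda>C\<in>rcosets K. C #> inv (h x)) \<in> Bij (rcosets K)" if "x \<in> carrier H" for x
  proof -
    have "bij_betw (\<lambda>C\<in>rcosets K. C #> inv (h x)) (rcosets K) (rcosets K)"
      by (rule bij_betw_byWitness[where f' = "\<lambda>C. C #> h x"])
        (use that in \<open>auto simp: as cl sub\<close>)
    then show ?thesis by (auto simp: Bij_def)
  qed
  show ?thesis
    unfolding group_action_def
  proof (intro group_hom.intro group_hom_axioms.intro homI)
    fix x y assume x: "x \<in> carrier H" and y: "y \<in> carrier H"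
    show "(\<lambda>C\<in>rcosets K. C #> inv (h (x \<otimes>\<^bsub>H\<^esub> y))) =
        (\<lambda>C\<in>rcosets K. C #> inv (h x)) \<otimes>\<^bsub>BijGroup (rcosets K)\<^esub> (\<lambda>C\<in>rcosets K. C #> inv (h y))"
      using x y bij[OF x] bij[OF y]
      by (auto simp: BijGroup_def compose_def as cl inv_mult_group intro!: restrict_ext)
  qed (use bij in \<open>auto simp: BijGroup_def H group_BijGroup[unfolded BijGroup_def]\<close>)
qed

text \<open>The coset \<open>K g\<close> is fixed by right translation with \<open>h x\<close> iff \<open>g\<close> conjugates
  \<open>h x\<close> into \<open>K\<close>. So the fixed cosets are those of the elements that conjugate the whole image
  of \<open>h\<close> into \<open>K\<close>.\<close>

lemma (in group) p_dvd_card_moved_cosets: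
  assumes p: "Factorial_Ring.prime (p::nat)" and fin: "finite (carrier G)" and K: "subgroup K G"
    and H: "group H" "order H = p ^ n" and h: "h \<in> hom H G"
  shows "p dvd card (rcosets K -
           {K #> g | g. g \<in> carrier G \<and> (\<forall>x\<in>carrier H. g \<otimes> h x \<otimes> inv g \<in> K)})"
proof -
  interpret H: group H by (rule H(1))
  interpret h: group_hom H G h using h by unfold_locales
  let ?\<phi> = "\<lambda>x. \<lambda>C\<in>rcosets K. C #> inv (h x)"
  interpret A: group_action H "rcosets K" ?\<phi> by (rule coset_action[OF K H(1) h])
  have KG: "K \<subseteq> carrier G" using K by (rule subgroup.subset)
  have fix_iff: "K #> g #> inv (h x) = K #> g \<longleftrightarrow> g \<otimes> h x \<otimes> inv g \<in> K"
    if "g \<in> carrier G" "x \<in> carrier H" for g x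
  proof -
    have "K #> g #> inv (h x) = K #> g \<longleftrightarrow> K #> (g \<otimes> inv (h x)) = K #> g"
      using that KG by (simp add: coset_mult_assoc)
    also have "\<dots> \<longleftrightarrow> g \<otimes> inv (g \<otimes> inv (h x)) \<in> K"
    proof
      assume "K #> (g \<otimes> inv (h x)) = K #> g"
      then have "g \<in> K #> (g \<otimes> inv (h x))" using that K rcos_self by metis
      then show "g \<otimes> inv (g \<otimes> inv (h x)) \<in> K"
        using that by (intro subgroup.rcos_module_imp[OF K is_group]) auto
    next
      assume "g \<otimes> inv (g \<otimes> inv (h x)) \<in> K"
      then have "g \<in> K #> (g \<otimes> inv (h x))"
        using that by (intro subgroup.rcos_module_rev[OF K is_group]) auto
      then show "K #> (g \<otimes> inv (h x)) = K #> g"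
        using that K repr_independence[of g K "g \<otimes> inv (h x)"] by simp
    qed
    finally show ?thesis using that by (simp add: inv_mult_group m_assoc)
  qed
  have "{C \<in> rcosets K. \<exists>x\<in>carrier H. ?\<phi> x C \<noteq> C} = rcosets K -
           {K #> g | g. g \<in> carrier G \<and> (\<forall>x\<in>carrier H. g \<otimes> h x \<otimes> inv g \<in> K)}"
    (is "?L = ?R")
  proof
    show "?L \<subseteq> ?R"
    proof
      fix C assume "C \<in> ?L"
      then have C: "C \<in> rcosets K" and "\<exists>x\<in>carrier H. ?\<phi> x C \<noteq> C" by blast+
      then obtain x where x: "x \<in> carrier H" "C #> inv (h x) \<noteq> C"
        using C by (metis restrict_apply')
      have "\<not> (g \<in> carrier G \<and> C = K #> g \<and> (\<forall>x\<in>carrier H. g \<otimes> h x \<otimes> inv g \<in> K))" for g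
        using x fix_iff by blast
      then show "C \<in> ?R" using C by blast
    qed
    show "?R \<subseteq> ?L" 
    proof
      fix C assume C: "C \<in> ?R"
      then obtain g where g: "g \<in> carrier G" "C = K #> g" unfolding RCOSETS_def by auto
      with C obtain x where "x \<in> carrier H" "g \<otimes> h x \<otimes> inv g \<notin> K" by blast
      then show "C \<in> ?L" using C g fix_iff by auto
    qed
  qed
  moreover have "finite (rcosets K)"
    using fin KG rcosets_part_G[OF K] by (metis finite_UnionD)
  ultimately show ?thesis using A.p_dvd_card_moved_points[OF p H(2)] by simp
qed

text \<open>The index of \<open>K\<close> is prime to \<open>p\<close>, so some coset is fixed. The \<open>p\<close>-group is given
  with a homomorphism instead of as a subgroup, because it is going to be a normalizer that
  acts by automorphisms.\<close>

lemma p_group_hom_conjugate_into_sylow: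
  fixes G (structure)
  assumes p: "Factorial_Ring.prime p" and G: "group G" "finite (carrier G)"
    and K: "sylow_subgroup p K G"
    and H: "group H" "order H = p ^ n" and h: "h \<in> hom H G"
  obtains g where "g \<in> carrier G" "\<And>x. x \<in> carrier H \<Longrightarrow> g \<otimes> h x \<otimes> inv g \<in> K"
proof -
  interpret group G by (rule G)
  have sK: "subgroup K G" and cK: "card K = p ^ multiplicity p (order G)"
    using K by (auto simp: sylow_subgroup_def)
  have o: "card (rcosets K) * card K = order G" by (rule lagrange[OF sK])
  have "\<not> p dvd card (rcosets K)"
  proof
    assume "p dvd card (rcosets K)"
    then have "p ^ Suc (multiplicity p (order G)) dvd order G"
      using o cK by (metis mult_dvd_mono dvd_refl power_Suc)
    moreover have "order G \<noteq> 0" using G(2) order_gt_0_iff_finite by simp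
    ultimately have "Suc (multiplicity p (order G)) \<le> multiplicity p (order G)"
      using p by (metis not_prime_unit power_dvd_iff_le_multiplicity)
    then show False by simp
  qed
  then have "rcosets K - {K #> g | g. g \<in> carrier G \<and> (\<forall>x\<in>carrier H. g \<otimes> h x \<otimes> inv g \<in> K)}
      \<noteq> rcosets K"
    using p_dvd_card_moved_cosets[OF p G(2) sK H h] by metis
  then show ?thesis using that by blast
qed

text \<open>Here \<open>R\<close> acts on its own cosets. Their number and the number of moved cosets are
  multiples of \<open>p\<close>, so besides \<open>R\<close> itself there is another fixed coset \<open>R g\<close>, and then \<open>g\<close> normalizes \<open>R\<close>.\<close>

lemma normalizer_grows:
  fixes S (structure)
  assumes p: "Factorial_Ring.prime p" and S: "finite_p_group p S"
    and R: "subgroup R S" "R \<noteq> carrier S"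
  obtains g where "g \<in> transporter S R R" "g \<notin> R"
proof -
  interpret group S using S by (simp add: finite_p_group_def)
  obtain n where n: "order S = p ^ n" using S by (auto simp: finite_p_group_def)
  then have fin: "finite (carrier S)"
    using p order_gt_0_iff_finite by (simp add: prime_gt_0_nat)
  have sub: "R \<subseteq> carrier S" using R subgroup.subset by blast
  have o: "card (rcosets R) * card R = p ^ n" using lagrange[OF R(1)] n by simp
  have "card R dvd p ^ n" using o by (metis dvd_triv_right)
  then obtain m where m: "card R = p ^ m" using divides_primepow_nat[OF p] by blast
  have "card (rcosets R) dvd p ^ n" using o by (metis dvd_triv_left)
  then obtain k where k: "card (rcosets R) = p ^ k" using divides_primepow_nat[OF p] by blast
  have "k \<noteq> 0"
  proof
    assume "k = 0"
    then have "card R = card (carrier S)" using o k n by (simp add: order_def)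
    then show False using R(2) sub fin card_subset_eq by metis
  qed
  then have dv: "p dvd card (rcosets R)" using k by simp
  define F where "F = {R #> g | g. g \<in> carrier S \<and> (\<forall>x\<in>R. g \<otimes> x \<otimes> inv g \<in> R)}"
  have finC: "finite (rcosets R)" using dv k p by (metis card.infinite not_prime_0 power_not_zero)
  have FC: "F \<subseteq> rcosets R" using sub rcosetsI by (auto simp: F_def)
  have "order (S\<lparr>carrier := R\<rparr>) = p ^ m" "(\<lambda>x. x) \<in> hom (S\<lparr>carrier := R\<rparr>) S"
    using m sub by (auto simp: order_def hom_def)
  from p_dvd_card_moved_cosets[OF p fin R(1) subgroup.subgroup_is_group[OF R(1) is_group] this]
  have "p dvd card (rcosets R - F)" by (simp add: F_def)
  moreover have "card F + card (rcosets R - F) = card (rcosets R)"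
    using FC finC by (simp add: card_Diff_subset card_mono finite_subset)
  ultimately have dF: "p dvd card F" using dv by (metis dvd_add_left_iff)
  have RF: "R \<in> F"
    using R sub by (auto simp: F_def intro!: exI[of _ \<one>])
  have "F \<noteq> {R}" using dF p not_prime_1 by auto
  then obtain C where "C \<in> F" "C \<noteq> R" using RF by blast
  then obtain g where g: "g \<in> carrier S" "\<forall>x\<in>R. g \<otimes> x \<otimes> inv g \<in> R" "R #> g \<noteq> R"
    by (auto simp: F_def)
  then have "g \<notin> R" using coset_join2[OF g(1) R(1)] by blast
  then show ?thesis using that[of g] g sub
    by (auto simp: transporter_def conj_map_def)
qed

section \<open>Conjugation and normalizers\<close>

lemma transporter_iff:
  "s \<in> transporter S P Q \<longleftrightarrow> s \<in> carrier S \<and> (\<forall>x\<in>P. s \<otimes>\<^bsub>S\<^esub> x \<otimes>\<^bsub>S\<^esub> inv\<^bsub>S\<^esub> s \<in> Q)"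
  by (auto simp: transporter_def conj_map_def)

lemma conj_map_apply: "x \<in> P \<Longrightarrow> conj_map S P g x = g \<otimes>\<^bsub>S\<^esub> x \<otimes>\<^bsub>S\<^esub> inv\<^bsub>S\<^esub> g"
  by (simp add: conj_map_def)

lemma (in group) conj_mult:
  "\<lbrakk>a \<in> carrier G; b \<in> carrier G; x \<in> carrier G\<rbrakk>
    \<Longrightarrow> a \<otimes> b \<otimes> x \<otimes> inv (a \<otimes> b) = a \<otimes> (b \<otimes> x \<otimes> inv b) \<otimes> inv a"
  by (simp add: inv_mult_group m_assoc)

lemma (in group) conj_inv_cancel:
  "\<lbrakk>a \<in> carrier G; x \<in> carrier G\<rbrakk> \<Longrightarrow> inv a \<otimes> (a \<otimes> x \<otimes> inv a) \<otimes> inv (inv a) = x"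
  using conj_mult[of "inv a" a x] by simp

lemma (in group) conj_inj:
  "\<lbrakk>a \<in> carrier G; x \<in> carrier G; y \<in> carrier G; a \<otimes> x \<otimes> inv a = a \<otimes> y \<otimes> inv a\<rbrakk> \<Longrightarrow> x = y"
  using conj_inv_cancel by metis

lemma (in group) conj_self_iff_commute:
  "\<lbrakk>a \<in> carrier G; x \<in> carrier G\<rbrakk> \<Longrightarrow> a \<otimes> x \<otimes> inv a = x \<longleftrightarrow> a \<otimes> x = x \<otimes> a"
  by (metis inv_closed inv_solve_right' m_closed)

text \<open>The functions on groups such as \<^const>\<open>transporter\<close> are typed with unextended monoid
  records, whereas the locale \<^locale>\<open>group\<close> allows record extensions.\<close>

locale unextended_group = group G for G :: "'a monoid" (structure)
begin

lemma transporter_mult: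
  assumes "a \<in> transporter G Q R" "b \<in> transporter G P Q" "P \<subseteq> carrier G"
  shows "a \<otimes> b \<in> transporter G P R"
  using assms by (auto simp: transporter_iff conj_mult subset_iff)

lemma subgroup_subset_transporter: "subgroup P G \<Longrightarrow> P \<subseteq> transporter G P P"
  by (auto simp: transporter_iff subgroup.mem_carrier subgroup.m_closed subgroup.m_inv_closed)

lemma one_in_transporter: "P \<subseteq> Q \<Longrightarrow> P \<subseteq> carrier G \<Longrightarrow> \<one> \<in> transporter G P Q"
  by (auto simp: transporter_iff subset_iff)

lemma transporter_carrier: "transporter G (carrier G) (carrier G) = carrier G"
  by (auto simp: transporter_iff)

text \<open>An element of \<open>N\<^sub>S(P,P)\<close> conjugates \<open>P\<close> into \<open>P\<close>; finiteness makes this an equality, which is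
  what closure of \<open>N\<^sub>S(P,P)\<close> under inverses depends on.\<close>

lemma normalizer_image:
  assumes "finite P" "P \<subseteq> carrier G" "g \<in> transporter G P P"
  shows "conj_map G P g ` P = P"
proof (rule endo_inj_surj)
  show "inj_on (conj_map G P g) P"
    using assms conj_inj by (auto simp: inj_on_def conj_map_def transporter_iff subset_iff)
qed (use assms in \<open>auto simp: transporter_def\<close>)

lemma normalizer_inv:
  assumes "finite P" "P \<subseteq> carrier G" and g: "g \<in> transporter G P P"
  shows "inv g \<in> transporter G P P"
proof -
  have gc: "g \<in> carrier G" using g by (simp add: transporter_def)
  have "inv g \<otimes> x \<otimes> inv (inv g) \<in> P" if x: "x \<in> P" for x
  proof -
    obtain y where y: "y \<in> P" "x = g \<otimes> y \<otimes> inv g"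
      using x normalizer_image[OF assms] by (metis conj_map_apply imageE)
    then show ?thesis using conj_inv_cancel gc assms(2) by auto
  qed
  then show ?thesis using gc by (simp add: transporter_iff)
qed

lemma normalizer_subgroup:
  assumes "finite P" "subgroup P G"
  shows "subgroup (transporter G P P) G"
proof (rule subgroupI)
  have P: "P \<subseteq> carrier G" using assms(2) by (rule subgroup.subset)
  show "transporter G P P \<noteq> {}"
    using subgroup_subset_transporter[OF assms(2)] subgroup.one_closed[OF assms(2)] by blast
  show "transporter G P P \<subseteq> carrier G" by (auto simp: transporter_def)
  show "inv a \<in> transporter G P P" if "a \<in> transporter G P P" for a
    using normalizer_inv[OF assms(1) P that] .
  show "a \<otimes> b \<in> transporter G P P" if "a \<in> transporter G P P" "b \<in> transporter G P P" for a b
    using transporter_mult[OF that P] .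
qed

end

lemma (in group_hom) card_image_dvd_order: "card (h ` carrier G) dvd order G"
proof -
  interpret I: group "H\<lparr>carrier := h ` carrier G\<rparr>"
    using H.subgroup_imp_group img_is_subgroup by blast
  interpret i: group_hom G "H\<lparr>carrier := h ` carrier G\<rparr>" h
    by unfold_locales (auto simp: hom_def)
  have "card (h ` carrier G) = card (carrier (G Mod kernel G (H\<lparr>carrier := h ` carrier G\<rparr>) h))"
    using i.FactGroup_iso_set by (auto dest!: iso_same_order simp: order_def iso_def bij_betw_same_card)
  also have "\<dots> = card (rcosets kernel G (H\<lparr>carrier := h ` carrier G\<rparr>) h)"
    by (simp add: FactGroup_def)
  also have "\<dots> dvd order G"
    using G.lagrange[OF i.subgroup_kernel] by (metis dvd_triv_left)
  finally show ?thesis .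
qed

section \<open>Fusion systems\<close>

sublocale fusion_system \<subseteq> S: unextended_group S
  using p_group by (simp add: finite_p_group_def unextended_group_def)

context fusion_system
begin

lemma finite_S: "finite (carrier S)"
proof -
  obtain n where "order S = p ^ n" using p_group by (auto simp: finite_p_group_def)
  then have "order S > 0" using prime_p by (simp add: prime_gt_0_nat)
  then show ?thesis by (simp add: S.order_gt_0_iff_finite)
qed

lemma finite_subgroup: "subgroup P S \<Longrightarrow> finite P"
  using finite_S subgroup.subset finite_subset by metis

lemma order_subgroup: assumes "subgroup P S" shows "\<exists>n. card P = p ^ n"
proof -
  obtain n where "order S = p ^ n" using p_group by (auto simp: finite_p_group_def)
  then have "card P dvd p ^ n" using S.lagrange[OF assms] by (metis dvd_triv_right)
  then show ?thesis using divides_primepow_nat[OF prime_p] by blast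
qed

lemma hom_mult:
  "\<lbrakk>subgroup P S; subgroup Q S; \<phi> \<in> \<F> P Q; x \<in> P; y \<in> P\<rbrakk> \<Longrightarrow> \<phi> (x \<otimes>\<^bsub>S\<^esub> y) = \<phi> x \<otimes>\<^bsub>S\<^esub> \<phi> y"
  using injective_hom[of P Q \<phi>] by (auto simp: hom_def)

lemma hom_in: "\<lbrakk>subgroup P S; subgroup Q S; \<phi> \<in> \<F> P Q; x \<in> P\<rbrakk> \<Longrightarrow> \<phi> x \<in> Q"
  using injective_hom[of P Q \<phi>] by (auto simp: hom_def)

lemma hom_inj: "\<lbrakk>subgroup P S; subgroup Q S; \<phi> \<in> \<F> P Q\<rbrakk> \<Longrightarrow> inj_on \<phi> P"
  using injective_hom[of P Q \<phi>] by auto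

lemma hom_ext: "\<lbrakk>subgroup P S; subgroup Q S; \<phi> \<in> \<F> P Q\<rbrakk> \<Longrightarrow> \<phi> \<in> extensional P"
  using injective_hom[of P Q \<phi>] by auto

lemma hom_group_hom:
  "\<lbrakk>subgroup P S; subgroup Q S; \<phi> \<in> \<F> P Q\<rbrakk>
    \<Longrightarrow> group_hom (S\<lparr>carrier := P\<rparr>) (S\<lparr>carrier := Q\<rparr>) \<phi>"
  using injective_hom[of P Q \<phi>] S.subgroup_imp_group
  by (simp add: group_hom_def group_hom_axioms_def)

lemma hom_inv:
  "\<lbrakk>subgroup P S; subgroup Q S; \<phi> \<in> \<F> P Q; x \<in> P\<rbrakk> \<Longrightarrow> \<phi> (inv\<^bsub>S\<^esub> x) = inv\<^bsub>S\<^esub> (\<phi> x)"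
  using group_hom.hom_inv[OF hom_group_hom, of P Q \<phi> x]
  by (simp add: S.m_inv_consistent hom_in)

lemma image_subgroup:
  assumes "subgroup P S" "subgroup Q S" "\<phi> \<in> \<F> P Q"
  shows "subgroup (\<phi> ` P) S"
  using group_hom.img_is_subgroup[OF hom_group_hom[OF assms]] assms(2) S.incl_subgroup by simp

lemma hom_conj:
  assumes "subgroup P S" "subgroup Q S" "\<phi> \<in> \<F> P Q" "x \<in> P" "y \<in> P"
  shows "\<phi> (x \<otimes>\<^bsub>S\<^esub> y \<otimes>\<^bsub>S\<^esub> inv\<^bsub>S\<^esub> x) = \<phi> x \<otimes>\<^bsub>S\<^esub> \<phi> y \<otimes>\<^bsub>S\<^esub> inv\<^bsub>S\<^esub> (\<phi> x)"
  using assms by (simp add: hom_mult hom_inv subgroup.m_closed subgroup.m_inv_closed)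

lemma inclusion_in:
  assumes "subgroup P S" "subgroup Q S" "P \<subseteq> Q" shows "(\<lambda>x\<in>P. x) \<in> \<F> P Q"
proof -
  have "conj_map S P \<one>\<^bsub>S\<^esub> = (\<lambda>x\<in>P. x)"
    using assms subgroup.mem_carrier by (fastforce simp: conj_map_def)
  then show ?thesis
    using conj_map_in[of P Q "\<one>\<^bsub>S\<^esub>"] S.one_in_transporter[of P Q] assms by (simp add: subgroup.subset)
qed

lemma restrict_in:
  assumes "subgroup P S" "subgroup Q S" "\<phi> \<in> \<F> P Q" "subgroup R S" "R \<subseteq> P"
  shows "restrict \<phi> R \<in> \<F> R Q"
proof -
  have "compose R \<phi> (\<lambda>x\<in>R. x) = restrict \<phi> R" by (auto simp: compose_def)
  then show ?thesis using compose_in[of R P Q "\<lambda>x\<in>R. x" \<phi>] inclusion_in assms by simp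
qed

lemma enlarge_codomain:
  assumes "subgroup P S" "subgroup Q S" "\<phi> \<in> \<F> P Q" "subgroup R S" "Q \<subseteq> R"
  shows "\<phi> \<in> \<F> P R"
proof -
  have "compose P (\<lambda>x\<in>Q. x) \<phi> = \<phi>"
    using hom_in[OF assms(1-3)] extensional_arb[OF hom_ext[OF assms(1-3)]]
    by (auto simp: compose_def fun_eq_iff)
  then show ?thesis using compose_in[of P Q R \<phi> "\<lambda>x\<in>Q. x"] inclusion_in assms by simp
qed

lemma change_codomain:
  assumes "subgroup P S" "subgroup Q S" "\<phi> \<in> \<F> P Q" "subgroup R S" "\<phi> ` P \<subseteq> R"
  shows "\<phi> \<in> \<F> P R"
  using enlarge_codomain[OF _ _ onto_image_in] image_subgroup assms by blast

lemma inverse_in':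
  assumes "subgroup P S" "subgroup Q S" "\<phi> \<in> \<F> P Q" "\<phi> ` P = Q"
  shows "restrict (inv_into P \<phi>) Q \<in> \<F> Q P" "restrict (inv_into P \<phi>) Q ` Q = P"
  using inverse_in[of P Q \<phi>] assms hom_inj[of P Q \<phi>] by (auto simp: image_iff)

lemma mem_IsoF:
  assumes P: "subgroup P S" and Q: "subgroup Q S"
  shows "\<phi> \<in> Iso\<^sub>F S \<F> P Q \<longleftrightarrow> \<phi> \<in> \<F> P Q \<and> \<phi> ` P = Q"
proof
  assume "\<phi> \<in> Iso\<^sub>F S \<F> P Q"
  then obtain \<psi> where \<phi>: "\<phi> \<in> \<F> P Q" and \<psi>: "\<psi> \<in> \<F> Q P" "compose Q \<phi> \<psi> = (\<lambda>x\<in>Q. x)"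
    by (auto simp: Iso\<^sub>F_def Iso_def inverse_mor_def fusion_cat_def)
  have "Q \<subseteq> \<phi> ` P"
  proof
    fix x assume "x \<in> Q"
    then have "x = \<phi> (\<psi> x)" using \<psi>(2) by (metis compose_eq restrict_apply')
    then show "x \<in> \<phi> ` P" using hom_in[OF Q P \<psi>(1) \<open>x \<in> Q\<close>] by blast
  qed
  then show "\<phi> \<in> \<F> P Q \<and> \<phi> ` P = Q" using \<phi> hom_in[OF P Q \<phi>] by blast
next
  assume \<phi>: "\<phi> \<in> \<F> P Q \<and> \<phi> ` P = Q"
  have "compose P (restrict (inv_into P \<phi>) Q) \<phi> = (\<lambda>x\<in>P. x)"
    using \<phi> hom_inj[OF P Q] by (auto simp: compose_def)
  moreover have "compose Q \<phi> (restrict (inv_into P \<phi>) Q) = (\<lambda>x\<in>Q. x)"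
    using \<phi> by (auto simp: compose_def f_inv_into_f)
  ultimately have "inverse_mor (fusion_cat S \<F>) P Q \<phi> (restrict (inv_into P \<phi>) Q)"
    using \<phi> inverse_in'[OF P Q] by (simp add: inverse_mor_def fusion_cat_def)
  then show "\<phi> \<in> Iso\<^sub>F S \<F> P Q" by (auto simp: Iso\<^sub>F_def Iso_def)
qed

lemma F_conjugate_iff:
  "F_conjugate S \<F> P Q \<longleftrightarrow> subgroup P S \<and> subgroup Q S \<and> (\<exists>\<phi>\<in>\<F> P Q. \<phi> ` P = Q)"
  using mem_IsoF by (fastforce simp: F_conjugate_def)

lemma F_conjugate_sym: "F_conjugate S \<F> P Q \<Longrightarrow> F_conjugate S \<F> Q P"
  using inverse_in'[of P Q] F_conjugate_iff[of P Q] F_conjugate_iff[of Q P] by blast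

lemma F_conjugate_image:
  "\<lbrakk>subgroup P S; subgroup Q S; \<phi> \<in> \<F> P Q\<rbrakk> \<Longrightarrow> F_conjugate S \<F> P (\<phi> ` P)"
  using F_conjugate_iff[of P "\<phi> ` P"] image_subgroup[of P Q \<phi>] onto_image_in[of P Q \<phi>] by blast

lemma F_conjugate_card: "F_conjugate S \<F> P Q \<Longrightarrow> card P = card Q"
  using F_conjugate_iff hom_inj by (metis card_image)

lemma endo_surj: "\<lbrakk>subgroup P S; \<phi> \<in> \<F> P P\<rbrakk> \<Longrightarrow> \<phi> ` P = P"
  using endo_inj_surj[of P \<phi>] finite_subgroup hom_inj hom_in by (simp add: image_subset_iff)

subsection \<open>Automorphism groups\<close>

lemma carrier_AutF [simp]: "carrier (Aut\<^sub>F S \<F> P) = \<F> P P"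
  and mult_AutF [simp]: "a \<otimes>\<^bsub>Aut\<^sub>F S \<F> P\<^esub> b = compose P a b"
  and one_AutF [simp]: "\<one>\<^bsub>Aut\<^sub>F S \<F> P\<^esub> = (\<lambda>x\<in>P. x)"
  by (simp_all add: Aut\<^sub>F_def Aut_def fusion_cat_def)

lemma group_AutF:
  assumes P: "subgroup P S"
  shows "group (Aut\<^sub>F S \<F> P)"
proof (rule groupI)
  fix a b c assume a: "a \<in> carrier (Aut\<^sub>F S \<F> P)" and b: "b \<in> carrier (Aut\<^sub>F S \<F> P)"
    and c: "c \<in> carrier (Aut\<^sub>F S \<F> P)"
  show "a \<otimes>\<^bsub>Aut\<^sub>F S \<F> P\<^esub> b \<in> carrier (Aut\<^sub>F S \<F> P)" using compose_in P a b by simp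
  show "a \<otimes>\<^bsub>Aut\<^sub>F S \<F> P\<^esub> b \<otimes>\<^bsub>Aut\<^sub>F S \<F> P\<^esub> c = a \<otimes>\<^bsub>Aut\<^sub>F S \<F> P\<^esub> (b \<otimes>\<^bsub>Aut\<^sub>F S \<F> P\<^esub> c)"
    using c hom_in[OF P P] by (auto simp: compose_def)
  show "\<one>\<^bsub>Aut\<^sub>F S \<F> P\<^esub> \<otimes>\<^bsub>Aut\<^sub>F S \<F> P\<^esub> a = a"
    using hom_in[OF P P, of a] extensional_arb[OF hom_ext[OF P P, of a]] a
    by (auto simp: compose_def fun_eq_iff)
  have "compose P (restrict (inv_into P a) P) a = (\<lambda>x\<in>P. x)"
    using hom_inj[OF P P, of a] hom_in[OF P P, of a] a
    by (auto simp: compose_def intro!: restrict_ext)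
  then show "\<exists>b\<in>carrier (Aut\<^sub>F S \<F> P). b \<otimes>\<^bsub>Aut\<^sub>F S \<F> P\<^esub> a = \<one>\<^bsub>Aut\<^sub>F S \<F> P\<^esub>"
    using inverse_in'(1)[OF P P _ endo_surj] P a by auto
qed (use inclusion_in P in auto)

lemma finite_AutF: "subgroup P S \<Longrightarrow> finite (carrier (Aut\<^sub>F S \<F> P))"
proof (rule finite_subset[of _ "P \<rightarrow>\<^sub>E P"])
  show "subgroup P S \<Longrightarrow> carrier (Aut\<^sub>F S \<F> P) \<subseteq> P \<rightarrow>\<^sub>E P"
    using hom_in hom_ext by (auto simp: PiE_def)
qed (simp add: finite_PiE finite_subgroup)

lemma AutF_inv_apply:
  assumes P: "subgroup P S" and a: "a \<in> \<F> P P" and x: "x \<in> P"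
  shows "(inv\<^bsub>Aut\<^sub>F S \<F> P\<^esub> a) (a x) = x" "a ((inv\<^bsub>Aut\<^sub>F S \<F> P\<^esub> a) x) = x"
proof -
  interpret A: group "Aut\<^sub>F S \<F> P" by (rule group_AutF[OF P])
  have "compose P (inv\<^bsub>Aut\<^sub>F S \<F> P\<^esub> a) a = (\<lambda>x\<in>P. x)" "compose P a (inv\<^bsub>Aut\<^sub>F S \<F> P\<^esub> a) = (\<lambda>x\<in>P. x)"
    using A.l_inv[of a] A.r_inv[of a] a by simp_all
  then show "(inv\<^bsub>Aut\<^sub>F S \<F> P\<^esub> a) (a x) = x" "a ((inv\<^bsub>Aut\<^sub>F S \<F> P\<^esub> a) x) = x"
    using x by (metis compose_eq restrict_apply')+
qed

lemma AutF_inv_closed: "\<lbrakk>subgroup P S; a \<in> \<F> P P\<rbrakk> \<Longrightarrow> inv\<^bsub>Aut\<^sub>F S \<F> P\<^esub> a \<in> \<F> P P"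
  using group.inv_closed[OF group_AutF] by fastforce

text \<open>This is the action of \<open>N\<^sub>S(R)\<close> on \<open>P\<close> by conjugation, transported along \<open>\<psi>\<close>. It is used with
  \<open>\<psi>\<close> the identity, and with \<open>\<psi>\<close> an isomorphism onto a fully automized subgroup \<open>P\<close>, where Sylow's
  theorem applies to its image.\<close>

lemma transported_conj_hom:
  assumes R: "subgroup R S" and P: "subgroup P S" and \<psi>: "\<psi> \<in> \<F> R P" "\<psi> ` R = P"
  shows "(\<lambda>g. \<lambda>x\<in>P. \<psi> (conj_map S R g (inv_into R \<psi> x)))
           \<in> hom (S\<lparr>carrier := transporter S R R\<rparr>) (Aut\<^sub>F S \<F> P)"
proof (rule homI)
  fix g assume "g \<in> carrier (S\<lparr>carrier := transporter S R R\<rparr>)"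
  then have g: "g \<in> transporter S R R" by simp
  have "compose P (compose R \<psi> (conj_map S R g)) (restrict (inv_into R \<psi>) P) \<in> \<F> P P"
    using compose_in inverse_in'(1)[OF R P \<psi>] conj_map_in g R P \<psi> by metis
  moreover have "compose P (compose R \<psi> (conj_map S R g)) (restrict (inv_into R \<psi>) P) =
      (\<lambda>x\<in>P. \<psi> (conj_map S R g (inv_into R \<psi> x)))"
    using \<psi>(2) by (auto simp: compose_def inv_into_into)
  ultimately show "(\<lambda>x\<in>P. \<psi> (conj_map S R g (inv_into R \<psi> x))) \<in> carrier (Aut\<^sub>F S \<F> P)" by simp
next
  fix g h assume "g \<in> carrier (S\<lparr>carrier := transporter S R R\<rparr>)" "h \<in> carrier (S\<lparr>carrier := transporter S R R\<rparr>)"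
  then have g: "g \<in> transporter S R R" and h: "h \<in> transporter S R R" by auto
  show "(\<lambda>x\<in>P. \<psi> (conj_map S R (g \<otimes>\<^bsub>S\<lparr>carrier := transporter S R R\<rparr>\<^esub> h) (inv_into R \<psi> x))) =
     (\<lambda>x\<in>P. \<psi> (conj_map S R g (inv_into R \<psi> x))) \<otimes>\<^bsub>Aut\<^sub>F S \<F> P\<^esub>
     (\<lambda>x\<in>P. \<psi> (conj_map S R h (inv_into R \<psi> x)))"
  proof
    fix x
    show "(\<lambda>x\<in>P. \<psi> (conj_map S R (g \<otimes>\<^bsub>S\<lparr>carrier := transporter S R R\<rparr>\<^esub> h) (inv_into R \<psi> x))) x =
     ((\<lambda>x\<in>P. \<psi> (conj_map S R g (inv_into R \<psi> x))) \<otimes>\<^bsub>Aut\<^sub>F S \<F> P\<^esub>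
     (\<lambda>x\<in>P. \<psi> (conj_map S R h (inv_into R \<psi> x)))) x"
    proof (cases "x \<in> P")
      case True
      then obtain y where y: "y \<in> R" "x = \<psi> y" using \<psi> by blast
      have hy: "h \<otimes>\<^bsub>S\<^esub> y \<otimes>\<^bsub>S\<^esub> inv\<^bsub>S\<^esub> h \<in> R" using h y by (simp add: transporter_iff)
      have inv: "inv_into R \<psi> (\<psi> z) = z" if "z \<in> R" for z
        using that hom_inj[OF R P \<psi>(1)] by simp
      have "y \<in> carrier S" using subgroup.mem_carrier[OF R y(1)] .
      then show ?thesis
        using True y hy g h \<psi>(2) inv S.conj_mult[of g h y]
        by (auto simp: compose_def conj_map_apply transporter_iff)
    qed (simp add: compose_def)
  qed
qed

lemma conj_map_hom:
  assumes P: "subgroup P S"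
  shows "conj_map S P \<in> hom (S\<lparr>carrier := transporter S P P\<rparr>) (Aut\<^sub>F S \<F> P)"
proof -
  have "inj_on (\<lambda>x\<in>P. x) P" by (simp add: inj_on_def)
  have "inv_into P (\<lambda>x\<in>P. x) x = x" if "x \<in> P" for x
    using inv_into_f_f[OF \<open>inj_on (\<lambda>x\<in>P. x) P\<close> that] that by simp
  then have eq: "(\<lambda>x\<in>P. (\<lambda>x\<in>P. x) (conj_map S P g (inv_into P (\<lambda>x\<in>P. x) x))) = conj_map S P g"
    if "g \<in> transporter S P P" for g
    using that by (auto simp: conj_map_def transporter_iff fun_eq_iff)
  have m: "g \<otimes>\<^bsub>S\<^esub> h \<in> transporter S P P"
    if "g \<in> transporter S P P" "h \<in> transporter S P P" for g h
    using S.transporter_mult[OF that] P subgroup.subset by blast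
  have im: "(\<lambda>x\<in>P. x) ` P = P" by simp
  note H = transported_conj_hom[OF P P inclusion_in[OF P P subset_refl] im]
  show ?thesis
  proof (rule homI)
    fix g assume g: "g \<in> carrier (S\<lparr>carrier := transporter S P P\<rparr>)"
    then show "conj_map S P g \<in> carrier (Aut\<^sub>F S \<F> P)"
      using Group.hom_in_carrier[OF H g] eq[of g] by simp
    fix h assume h: "h \<in> carrier (S\<lparr>carrier := transporter S P P\<rparr>)"
    show "conj_map S P (g \<otimes>\<^bsub>S\<lparr>carrier := transporter S P P\<rparr>\<^esub> h) =
        conj_map S P g \<otimes>\<^bsub>Aut\<^sub>F S \<F> P\<^esub> conj_map S P h"
      using Group.hom_mult[OF H g h] eq[of g] eq[of h] eq[of "g \<otimes>\<^bsub>S\<^esub> h"] m[of g h] g h by simp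
  qed
qed

lemma Inn_subgroup: "subgroup P S \<Longrightarrow> subgroup (Inn S P) (Aut\<^sub>F S \<F> P)"
  and card_Inn: "subgroup P S \<Longrightarrow> \<exists>n. card (Inn S P) = p ^ n"
proof -
  assume P: "subgroup P S"
  have sub: "P \<subseteq> transporter S P P" by (rule S.subgroup_subset_transporter[OF P])
  interpret A: group "Aut\<^sub>F S \<F> P" by (rule group_AutF[OF P])
  interpret P: group "S\<lparr>carrier := P\<rparr>" using P S.subgroup_imp_group by blast
  interpret h: group_hom "S\<lparr>carrier := P\<rparr>" "Aut\<^sub>F S \<F> P" "conj_map S P"
    using conj_map_hom[OF P] sub by unfold_locales (auto simp: hom_def Pi_iff)
  show "subgroup (Inn S P) (Aut\<^sub>F S \<F> P)" using h.img_is_subgroup by (simp add: Inn_def)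
  have "card (Inn S P) dvd card P" using h.card_image_dvd_order by (simp add: Inn_def order_def)
  then show "\<exists>n. card (Inn S P) = p ^ n"
    using order_subgroup[OF P] divides_primepow_nat[OF prime_p] by metis
qed

lemma Inn_normal:
  assumes P: "subgroup P S"
  shows "Inn S P \<lhd> Aut\<^sub>F S \<F> P"
proof -
  interpret A: group "Aut\<^sub>F S \<F> P" by (rule group_AutF[OF P])
  have "a \<otimes>\<^bsub>Aut\<^sub>F S \<F> P\<^esub> c \<otimes>\<^bsub>Aut\<^sub>F S \<F> P\<^esub> inv\<^bsub>Aut\<^sub>F S \<F> P\<^esub> a \<in> Inn S P"
    if a: "a \<in> \<F> P P" and c: "c \<in> Inn S P" for a c
  proof -
    obtain g where g: "g \<in> P" "c = conj_map S P g" using c by (auto simp: Inn_def)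
    have "compose P (compose P a c) (inv\<^bsub>Aut\<^sub>F S \<F> P\<^esub> a) = conj_map S P (a g)"
    proof
      fix x
      show "compose P (compose P a c) (inv\<^bsub>Aut\<^sub>F S \<F> P\<^esub> a) x = conj_map S P (a g) x"
      proof (cases "x \<in> P")
        case True
        then have "(inv\<^bsub>Aut\<^sub>F S \<F> P\<^esub> a) x \<in> P" using AutF_inv_closed[OF P a] hom_in P by blast
        then show ?thesis
          using True g hom_conj[OF P P a] AutF_inv_apply[OF P a True]
          by (simp add: compose_def conj_map_apply)
      qed (simp add: compose_def conj_map_def)
    qed
    then show ?thesis using g hom_in[OF P P a] by (auto simp: Inn_def)
  qed
  then show ?thesis unfolding A.normal_inv_iff using Inn_subgroup[OF P] by simp
qed

subsection \<open>Extension domains\<close>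

text \<open>Evaluating at \<open>\<phi> x\<close> instead of \<open>x\<close> removes the inverse of \<open>\<phi>\<close> from the definition.\<close>

lemma mem_extension_domain:
  assumes Q: "subgroup Q S" and P: "subgroup P S" and \<phi>: "\<phi> \<in> \<F> Q P" "\<phi> ` Q = P"
  shows "g \<in> extension_domain S Q P \<phi> \<longleftrightarrow> g \<in> transporter S Q Q \<and>
     (\<exists>h\<in>transporter S P P. \<forall>x\<in>Q.
        \<phi> (g \<otimes>\<^bsub>S\<^esub> x \<otimes>\<^bsub>S\<^esub> inv\<^bsub>S\<^esub> g) = h \<otimes>\<^bsub>S\<^esub> \<phi> x \<otimes>\<^bsub>S\<^esub> inv\<^bsub>S\<^esub> h)"
proof -
  have "(\<lambda>x\<in>P. \<phi> (conj_map S Q g (inv_into Q \<phi> x))) = conj_map S P h \<longleftrightarrow>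
      (\<forall>x\<in>Q. \<phi> (g \<otimes>\<^bsub>S\<^esub> x \<otimes>\<^bsub>S\<^esub> inv\<^bsub>S\<^esub> g) = h \<otimes>\<^bsub>S\<^esub> \<phi> x \<otimes>\<^bsub>S\<^esub> inv\<^bsub>S\<^esub> h)" for h
  proof -
    have "(\<lambda>x\<in>P. \<phi> (conj_map S Q g (inv_into Q \<phi> x))) = conj_map S P h \<longleftrightarrow>
        (\<forall>x\<in>P. \<phi> (conj_map S Q g (inv_into Q \<phi> x)) = h \<otimes>\<^bsub>S\<^esub> x \<otimes>\<^bsub>S\<^esub> inv\<^bsub>S\<^esub> h)"
      by (auto simp: conj_map_def fun_eq_iff)
    also have "\<dots> \<longleftrightarrow> (\<forall>x\<in>Q. \<phi> (g \<otimes>\<^bsub>S\<^esub> x \<otimes>\<^bsub>S\<^esub> inv\<^bsub>S\<^esub> g) = h \<otimes>\<^bsub>S\<^esub> \<phi> x \<otimes>\<^bsub>S\<^esub> inv\<^bsub>S\<^esub> h)"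
      using \<phi>(2) hom_inj[OF Q P \<phi>(1)] by (force simp: conj_map_apply)
    finally show ?thesis .
  qed
  then show ?thesis by (auto simp: extension_domain_def Aut\<^sub>S_def image_iff)
qed

lemma extension_domain_contains:
  assumes Q: "subgroup Q S" and P: "subgroup P S" and \<phi>: "\<phi> \<in> \<F> Q P" "\<phi> ` Q = P"
  shows "Q \<subseteq> extension_domain S Q P \<phi>"
proof
  fix g assume g: "g \<in> Q"
  have "g \<in> transporter S Q Q" "\<phi> g \<in> transporter S P P"
    using S.subgroup_subset_transporter[OF Q] S.subgroup_subset_transporter[OF P] g
      hom_in[OF Q P \<phi>(1) g] by blast+
  then show "g \<in> extension_domain S Q P \<phi>"
    using hom_conj[OF Q P \<phi>(1) g] by (auto simp: mem_extension_domain[OF assms])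
qed

lemma extension_domain_subgroup:
  assumes Q: "subgroup Q S" and P: "subgroup P S" and \<phi>: "\<phi> \<in> \<F> Q P" "\<phi> ` Q = P"
  shows "subgroup (extension_domain S Q P \<phi>) S"
proof (rule S.subgroupI)
  note mem = mem_extension_domain[OF assms]
  have Qc: "Q \<subseteq> carrier S" and Pc: "P \<subseteq> carrier S" using P Q subgroup.subset by blast+
  show "extension_domain S Q P \<phi> \<subseteq> carrier S"
    by (auto simp: extension_domain_def transporter_def)
  show "extension_domain S Q P \<phi> \<noteq> {}"
    using extension_domain_contains[OF assms] subgroup.one_closed[OF Q] by blast
  fix a assume a: "a \<in> extension_domain S Q P \<phi>"
  then obtain h where h: "h \<in> transporter S P P"
    and ah: "\<And>x. x \<in> Q \<Longrightarrow> \<phi> (a \<otimes>\<^bsub>S\<^esub> x \<otimes>\<^bsub>S\<^esub> inv\<^bsub>S\<^esub> a) = h \<otimes>\<^bsub>S\<^esub> \<phi> x \<otimes>\<^bsub>S\<^esub> inv\<^bsub>S\<^esub> h"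
    and aN: "a \<in> transporter S Q Q"
    using mem by blast
  have ac: "a \<in> carrier S" and hc: "h \<in> carrier S" using aN h by (auto simp: transporter_def)
  have ia: "inv\<^bsub>S\<^esub> a \<in> transporter S Q Q" and ih: "inv\<^bsub>S\<^esub> h \<in> transporter S P P"
    using S.normalizer_inv aN h finite_subgroup Q P Qc Pc by blast+
  have "\<phi> (inv\<^bsub>S\<^esub> a \<otimes>\<^bsub>S\<^esub> x \<otimes>\<^bsub>S\<^esub> inv\<^bsub>S\<^esub> (inv\<^bsub>S\<^esub> a)) = inv\<^bsub>S\<^esub> h \<otimes>\<^bsub>S\<^esub> \<phi> x \<otimes>\<^bsub>S\<^esub> inv\<^bsub>S\<^esub> (inv\<^bsub>S\<^esub> h)"
    if x: "x \<in> Q" for x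
  proof -
    let ?y = "inv\<^bsub>S\<^esub> a \<otimes>\<^bsub>S\<^esub> x \<otimes>\<^bsub>S\<^esub> inv\<^bsub>S\<^esub> (inv\<^bsub>S\<^esub> a)"
    have y: "?y \<in> Q" using ia x by (simp add: transporter_iff)
    have "x \<in> carrier S" using x Qc by blast
    then have "a \<otimes>\<^bsub>S\<^esub> ?y \<otimes>\<^bsub>S\<^esub> inv\<^bsub>S\<^esub> a = x"
      using S.conj_mult[of a "inv\<^bsub>S\<^esub> a" x] ac by simp
    then have "\<phi> x = h \<otimes>\<^bsub>S\<^esub> \<phi> ?y \<otimes>\<^bsub>S\<^esub> inv\<^bsub>S\<^esub> h" using ah[OF y] by simp
    moreover have "\<phi> ?y \<in> carrier S" using hom_in[OF Q P \<phi>(1) y] Pc by blast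
    ultimately show ?thesis using S.conj_inv_cancel[OF hc] by simp
  qed
  then show "inv\<^bsub>S\<^esub> a \<in> extension_domain S Q P \<phi>" using mem ia ih by blast
  fix b assume "b \<in> extension_domain S Q P \<phi>"
  then obtain k where k: "k \<in> transporter S P P"
    and bk: "\<And>x. x \<in> Q \<Longrightarrow> \<phi> (b \<otimes>\<^bsub>S\<^esub> x \<otimes>\<^bsub>S\<^esub> inv\<^bsub>S\<^esub> b) = k \<otimes>\<^bsub>S\<^esub> \<phi> x \<otimes>\<^bsub>S\<^esub> inv\<^bsub>S\<^esub> k"
    and bN: "b \<in> transporter S Q Q"
    using mem by blast
  have bc: "b \<in> carrier S" and kc: "k \<in> carrier S" using bN k by (auto simp: transporter_def)
  have "\<phi> (a \<otimes>\<^bsub>S\<^esub> b \<otimes>\<^bsub>S\<^esub> x \<otimes>\<^bsub>S\<^esub> inv\<^bsub>S\<^esub> (a \<otimes>\<^bsub>S\<^esub> b)) = h \<otimes>\<^bsub>S\<^esub> k \<otimes>\<^bsub>S\<^esub> \<phi> x \<otimes>\<^bsub>S\<^esub> inv\<^bsub>S\<^esub> (h \<otimes>\<^bsub>S\<^esub> k)"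
    if x: "x \<in> Q" for x
  proof -
    have "b \<otimes>\<^bsub>S\<^esub> x \<otimes>\<^bsub>S\<^esub> inv\<^bsub>S\<^esub> b \<in> Q" using bN x by (simp add: transporter_iff)
    moreover have "x \<in> carrier S" "\<phi> x \<in> carrier S" using x Qc hom_in[OF Q P \<phi>(1) x] Pc by blast+
    ultimately show ?thesis
      using ah bk[OF x] S.conj_mult[OF ac bc] S.conj_mult[OF hc kc] by simp
  qed
  moreover have "a \<otimes>\<^bsub>S\<^esub> b \<in> transporter S Q Q" "h \<otimes>\<^bsub>S\<^esub> k \<in> transporter S P P"
    using S.transporter_mult aN bN h k Pc Qc by blast+
  ultimately show "a \<otimes>\<^bsub>S\<^esub> b \<in> extension_domain S Q P \<phi>" using mem by blast
qed

end

section \<open>Alperin's fusion theorem\<close>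

text \<open>This is the induction step of Alperin's theorem: as \<open>P\<close> is receptive, \<open>\<phi>\<close> is the
  restriction of a morphism whose domain is strictly larger than \<open>Q\<close>.\<close>

lemma (in fusion_system) extension_in_subsystem:
  assumes G: "fusion_system p S \<G>"
    and Q: "subgroup Q S" and P: "subgroup P S" and \<phi>: "\<phi> \<in> \<F> Q P" "\<phi> ` Q = P"
    and rec: "receptive S \<F> P"
    and g: "g \<in> extension_domain S Q P \<phi>" "g \<notin> Q"
    and larger: "\<And>R. \<lbrakk>subgroup R S; card Q < card R\<rbrakk> \<Longrightarrow> \<F> R (carrier S) \<subseteq> \<G> R (carrier S)"
  shows "\<phi> \<in> \<G> Q P"
proof -
  interpret G: fusion_system p S \<G> by (rule G)
  let ?N = "extension_domain S Q P \<phi>"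
  have N: "subgroup ?N S" by (rule extension_domain_subgroup[OF Q P \<phi>])
  have QN: "Q \<subseteq> ?N" by (rule extension_domain_contains[OF Q P \<phi>])
  have S: "subgroup (carrier S) S" by (rule S.subgroup_self)
  have "card Q < card ?N" using QN g finite_subgroup[OF N] by (metis psubsetI psubset_card_mono)
  moreover obtain \<psi> where \<psi>: "\<psi> \<in> \<F> ?N (carrier S)" "\<forall>x\<in>Q. \<psi> x = \<phi> x"
    using rec Q \<phi> mem_IsoF[OF Q P] unfolding receptive_def by blast
  ultimately have "\<psi> \<in> \<G> ?N (carrier S)" using larger[OF N] by blast
  then have "restrict \<psi> Q \<in> \<G> Q (carrier S)" using G.restrict_in[OF N S _ Q QN] by blast
  moreover have "restrict \<psi> Q = \<phi>"
    using \<psi>(2) extensional_arb[OF hom_ext[OF Q P \<phi>(1)]] by (auto simp: fun_eq_iff)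
  ultimately show ?thesis using G.change_codomain[OF Q S _ P] \<phi>(2) by simp
qed

text \<open>A conjugate \<open>Q\<close> of \<open>P\<close> has an element \<open>c\<close> outside \<open>Q\<close> that centralizes it. Such an element lies in
  the extension domain of every isomorphism from \<open>Q\<close> to \<open>P\<close>, because it induces the identity on
  \<open>Q\<close>, and the extension maps it to an element that centralizes \<open>P\<close>.\<close>

lemma (in fusion_system) receptive_centralizer:
  assumes P: "subgroup P S" and rec: "receptive S \<F> P" and nc: "\<not> F_centric S \<F> P"
  obtains g where "g \<in> centralizer S P" "g \<notin> P"
proof -
  obtain Q where "F_conjugate S \<F> P Q" "\<not> centralizer S Q \<subseteq> Q"
    using nc by (auto simp: F_centric_def)
  then obtain c \<psi> where Q: "subgroup Q S" and \<psi>: "\<psi> \<in> \<F> Q P" "\<psi> ` Q = P"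
    and c: "c \<in> centralizer S Q" "c \<notin> Q"
    using F_conjugate_sym[of P Q] F_conjugate_iff[of Q P] by blast
  let ?N = "extension_domain S Q P \<psi>"
  have N: "subgroup ?N S" by (rule extension_domain_subgroup[OF Q P \<psi>])
  have QN: "Q \<subseteq> ?N" by (rule extension_domain_contains[OF Q P \<psi>])
  have S: "subgroup (carrier S) S" by (rule S.subgroup_self)
  have cc: "c \<in> carrier S" and comm: "\<And>x. x \<in> Q \<Longrightarrow> c \<otimes>\<^bsub>S\<^esub> x = x \<otimes>\<^bsub>S\<^esub> c"
    using c by (auto simp: centralizer_def)
  have cx: "c \<otimes>\<^bsub>S\<^esub> x \<otimes>\<^bsub>S\<^esub> inv\<^bsub>S\<^esub> c = x" if "x \<in> Q" for x
    using S.conj_self_iff_commute[OF cc] comm[OF that] subgroup.mem_carrier[OF Q that] by blast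
  have cN: "c \<in> ?N"
    unfolding mem_extension_domain[OF Q P \<psi>]
  proof
    show "c \<in> transporter S Q Q" using cc cx by (simp add: transporter_iff)
    show "\<exists>h\<in>transporter S P P. \<forall>x\<in>Q. \<psi> (c \<otimes>\<^bsub>S\<^esub> x \<otimes>\<^bsub>S\<^esub> inv\<^bsub>S\<^esub> c) = h \<otimes>\<^bsub>S\<^esub> \<psi> x \<otimes>\<^bsub>S\<^esub> inv\<^bsub>S\<^esub> h"
      using S.one_in_transporter[of P P] P hom_in[OF Q P \<psi>(1)]
      by (intro bexI[of _ "\<one>\<^bsub>S\<^esub>"]) (auto simp: cx subgroup.subset subgroup.mem_carrier)
  qed
  obtain \<theta> where \<theta>: "\<theta> \<in> \<F> ?N (carrier S)" "\<forall>x\<in>Q. \<theta> x = \<psi> x"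
    using rec Q \<psi> mem_IsoF[OF Q P] unfolding receptive_def by blast
  have "\<theta> c \<in> centralizer S P"
  proof -
    have "\<theta> c \<otimes>\<^bsub>S\<^esub> x = x \<otimes>\<^bsub>S\<^esub> \<theta> c" if x: "x \<in> P" for x
    proof -
      obtain y where y: "y \<in> Q" "x = \<psi> y" using x \<psi>(2) by blast
      have "\<theta> (c \<otimes>\<^bsub>S\<^esub> y) = \<theta> c \<otimes>\<^bsub>S\<^esub> \<theta> y" "\<theta> (y \<otimes>\<^bsub>S\<^esub> c) = \<theta> y \<otimes>\<^bsub>S\<^esub> \<theta> c"
        using hom_mult[OF N S \<theta>(1)] cN y(1) QN by blast+
      then show ?thesis using comm y \<theta>(2) by simp
    qed
    then show ?thesis using hom_in[OF N S \<theta>(1) cN] by (simp add: centralizer_def)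
  qed
  moreover have "\<theta> c \<notin> P"
  proof
    assume "\<theta> c \<in> P"
    then obtain y where y: "y \<in> Q" "\<theta> c = \<theta> y" using \<psi>(2) \<theta>(2) by force
    then have "c = y" using hom_inj[OF N S \<theta>(1)] cN QN by (meson inj_onD subsetD)
    then show False using y c by blast
  qed
  ultimately show ?thesis using that by blast
qed

text \<open>\<open>O\<^sub>p\<close> is generated by the normal \<open>p\<close>-subgroups, so one of these is nontrivial in
  \<open>Out\<^sub>F(P)\<close>. Its preimage in \<open>Aut\<^sub>F(P)\<close> is an extension of a \<open>p\<close>-group by the
  \<open>p\<close>-group \<open>Inn(P)\<close>.\<close>

lemma (in fusion_system) nonradical_normal_p_subgroup:
  assumes P: "subgroup P S" and nr: "\<not> F_radical p S \<F> P"
  obtains K n where "K \<lhd> Aut\<^sub>F S \<F> P" "card K = p ^ n" "\<not> K \<subseteq> Inn S P"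
proof -
  interpret A: group "Aut\<^sub>F S \<F> P" by (rule group_AutF[OF P])
  interpret I: normal "Inn S P" "Aut\<^sub>F S \<F> P" by (rule Inn_normal[OF P])
  define Out where "Out = Aut\<^sub>F S \<F> P Mod Inn S P"
  interpret O: group Out unfolding Out_def by (rule I.factorgroup_is_group)
  have "\<exists>N n. N \<lhd> Out \<and> card N = p ^ n \<and> N \<noteq> {\<one>\<^bsub>Out\<^esub>}"
  proof (rule ccontr)
    assume "\<not> ?thesis"
    then have "\<Union>{N. N \<lhd> Out \<and> (\<exists>n. card N = p ^ n)} \<subseteq> {\<one>\<^bsub>Out\<^esub>}" by blast
    then have "p_core p Out \<subseteq> {\<one>\<^bsub>Out\<^esub>}"
      unfolding p_core_def using O.generate_subgroup_incl[OF _ O.triv_subgroup] by blast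
    moreover have "\<one>\<^bsub>Out\<^esub> \<in> p_core p Out" unfolding p_core_def by (rule generate.one)
    ultimately show False using nr unfolding F_radical_def Out_def by blast
  qed
  then obtain N n where N: "N \<lhd> Out" "card N = p ^ n" "N \<noteq> {\<one>\<^bsub>Out\<^esub>}" by blast
  have sN: "subgroup N Out" by (rule normal_imp_subgroup[OF N(1)])
  have K: "\<Union>N \<lhd> Aut\<^sub>F S \<F> P"
    using I.factgroup_subgroup_union_normal N(1) unfolding Out_def by blast
  have char: "\<Union>N = {x \<in> carrier (Aut\<^sub>F S \<F> P). Inn S P #>\<^bsub>Aut\<^sub>F S \<F> P\<^esub> x \<in> N}"
    using I.factgroup_subgroup_union_char sN unfolding Out_def by blast
  have NC: "N \<subseteq> rcosets\<^bsub>Aut\<^sub>F S \<F> P\<^esub> (Inn S P)"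
    using subgroup.subset[OF sN] by (simp add: Out_def FactGroup_def)
  obtain m where m: "card (Inn S P) = p ^ m" using card_Inn[OF P] by blast
  have "card (Inn S P) * card N = card (\<Union>N)"
  proof (rule card_partition)
    show fin: "finite (\<Union>N)"
      using finite_subset[OF subgroup.subset[OF normal_imp_subgroup[OF K]] finite_AutF[OF P]] .
    show "finite N" by (rule finite_UnionD[OF fin])
    show "card c = card (Inn S P)" if "c \<in> N" for c
      using A.card_rcosets_equal[OF subsetD[OF NC that] I.subset] by simp
    show "c1 \<inter> c2 = {}" if "c1 \<in> N" "c2 \<in> N" "c1 \<noteq> c2" for c1 c2
      using pairwiseD[OF A.rcos_disjoint[OF I.is_subgroup] _ _ that(3)] NC that(1,2)
      unfolding disjnt_def by blast
  qed
  then have "card (\<Union>N) = p ^ (m + n)" using m N(2) by (simp add: power_add)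
  moreover have "\<not> \<Union>N \<subseteq> Inn S P"
  proof
    assume le: "\<Union>N \<subseteq> Inn S P"
    have "C = \<one>\<^bsub>Out\<^esub>" if C: "C \<in> N" for C
    proof -
      obtain x where x: "x \<in> carrier (Aut\<^sub>F S \<F> P)" "C = Inn S P #>\<^bsub>Aut\<^sub>F S \<F> P\<^esub> x"
        using C NC by (auto simp: RCOSETS_def)
      then have "x \<in> \<Union>N" using C char by blast
      then have "x \<in> Inn S P" using le by blast
      then show ?thesis
        using x A.coset_join2[OF x(1) I.is_subgroup] by (simp add: Out_def)
    qed
    then show False using N(3) subgroup.one_closed[OF sN] by blast
  qed
  ultimately show ?thesis using that K by blast
qed

text \<open>Some conjugate of \<open>K\<close> lies in the Sylow subgroup \<open>Aut\<^sub>S(P)\<close>, and a normal subgroup has no conjugate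
  but itself.\<close>

lemma (in fusion_system) normal_p_subgroup_in_sylow:
  assumes P: "subgroup P S" and fa: "fully_automized p S \<F> P"
    and K: "K \<lhd> Aut\<^sub>F S \<F> P" and card: "card K = p ^ n"
  shows "K \<subseteq> Aut\<^sub>S S P"
proof
  interpret A: group "Aut\<^sub>F S \<F> P" by (rule group_AutF[OF P])
  let ?A = "Aut\<^sub>F S \<F> P"
  have sK: "subgroup K ?A" by (rule normal_imp_subgroup[OF K])
  have h: "(\<lambda>x. x) \<in> hom (?A\<lparr>carrier := K\<rparr>) ?A" using subgroup.subset[OF sK] by (auto simp: hom_def)
  have "order (?A\<lparr>carrier := K\<rparr>) = p ^ n" using card by (simp add: order_def)
  then obtain a where a: "a \<in> carrier ?A"
    and sy: "\<And>x. x \<in> K \<Longrightarrow> a \<otimes>\<^bsub>?A\<^esub> x \<otimes>\<^bsub>?A\<^esub> inv\<^bsub>?A\<^esub> a \<in> Aut\<^sub>S S P"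
    using p_group_hom_conjugate_into_sylow[OF prime_p A.is_group finite_AutF[OF P]
        fa[unfolded fully_automized_def] A.subgroup_imp_group[OF sK] _ h]
    by auto
  fix k assume k: "k \<in> K"
  then have kc: "k \<in> carrier ?A" using subgroup.mem_carrier[OF sK] by blast
  have "inv\<^bsub>?A\<^esub> a \<otimes>\<^bsub>?A\<^esub> k \<otimes>\<^bsub>?A\<^esub> a \<in> K" using normal.inv_op_closed1[OF K a k] .
  then have "a \<otimes>\<^bsub>?A\<^esub> (inv\<^bsub>?A\<^esub> a \<otimes>\<^bsub>?A\<^esub> k \<otimes>\<^bsub>?A\<^esub> a) \<otimes>\<^bsub>?A\<^esub> inv\<^bsub>?A\<^esub> a \<in> Aut\<^sub>S S P" by (rule sy)
  moreover have "a \<otimes>\<^bsub>?A\<^esub> (inv\<^bsub>?A\<^esub> a \<otimes>\<^bsub>?A\<^esub> k \<otimes>\<^bsub>?A\<^esub> a) \<otimes>\<^bsub>?A\<^esub> inv\<^bsub>?A\<^esub> a = k"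
    using A.conj_mult[of a "inv\<^bsub>?A\<^esub> a" k] a kc A.inv_closed A.r_inv A.inv_inv A.inv_one A.l_one A.r_one
    by metis
  ultimately show "k \<in> Aut\<^sub>S S P" by simp
qed

text \<open>If \<open>P\<close> is not centric, then an element of \<open>C\<^sub>S(P)\<close> outside \<open>P\<close> is in the extension domain of
  every automorphism. If \<open>P\<close> is not radical, there is a normal \<open>p\<close>-subgroup \<open>K\<close> of
  \<open>Aut\<^sub>F(P)\<close> with \<open>Inn(P) < K \<le> Aut\<^sub>S(P)\<close>; conjugation by \<open>\<chi>\<close> preserves it, so an
  element \<open>g\<close> that induces a member of \<open>K\<close> outside \<open>Inn(P)\<close> is in the extension domain of \<open>\<chi>\<close>.\<close>

lemma (in fusion_system) automorphism_extends:
  assumes P: "subgroup P S" and rec: "receptive S \<F> P" and fa: "fully_automized p S \<F> P"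
    and ncr: "P \<notin> centric_radicals p S \<F>" and \<chi>: "\<chi> \<in> \<F> P P"
  shows "\<exists>g\<in>extension_domain S P P \<chi>. g \<notin> P"
proof (cases "F_centric S \<F> P")
  case False
  then obtain c where c: "c \<in> centralizer S P" "c \<notin> P"
    using receptive_centralizer[OF P rec] by blast
  have cc: "c \<in> carrier S" and comm: "\<And>x. x \<in> P \<Longrightarrow> c \<otimes>\<^bsub>S\<^esub> x = x \<otimes>\<^bsub>S\<^esub> c"
    using c by (auto simp: centralizer_def)
  have cx: "c \<otimes>\<^bsub>S\<^esub> x \<otimes>\<^bsub>S\<^esub> inv\<^bsub>S\<^esub> c = x" if "x \<in> P" for x
    using S.conj_self_iff_commute[OF cc] comm[OF that] subgroup.mem_carrier[OF P that] by blast
  have "c \<in> extension_domain S P P \<chi>"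
    unfolding mem_extension_domain[OF P P \<chi> endo_surj[OF P \<chi>]]
  proof
    show "c \<in> transporter S P P" using cc cx by (simp add: transporter_iff)
    show "\<exists>h\<in>transporter S P P. \<forall>x\<in>P. \<chi> (c \<otimes>\<^bsub>S\<^esub> x \<otimes>\<^bsub>S\<^esub> inv\<^bsub>S\<^esub> c) = h \<otimes>\<^bsub>S\<^esub> \<chi> x \<otimes>\<^bsub>S\<^esub> inv\<^bsub>S\<^esub> h"
      using S.one_in_transporter[of P P] P hom_in[OF P P \<chi>]
      by (intro bexI[of _ "\<one>\<^bsub>S\<^esub>"]) (auto simp: cx subgroup.subset subgroup.mem_carrier)
  qed
  then show ?thesis using c by blast
next
  case True
  then have "\<not> F_radical p S \<F> P" using ncr P by (simp add: centric_radicals_def)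
  then obtain K n where K: "K \<lhd> Aut\<^sub>F S \<F> P" "card K = p ^ n" "\<not> K \<subseteq> Inn S P"
    using nonradical_normal_p_subgroup[OF P] by blast
  have KS: "K \<subseteq> Aut\<^sub>S S P" by (rule normal_p_subgroup_in_sylow[OF P fa K(1,2)])
  obtain k where k: "k \<in> K" "k \<notin> Inn S P" using K(3) by blast
  then obtain g where g: "g \<in> transporter S P P" "k = conj_map S P g"
    using KS by (auto simp: Aut\<^sub>S_def)
  have "g \<notin> P" using g k by (auto simp: Inn_def)
  interpret A: group "Aut\<^sub>F S \<F> P" by (rule group_AutF[OF P])
  have "\<chi> \<otimes>\<^bsub>Aut\<^sub>F S \<F> P\<^esub> k \<otimes>\<^bsub>Aut\<^sub>F S \<F> P\<^esub> inv\<^bsub>Aut\<^sub>F S \<F> P\<^esub> \<chi> \<in> K"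
    using normal.inv_op_closed2[OF K(1)] \<chi> k by simp
  then obtain h where h: "h \<in> transporter S P P"
    and eq: "compose P (compose P \<chi> k) (inv\<^bsub>Aut\<^sub>F S \<F> P\<^esub> \<chi>) = conj_map S P h"
    using KS by (auto simp: Aut\<^sub>S_def)
  have "\<chi> (g \<otimes>\<^bsub>S\<^esub> x \<otimes>\<^bsub>S\<^esub> inv\<^bsub>S\<^esub> g) = h \<otimes>\<^bsub>S\<^esub> \<chi> x \<otimes>\<^bsub>S\<^esub> inv\<^bsub>S\<^esub> h" if x: "x \<in> P" for x
  proof -
    have "\<chi> x \<in> P" using hom_in[OF P P \<chi> x] .
    then show ?thesis
      using fun_cong[OF eq, of "\<chi> x"] AutF_inv_apply(1)[OF P \<chi> x] x g(2)
      by (simp add: compose_def conj_map_apply)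
  qed
  then have "g \<in> extension_domain S P P \<chi>"
    using mem_extension_domain[OF P P \<chi> endo_surj[OF P \<chi>]] g h by blast
  then show ?thesis using \<open>g \<notin> P\<close> by blast
qed

text \<open>The group \<open>\<psi> Aut\<^sub>S(R) \<psi>\<^sup>-\<^sup>1\<close> is a \<open>p\<close>-subgroup of \<open>Aut\<^sub>F(P)\<close>, so some \<open>a\<close>
  conjugates it into the Sylow subgroup \<open>Aut\<^sub>S(P)\<close>.\<close>

lemma (in fusion_system) isomorphism_extends:
  assumes R: "subgroup R S" and P: "subgroup P S" and \<psi>: "\<psi> \<in> \<F> R P" "\<psi> ` R = P"
    and fa: "fully_automized p S \<F> P"
  obtains a where "a \<in> \<F> P P" "transporter S R R \<subseteq> extension_domain S R P (compose R a \<psi>)"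
proof -
  let ?A = "Aut\<^sub>F S \<F> P"
  interpret A: group ?A by (rule group_AutF[OF P])
  define \<kappa> where "\<kappa> = (\<lambda>g. \<lambda>x\<in>P. \<psi> (conj_map S R g (inv_into R \<psi> x)))"
  have N: "subgroup (transporter S R R) S"
    using S.normalizer_subgroup[OF finite_subgroup[OF R] R] .
  have \<kappa>: "\<kappa> \<in> hom (S\<lparr>carrier := transporter S R R\<rparr>) ?A"
    unfolding \<kappa>_def by (rule transported_conj_hom[OF R P \<psi>])
  obtain n where "order (S\<lparr>carrier := transporter S R R\<rparr>) = p ^ n"
    using order_subgroup[OF N] by (auto simp: order_def)
  then obtain a where "a \<in> carrier ?A"
    and sy: "\<And>g. g \<in> transporter S R R \<Longrightarrow> a \<otimes>\<^bsub>?A\<^esub> \<kappa> g \<otimes>\<^bsub>?A\<^esub> inv\<^bsub>?A\<^esub> a \<in> Aut\<^sub>S S P"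
    using p_group_hom_conjugate_into_sylow[OF prime_p A.is_group finite_AutF[OF P]
        fa[unfolded fully_automized_def] S.subgroup_imp_group[OF N] _ \<kappa>]
    by auto
  then have a: "a \<in> \<F> P P" by simp
  have \<chi>: "compose R a \<psi> \<in> \<F> R P" using compose_in[OF R P P \<psi>(1) a] .
  have \<chi>im: "compose R a \<psi> ` R = P"
    using \<psi>(2) endo_surj[OF P a] by (simp add: compose_def image_image[symmetric])
  have "g \<in> extension_domain S R P (compose R a \<psi>)" if g: "g \<in> transporter S R R" for g
  proof -
    obtain h where h: "h \<in> transporter S P P"
      and eq: "compose P (compose P a (\<kappa> g)) (inv\<^bsub>?A\<^esub> a) = conj_map S P h"
      using sy[OF g] by (auto simp: Aut\<^sub>S_def)
    have "compose R a \<psi> (g \<otimes>\<^bsub>S\<^esub> x \<otimes>\<^bsub>S\<^esub> inv\<^bsub>S\<^esub> g) = h \<otimes>\<^bsub>S\<^esub> compose R a \<psi> x \<otimes>\<^bsub>S\<^esub> inv\<^bsub>S\<^esub> h"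
      if x: "x \<in> R" for x
    proof -
      have px: "\<psi> x \<in> P" "a (\<psi> x) \<in> P" using \<psi> x hom_in[OF P P a] by auto
      have gx: "g \<otimes>\<^bsub>S\<^esub> x \<otimes>\<^bsub>S\<^esub> inv\<^bsub>S\<^esub> g \<in> R" using g x by (simp add: transporter_iff)
      have "a (\<kappa> g (\<psi> x)) = h \<otimes>\<^bsub>S\<^esub> a (\<psi> x) \<otimes>\<^bsub>S\<^esub> inv\<^bsub>S\<^esub> h"
        using fun_cong[OF eq, of "a (\<psi> x)"] AutF_inv_apply(1)[OF P a px(1)] px
        by (simp add: compose_def conj_map_apply)
      moreover have "\<kappa> g (\<psi> x) = \<psi> (g \<otimes>\<^bsub>S\<^esub> x \<otimes>\<^bsub>S\<^esub> inv\<^bsub>S\<^esub> g)"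
        using px x hom_inj[OF R P \<psi>(1)] by (simp add: \<kappa>_def conj_map_apply)
      ultimately show ?thesis using x gx by (simp add: compose_def)
    qed
    then show ?thesis using mem_extension_domain[OF R P \<chi> \<chi>im] g h by blast
  qed
  then show ?thesis using that[OF a] by blast
qed

text \<open>For a subgroup \<open>R\<close> let \<open>U\<close> be a fully automized and receptive conjugate of \<open>R\<close>, and suppose the claim
  for all larger subgroups. The automorphisms of \<open>U\<close> are in \<open>\<G>\<close> by assumption or, if \<open>U\<close> is not
  centric radical, because they extend to larger subgroups. An isomorphism from a proper
  subgroup \<open>V\<close> to \<open>U\<close> extends, up to an automorphism of \<open>U\<close>, to the normalizer of \<open>V\<close>, which is larger
  than \<open>V\<close>. Finally any morphism from \<open>R\<close> is an isomorphism onto \<open>U\<close>, followed by the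
  inverse of another one and by an inclusion.\<close>

theorem (in saturated_fusion_system) alperin_fusion:
  assumes G: "fusion_system p S \<G>"
    and cr: "\<And>P. P \<in> centric_radicals p S \<F> \<Longrightarrow> \<F> P P \<subseteq> \<G> P P"
    and P: "subgroup P S" and Q: "subgroup Q S"
  shows "\<F> P Q \<subseteq> \<G> P Q"
proof -
  interpret G: fusion_system p S \<G> by (rule G)
  have S: "subgroup (carrier S) S" by (rule S.subgroup_self)
  have main: "subgroup R S \<Longrightarrow> \<F> R (carrier S) \<subseteq> \<G> R (carrier S)" for R
  proof (induction "card (carrier S) - card R" arbitrary: R rule: less_induct)
    case less
    note R = less.prems
    have cle: "card R' \<le> card (carrier S)" if "subgroup R' S" for R'
      using card_mono[OF finite_S subgroup.subset[OF that]] .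
    have larger: "\<F> R' (carrier S) \<subseteq> \<G> R' (carrier S)" if "subgroup R' S" "card R < card R'" for R'
      using less.hyps[OF _ that(1)] cle[OF that(1)] that(2) by linarith
    obtain U where U: "F_conjugate S \<F> R U" and fa: "fully_automized p S \<F> U"
      and rec: "receptive S \<F> U"
      using saturated[OF R] by blast
    have sU: "subgroup U S" using U by (simp add: F_conjugate_iff)
    have cU: "card U = card R" using F_conjugate_card[OF U] by simp
    have aut: "\<F> U U \<subseteq> \<G> U U"
    proof (cases "U \<in> centric_radicals p S \<F>")
      case False
      show ?thesis
      proof
        fix \<chi> assume \<chi>: "\<chi> \<in> \<F> U U"
        obtain g where "g \<in> extension_domain S U U \<chi>" "g \<notin> U"
          using automorphism_extends[OF sU rec fa False \<chi>] by blast
        then show "\<chi> \<in> \<G> U U"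
          using extension_in_subsystem[OF G sU sU \<chi> endo_surj[OF sU \<chi>] rec] larger cU by simp
      qed
    qed (rule cr)
    have iso: "\<psi> \<in> \<G> V U" if V: "subgroup V S" and \<psi>: "\<psi> \<in> \<F> V U" "\<psi> ` V = U" for V \<psi>
    proof (cases "V = carrier S")
      case True
      have "card V = card U" using hom_inj[OF V sU \<psi>(1)] \<psi>(2) by (metis card_image)
      then have "U = V" using True card_subset_eq[OF finite_S subgroup.subset[OF sU]] by simp
      then show ?thesis using \<psi>(1) aut by blast
    next
      case False
      obtain a where a: "a \<in> \<F> U U"
        and ext: "transporter S V V \<subseteq> extension_domain S V U (compose V a \<psi>)"
        using isomorphism_extends[OF V sU \<psi> fa] .
      have cV: "card V = card R" using hom_inj[OF V sU \<psi>(1)] \<psi>(2) cU by (metis card_image)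
      obtain g where g: "g \<in> transporter S V V" "g \<notin> V"
        using normalizer_grows[OF prime_p p_group V False] .
      have "compose V a \<psi> \<in> \<F> V U" using compose_in[OF V sU sU \<psi>(1) a] .
      moreover have "compose V a \<psi> ` V = U"
        using \<psi>(2) endo_surj[OF sU a] by (simp add: compose_def image_image[symmetric])
      ultimately have "compose V a \<psi> \<in> \<G> V U"
        using extension_in_subsystem[OF G V sU _ _ rec] ext g larger cV by auto
      moreover have "inv\<^bsub>Aut\<^sub>F S \<F> U\<^esub> a \<in> \<G> U U" using aut AutF_inv_closed[OF sU a] by blast
      ultimately have "compose V (inv\<^bsub>Aut\<^sub>F S \<F> U\<^esub> a) (compose V a \<psi>) \<in> \<G> V U"
        using G.compose_in[OF V sU sU] by blast
      moreover have "compose V (inv\<^bsub>Aut\<^sub>F S \<F> U\<^esub> a) (compose V a \<psi>) = \<psi>"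
        using hom_in[OF V sU \<psi>(1)] AutF_inv_apply(1)[OF sU a] extensional_arb[OF hom_ext[OF V sU \<psi>(1)]]
        by (auto simp: compose_def fun_eq_iff)
      ultimately show ?thesis by simp
    qed
    show ?case
    proof
      fix \<phi> assume \<phi>: "\<phi> \<in> \<F> R (carrier S)"
      \<comment> \<open>\<open>\<phi>\<close> is \<open>\<psi>\<close> followed by the inverse of \<open>\<theta> = \<psi> \<phi>\<^sup>-\<^sup>1\<close>, and both of these are isomorphisms onto \<open>U\<close>.\<close>
      let ?V = "\<phi> ` R"
      have V: "subgroup ?V S" by (rule image_subgroup[OF R S \<phi>])
      have \<phi>V: "\<phi> \<in> \<F> R ?V" by (rule onto_image_in[OF R S \<phi>])
      obtain \<psi> where \<psi>: "\<psi> \<in> \<F> R U" "\<psi> ` R = U" using U by (auto simp: F_conjugate_iff)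
      let ?\<phi>' = "restrict (inv_into R \<phi>) ?V"
      have \<phi>': "?\<phi>' \<in> \<F> ?V R" "?\<phi>' ` ?V = R" using inverse_in'[OF R V \<phi>V] by simp_all
      let ?\<theta> = "compose ?V \<psi> ?\<phi>'"
      have \<theta>: "?\<theta> \<in> \<F> ?V U" by (rule compose_in[OF V R sU \<phi>'(1) \<psi>(1)])
      have \<theta>im: "?\<theta> ` ?V = U"
        using \<phi>'(2) \<psi>(2) by (simp add: compose_def image_image[symmetric])
      have "?\<theta> \<in> \<G> ?V U" using iso[OF V \<theta> \<theta>im] .
      then have "restrict (inv_into ?V ?\<theta>) U \<in> \<G> U ?V" using G.inverse_in'(1)[OF V sU _ \<theta>im] by blast
      moreover have "\<psi> \<in> \<G> R U" using iso[OF R \<psi>] .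
      ultimately have "compose R (restrict (inv_into ?V ?\<theta>) U) \<psi> \<in> \<G> R ?V"
        using G.compose_in[OF R sU V] by blast
      moreover have "compose R (restrict (inv_into ?V ?\<theta>) U) \<psi> = \<phi>"
      proof
        fix x show "compose R (restrict (inv_into ?V ?\<theta>) U) \<psi> x = \<phi> x"
        proof (cases "x \<in> R")
          case True
          have "?\<theta> (\<phi> x) = \<psi> x"
            using True hom_inj[OF R S \<phi>] by (simp add: compose_def)
          then show ?thesis
            using inv_into_f_f[OF hom_inj[OF V sU \<theta>], of "\<phi> x"] True \<psi>(2) by (auto simp: compose_def)
        qed (use extensional_arb[OF hom_ext[OF R S \<phi>]] in \<open>simp add: compose_def\<close>)
      qed
      ultimately show "\<phi> \<in> \<G> R (carrier S)"
        using G.enlarge_codomain[OF R V _ S subgroup.subset[OF V]] by simp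
    qed
  qed
  show ?thesis
  proof
    fix \<phi> assume \<phi>: "\<phi> \<in> \<F> P Q"
    then have "\<phi> \<in> \<G> P (carrier S)"
      using main[OF P] enlarge_codomain[OF P Q _ S subgroup.subset[OF Q]] by blast
    then show "\<phi> \<in> \<G> P Q" using G.change_codomain[OF P S _ Q] hom_in[OF P Q \<phi>] by blast
  qed
qed

section \<open>Equivalences of categories\<close>

lemma functor_eqI:
  assumes "restrict_func C F = F" "restrict_func C G = G"
    and "\<And>x. x \<in> Obj C \<Longrightarrow> fobj F x = fobj G x"
    and "\<And>x y f. \<lbrakk>x \<in> Obj C; y \<in> Obj C; f \<in> Hom C x y\<rbrakk> \<Longrightarrow> fmor F x y f = fmor G x y f"
  shows "F = G"
proof -
  have "restrict_func C F = restrict_func C G"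
    using assms(3,4) by (auto simp: restrict_func_def fun_eq_iff restrict_def)
  then show ?thesis using assms(1,2) by simp
qed

lemma restrict_func_idem [simp]: "restrict_func C (restrict_func C F) = restrict_func C F"
  by (auto simp: restrict_func_def fun_eq_iff)

lemma fobj_restrict_func [simp]: "x \<in> Obj C \<Longrightarrow> fobj (restrict_func C F) x = fobj F x"
  and fmor_restrict_func [simp]:
    "\<lbrakk>x \<in> Obj C; y \<in> Obj C; f \<in> Hom C x y\<rbrakk> \<Longrightarrow> fmor (restrict_func C F) x y f = fmor F x y f"
  by (auto simp: restrict_func_def)

lemma fobj_comp_func [simp]: "x \<in> Obj C \<Longrightarrow> fobj (comp_func C G F) x = fobj G (fobj F x)"
  and fmor_comp_func [simp]:
    "\<lbrakk>x \<in> Obj C; y \<in> Obj C; f \<in> Hom C x y\<rbrakk>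
      \<Longrightarrow> fmor (comp_func C G F) x y f = fmor G (fobj F x) (fobj F y) (fmor F x y f)"
  and normalized_comp_func [simp]: "restrict_func C (comp_func C G F) = comp_func C G F"
  by (simp_all add: comp_func_def)

lemma fobj_id_func [simp]: "x \<in> Obj C \<Longrightarrow> fobj (id_func C) x = x"
  and fmor_id_func [simp]:
    "\<lbrakk>x \<in> Obj C; y \<in> Obj C; f \<in> Hom C x y\<rbrakk> \<Longrightarrow> fmor (id_func C) x y f = f"
  and normalized_id_func [simp]: "restrict_func C (id_func C) = id_func C"
  by (simp_all add: id_func_def)

context category
begin

lemma iso_left_cancel:
  assumes h: "h \<in> Iso C x y" and ob: "w \<in> Obj C" "x \<in> Obj C" "y \<in> Obj C"
    and f: "f \<in> Hom C w x" and g: "g \<in> Hom C w x"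
    and eq: "Comp C w x y h f = Comp C w x y h g"
  shows "f = g"
proof -
  obtain k where k: "h \<in> Hom C x y" "k \<in> Hom C y x" "Comp C x y x k h = Id C x"
    using h by (auto simp: Iso_def inverse_mor_def)
  have "Comp C w y x k (Comp C w x y h e) = e" if "e \<in> Hom C w x" for e
    using Comp_assoc[OF ob(1-3) ob(2) that k(1,2)] k(3) Comp_Id_left[OF ob(1,2) that] by simp
  then show ?thesis using eq f g by metis
qed

lemma iso_right_cancel:
  assumes h: "h \<in> Iso C x y" and ob: "x \<in> Obj C" "y \<in> Obj C" "z \<in> Obj C"
    and f: "f \<in> Hom C y z" and g: "g \<in> Hom C y z"
    and eq: "Comp C x y z f h = Comp C x y z g h"
  shows "f = g"
proof -
  obtain k where k: "h \<in> Hom C x y" "k \<in> Hom C y x" "Comp C y x y h k = Id C y"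
    using h by (auto simp: Iso_def inverse_mor_def)
  have "Comp C y x z (Comp C x y z e h) k = e" if "e \<in> Hom C y z" for e
    using Comp_assoc[OF ob(2,1,2,3) k(2,1) that] k(3) Comp_Id_right[OF ob(2,3) that] by simp
  then show ?thesis using eq f g by metis
qed

end

lemma (in cat_functor) fmor_inverse_mor:
  assumes "inverse_mor C x y f g" "x \<in> Obj C" "y \<in> Obj C"
  shows "inverse_mor D (fobj F x) (fobj F y) (fmor F x y f) (fmor F y x g)"
  using assms fmor_in_Hom[of x y f] fmor_in_Hom[of y x g] fmor_Comp[of x y x f g]
    fmor_Comp[of y x y g f] fmor_Id[of x] fmor_Id[of y]
  by (auto simp: inverse_mor_def)

lemma functor_faithful_left:
  assumes F: "cat_functor C D F" and G: "cat_functor D C G"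
    and \<eta>: "natural_iso C C (id_func C) (comp_func C G F) \<eta>"
    and x: "x \<in> Obj C" and y: "y \<in> Obj C" and f: "f \<in> Hom C x y" and g: "g \<in> Hom C x y"
    and eq: "fmor F x y f = fmor F x y g"
  shows "f = g"
proof -
  interpret F: cat_functor C D F by (rule F)
  have "\<eta> y \<in> Iso C y (fobj G (fobj F y))" using \<eta> y by (simp add: natural_iso_def)
  moreover have "Comp C x y (fobj G (fobj F y)) (\<eta> y) f = Comp C x y (fobj G (fobj F y)) (\<eta> y) g"
  proof -
    have "Comp C x y (fobj G (fobj F y)) (\<eta> y) h =
        Comp C x (fobj G (fobj F x)) (fobj G (fobj F y)) (fmor G (fobj F x) (fobj F y) (fmor F x y h)) (\<eta> x)"
      if "h \<in> Hom C x y" for h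
      using \<eta> x y that by (simp add: natural_iso_def)
    then show ?thesis using f g eq by simp
  qed
  moreover have "fobj G (fobj F y) \<in> Obj C"
    using y F.fobj_in_Obj cat_functor.fobj_in_Obj[OF G] by blast
  ultimately show ?thesis using F.source.iso_left_cancel x y f g by blast
qed

text \<open>The other functor of an equivalence is faithful as well; fullness depends on this.\<close>

lemma functor_faithful_right:
  assumes F: "cat_functor C D F" and G: "cat_functor D C G"
    and \<epsilon>: "natural_iso D D (comp_func D F G) (id_func D) \<epsilon>"
    and x: "x \<in> Obj D" and y: "y \<in> Obj D" and f: "f \<in> Hom D x y" and g: "g \<in> Hom D x y"
    and eq: "fmor G x y f = fmor G x y g"
  shows "f = g"
proof -
  interpret F: cat_functor C D F by (rule F)
  have "\<epsilon> x \<in> Iso D (fobj F (fobj G x)) x" using \<epsilon> x by (simp add: natural_iso_def)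
  moreover have "Comp D (fobj F (fobj G x)) x y f (\<epsilon> x) = Comp D (fobj F (fobj G x)) x y g (\<epsilon> x)"
  proof -
    have "Comp D (fobj F (fobj G x)) x y h (\<epsilon> x) =
        Comp D (fobj F (fobj G x)) (fobj F (fobj G y)) y (\<epsilon> y) (fmor F (fobj G x) (fobj G y) (fmor G x y h))"
      if "h \<in> Hom D x y" for h
      using \<epsilon> x y that by (simp add: natural_iso_def)
    then show ?thesis using f g eq by simp
  qed
  moreover have "fobj F (fobj G x) \<in> Obj D"
    using x F.fobj_in_Obj cat_functor.fobj_in_Obj[OF G] by blast
  ultimately show ?thesis using F.target.iso_right_cancel x y f g by blast
qed

lemma equivalence_faithful:
  assumes "cat_equivalence C D F"
    and "x \<in> Obj C" "y \<in> Obj C" "f \<in> Hom C x y" "g \<in> Hom C x y" "fmor F x y f = fmor F x y g"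
  shows "f = g"
  using assms functor_faithful_left[of C D F] unfolding cat_equivalence_def by blast

lemma equivalence_essentially_surjective:
  assumes "cat_equivalence C D F" and z: "z \<in> Obj D"
  shows "\<exists>x\<in>Obj C. Iso D (fobj F x) z \<noteq> {}"
proof -
  obtain G \<epsilon> where G: "cat_functor D C G"
    and \<epsilon>: "natural_iso D D (comp_func D F G) (id_func D) \<epsilon>"
    using assms(1) by (auto simp: cat_equivalence_def)
  have "\<epsilon> z \<in> Iso D (fobj F (fobj G z)) z" using \<epsilon> z by (simp add: natural_iso_def)
  then show ?thesis using cat_functor.fobj_in_Obj[OF G z] by blast
qed

text \<open>The candidate preimage of \<open>g\<close> is the \<open>\<eta>\<close>-conjugate of \<open>G(g)\<close>: its image has the same
  image under the faithful functor \<open>G\<close> as \<open>g\<close>.\<close>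

lemma equivalence_full:
  assumes "cat_equivalence C D F" and x: "x \<in> Obj C" and y: "y \<in> Obj C"
    and g: "g \<in> Hom D (fobj F x) (fobj F y)"
  shows "\<exists>f\<in>Hom C x y. fmor F x y f = g"
proof -
  obtain G \<eta> \<epsilon> where F: "cat_functor C D F" and G: "cat_functor D C G"
    and \<eta>: "natural_iso C C (id_func C) (comp_func C G F) \<eta>"
    and \<epsilon>: "natural_iso D D (comp_func D F G) (id_func D) \<epsilon>"
    using assms(1) by (auto simp: cat_equivalence_def)
  interpret F: cat_functor C D F by (rule F)
  interpret G: cat_functor D C G by (rule G)
  let ?x = "fobj G (fobj F x)" and ?y = "fobj G (fobj F y)"
  have ob: "fobj F x \<in> Obj D" "fobj F y \<in> Obj D" "?x \<in> Obj C" "?y \<in> Obj C"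
    using x y F.fobj_in_Obj G.fobj_in_Obj by simp_all
  have \<eta>x: "\<eta> x \<in> Iso C x ?x" and \<eta>y: "\<eta> y \<in> Iso C y ?y" using \<eta> x y by (simp_all add: natural_iso_def)
  obtain k where k: "\<eta> y \<in> Hom C y ?y" "k \<in> Hom C ?y y" "Comp C ?y y ?y (\<eta> y) k = Id C ?y"
    using \<eta>y by (auto simp: Iso_def inverse_mor_def)
  have \<eta>xH: "\<eta> x \<in> Hom C x ?x" using \<eta>x by (auto simp: Iso_def inverse_mor_def)
  let ?g = "fmor G (fobj F x) (fobj F y) g"
  have Gg: "?g \<in> Hom C ?x ?y" using G.fmor_in_Hom ob g by blast
  have gx: "Comp C x ?x ?y ?g (\<eta> x) \<in> Hom C x ?y" using F.source.Comp_in_Hom x ob \<eta>xH Gg by blast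
  define f where "f = Comp C x ?y y k (Comp C x ?x ?y ?g (\<eta> x))"
  have f: "f \<in> Hom C x y" unfolding f_def using F.source.Comp_in_Hom x y ob k gx by blast
  have "Comp C x y ?y (\<eta> y) f = Comp C x ?x ?y ?g (\<eta> x)"
    unfolding f_def using x y ob k gx by (simp add: F.source.Comp_assoc F.source.Comp_Id_left)
  moreover have "Comp C x y ?y (\<eta> y) f = Comp C x ?x ?y (fmor G (fobj F x) (fobj F y) (fmor F x y f)) (\<eta> x)"
    using \<eta> x y f by (simp add: natural_iso_def)
  moreover have FfH: "fmor F x y f \<in> Hom D (fobj F x) (fobj F y)" using F.fmor_in_Hom x y f by blast
  ultimately have "fmor G (fobj F x) (fobj F y) (fmor F x y f) = ?g"
    using F.source.iso_right_cancel[OF \<eta>x x ob(3,4) _ Gg] G.fmor_in_Hom[OF ob(1,2)] by metis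
  then have "fmor F x y f = g"
    using functor_faithful_right[OF F G \<epsilon> ob(1,2) FfH g] by blast
  then show ?thesis using f by blast
qed

section \<open>Morphisms of transporter systems\<close>

context transporter_system
begin

sublocale delta: cat_functor "transporter_cat S \<Delta>" T \<delta> by (rule functor_delta)
sublocale pi: cat_functor T "fusion_cat S \<F>" \<pi> by (rule functor_pi)

lemma carrier_in_Delta: "carrier S \<in> \<Delta>"
proof -
  obtain P where "P \<in> \<Delta>" using nonempty by blast
  then show ?thesis using A1_overgroups[OF _ S.subgroup_self] A1_subgroups subgroup.subset by blast
qed

lemma delta_in_Hom: "\<lbrakk>P \<in> \<Delta>; Q \<in> \<Delta>; g \<in> transporter S P Q\<rbrakk> \<Longrightarrow> fmor \<delta> P Q g \<in> Hom T P Q"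
  using delta.fmor_in_Hom[of P Q g] by (simp add: transporter_cat_def A1_delta)

lemma delta_mult:
  "\<lbrakk>P \<in> \<Delta>; Q \<in> \<Delta>; R \<in> \<Delta>; g \<in> transporter S P Q; h \<in> transporter S Q R\<rbrakk>
    \<Longrightarrow> fmor \<delta> P R (h \<otimes>\<^bsub>S\<^esub> g) = Comp T P Q R (fmor \<delta> Q R h) (fmor \<delta> P Q g)"
  using delta.fmor_Comp[of P Q R g h] by (simp add: transporter_cat_def A1_delta)

lemma one_in_transporter: "\<lbrakk>P \<in> \<Delta>; P \<subseteq> Q\<rbrakk> \<Longrightarrow> \<one>\<^bsub>S\<^esub> \<in> transporter S P Q"
  using S.one_in_transporter A1_subgroups subgroup.subset by blast

lemma transporter_in_carrier: "g \<in> transporter S P Q \<Longrightarrow> g \<in> carrier S"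
  by (simp add: transporter_def)

lemma delta_compose_inclusion:
  assumes "P \<in> \<Delta>" "Q \<in> \<Delta>" "R \<in> \<Delta>" "P \<subseteq> Q" "g \<in> transporter S Q R"
  shows "Comp T P Q R (fmor \<delta> Q R g) (fmor \<delta> P Q \<one>\<^bsub>S\<^esub>) = fmor \<delta> P R g"
  using delta_mult[of P Q R "\<one>\<^bsub>S\<^esub>" g] assms one_in_transporter[of P Q] transporter_in_carrier[of g]
  by simp

lemma inclusion_compose_delta:
  assumes "P \<in> \<Delta>" "Q \<in> \<Delta>" "R \<in> \<Delta>" "Q \<subseteq> R" "g \<in> transporter S P Q"
  shows "Comp T P Q R (fmor \<delta> Q R \<one>\<^bsub>S\<^esub>) (fmor \<delta> P Q g) = fmor \<delta> P R g"
  using delta_mult[of P Q R g "\<one>\<^bsub>S\<^esub>"] assms one_in_transporter[of Q R] transporter_in_carrier[of g]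
  by simp

lemma pi_in_F: "\<lbrakk>P \<in> \<Delta>; Q \<in> \<Delta>; \<phi> \<in> Hom T P Q\<rbrakk> \<Longrightarrow> fmor \<pi> P Q \<phi> \<in> \<F> P Q"
  using A2_surjective by blast

lemma pi_Comp:
  "\<lbrakk>P \<in> \<Delta>; Q \<in> \<Delta>; R \<in> \<Delta>; \<phi> \<in> Hom T P Q; \<psi> \<in> Hom T Q R\<rbrakk>
    \<Longrightarrow> fmor \<pi> P R (Comp T P Q R \<psi> \<phi>) = compose P (fmor \<pi> Q R \<psi>) (fmor \<pi> P Q \<phi>)"
  using pi.fmor_Comp[of P Q R \<phi> \<psi>] by (simp add: fusion_cat_def A1_pi Obj_T)

lemma pi_Id: "P \<in> \<Delta> \<Longrightarrow> fmor \<pi> P P (Id T P) = (\<lambda>x\<in>P. x)"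
  using pi.fmor_Id[of P] by (simp add: fusion_cat_def A1_pi Obj_T)

lemma isomorphic_imp_F_conjugate:
  assumes P: "P \<in> \<Delta>" and Q: "Q \<in> \<Delta>" and iso: "Iso T P Q \<noteq> {}"
  shows "F_conjugate S \<F> P Q"
proof -
  obtain \<phi> \<psi> where "inverse_mor T P Q \<phi> \<psi>" using iso by (auto simp: Iso_def)
  then have "inverse_mor (fusion_cat S \<F>) P Q (fmor \<pi> P Q \<phi>) (fmor \<pi> Q P \<psi>)"
    using pi.fmor_inverse_mor[of P Q \<phi> \<psi>] P Q by (simp add: Obj_T A1_pi)
  then show ?thesis using P Q A1_subgroups by (auto simp: F_conjugate_def Iso\<^sub>F_def Iso_def)
qed

text \<open>The map \<open>\<pi>(\<psi>)\<close> is injective, so \<open>\<phi>1\<close> and \<open>\<phi>2\<close> have the same image in \<open>\<F>\<close> and differ by an element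
  of \<open>E(P)\<close>, which is trivial as \<open>E(P)\<close> acts freely on the morphisms from \<open>P\<close> to \<open>R\<close>.\<close>

lemma mor_mono:
  assumes P: "P \<in> \<Delta>" and Q: "Q \<in> \<Delta>" and R: "R \<in> \<Delta>" and \<psi>: "\<psi> \<in> Hom T Q R"
    and \<phi>1: "\<phi>1 \<in> Hom T P Q" and \<phi>2: "\<phi>2 \<in> Hom T P Q"
    and eq: "Comp T P Q R \<psi> \<phi>1 = Comp T P Q R \<psi> \<phi>2"
  shows "\<phi>1 = \<phi>2"
proof -
  have sP: "subgroup P S" and sQ: "subgroup Q S" and sR: "subgroup R S"
    using P Q R A1_subgroups by simp_all
  have F: "fmor \<pi> P Q \<phi>1 \<in> \<F> P Q" "fmor \<pi> P Q \<phi>2 \<in> \<F> P Q" "fmor \<pi> Q R \<psi> \<in> \<F> Q R"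
    using pi_in_F P Q R \<phi>1 \<phi>2 \<psi> by simp_all
  have ceq: "compose P (fmor \<pi> Q R \<psi>) (fmor \<pi> P Q \<phi>1) = compose P (fmor \<pi> Q R \<psi>) (fmor \<pi> P Q \<phi>2)"
    using eq pi_Comp P Q R \<phi>1 \<phi>2 \<psi> by metis
  have "fmor \<pi> P Q \<phi>1 x = fmor \<pi> P Q \<phi>2 x" for x
  proof (cases "x \<in> P")
    case True
    then have "fmor \<pi> Q R \<psi> (fmor \<pi> P Q \<phi>1 x) = fmor \<pi> Q R \<psi> (fmor \<pi> P Q \<phi>2 x)"
      using fun_cong[OF ceq, of x] by (simp add: compose_def)
    then show ?thesis
      using hom_inj[OF sQ sR F(3)] hom_in[OF sP sQ F(1) True] hom_in[OF sP sQ F(2) True]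
      by (meson inj_onD)
  qed (use extensional_arb[OF hom_ext[OF sP sQ F(1)]] extensional_arb[OF hom_ext[OF sP sQ F(2)]] in simp)
  then have "fmor \<pi> P Q \<phi>1 = fmor \<pi> P Q \<phi>2" by blast
  then obtain e where e: "e \<in> E P" "\<phi>2 = Comp T P P Q \<phi>1 e" using A2_orbits P Q \<phi>1 \<phi>2 by blast
  have eH: "e \<in> Hom T P P" using e by (simp add: E_def)
  have "Comp T P P R (Comp T P Q R \<psi> \<phi>1) e = Comp T P Q R \<psi> \<phi>1"
    using eq e Comp_assoc[of P P Q R e \<phi>1 \<psi>] eH \<phi>1 \<psi> P Q R by (simp add: Obj_T)
  moreover have "Comp T P Q R \<psi> \<phi>1 \<in> Hom T P R" using Comp_in_Hom P Q R \<phi>1 \<psi> by (simp add: Obj_T)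
  ultimately have "e = Id T P" using A2_free_right[OF P R _ e(1)] by blast
  then show ?thesis using e Comp_Id_right P Q \<phi>1 by (simp add: Obj_T)
qed

text \<open>A morphism factors through its image \<open>R\<close> because \<open>\<pi>(\<psi>)\<close> does in \<open>\<F>\<close>: lifts of the corestriction and of its
  inverse have the required properties up to elements of \<open>E(P)\<close> and \<open>E(R)\<close>. The right
  inverse \<open>\<chi>\<close> serves to cancel \<open>\<psi>\<^sub>0\<close> on the right.\<close>

lemma mor_factorization:
  assumes P: "P \<in> \<Delta>" and Q: "Q \<in> \<Delta>" and \<psi>: "\<psi> \<in> Hom T P Q"
  obtains R \<psi>\<^sub>0 \<chi> where "R \<in> \<Delta>" "R \<subseteq> Q" "\<psi>\<^sub>0 \<in> Hom T P R" "\<chi> \<in> Hom T R P"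
    "\<psi> = Comp T P R Q (fmor \<delta> R Q \<one>\<^bsub>S\<^esub>) \<psi>\<^sub>0" "Comp T R P R \<psi>\<^sub>0 \<chi> = Id T R"
proof -
  have sP: "subgroup P S" and sQ: "subgroup Q S" using P Q A1_subgroups by simp_all
  let ?\<phi> = "fmor \<pi> P Q \<psi>"
  have \<phi>: "?\<phi> \<in> \<F> P Q" using pi_in_F P Q \<psi> by blast
  define R where "R = ?\<phi> ` P"
  have conj: "F_conjugate S \<F> P R" unfolding R_def by (rule F_conjugate_image[OF sP sQ \<phi>])
  have R: "R \<in> \<Delta>" using A1_conjugates[OF P conj] .
  have sR: "subgroup R S" using R A1_subgroups by blast
  have RQ: "R \<subseteq> Q" using hom_in[OF sP sQ \<phi>] by (auto simp: R_def)
  have \<phi>R: "?\<phi> \<in> \<F> P R" unfolding R_def by (rule onto_image_in[OF sP sQ \<phi>])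
  obtain \<psi>' where \<psi>': "\<psi>' \<in> Hom T P R" "fmor \<pi> P R \<psi>' = ?\<phi>"
    using A2_surjective[OF P R] \<phi>R by (metis imageE)
  have one: "\<one>\<^bsub>S\<^esub> \<in> transporter S R Q" by (rule one_in_transporter[OF R RQ])
  let ?\<iota> = "fmor \<delta> R Q \<one>\<^bsub>S\<^esub>"
  have \<iota>: "?\<iota> \<in> Hom T R Q" by (rule delta_in_Hom[OF R Q one])
  have \<iota>\<psi>': "Comp T P R Q ?\<iota> \<psi>' \<in> Hom T P Q" using Comp_in_Hom P Q R \<iota> \<psi>' by (simp add: Obj_T)
  have incl: "fmor \<pi> R Q ?\<iota> x = x" if "x \<in> R" for x
    using B_conj[OF R Q one] that subgroup.mem_carrier[OF sR that] by (simp add: conj_map_apply)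
  have comp_incl: "compose P (fmor \<pi> R Q ?\<iota>) \<theta> = \<theta>" if "\<theta> \<in> \<F> P R" for \<theta>
    using incl hom_in[OF sP sR that] extensional_arb[OF hom_ext[OF sP sR that]]
    by (auto simp: compose_def fun_eq_iff)
  have "fmor \<pi> P Q (Comp T P R Q ?\<iota> \<psi>') = ?\<phi>"
    using pi_Comp[OF P R Q \<psi>'(1) \<iota>] \<psi>'(2) comp_incl[OF \<phi>R] by simp
  then obtain e where e: "e \<in> E P" "\<psi> = Comp T P P Q (Comp T P R Q ?\<iota> \<psi>') e"
    using A2_orbits[OF P Q \<iota>\<psi>' \<psi>] by blast
  have eH: "e \<in> Hom T P P" using e by (simp add: E_def)
  define \<psi>\<^sub>0 where "\<psi>\<^sub>0 = Comp T P P R \<psi>' e"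
  have \<psi>\<^sub>0: "\<psi>\<^sub>0 \<in> Hom T P R" unfolding \<psi>\<^sub>0_def using Comp_in_Hom P R \<psi>' eH by (simp add: Obj_T)
  have fac: "\<psi> = Comp T P R Q ?\<iota> \<psi>\<^sub>0"
    unfolding \<psi>\<^sub>0_def e(2) using Comp_assoc P Q R \<psi>' eH \<iota> by (simp add: Obj_T)
  have \<pi>\<psi>\<^sub>0: "fmor \<pi> P R \<psi>\<^sub>0 = ?\<phi>"
    using pi_Comp[OF P R Q \<psi>\<^sub>0 \<iota>] fac comp_incl[OF pi_in_F[OF P R \<psi>\<^sub>0]] by simp
  have "restrict (inv_into P ?\<phi>) R \<in> \<F> R P"
    using inverse_in'(1)[OF sP sR \<phi>R] by (simp add: R_def)
  then obtain \<chi>' where \<chi>': "\<chi>' \<in> Hom T R P" "fmor \<pi> R P \<chi>' = restrict (inv_into P ?\<phi>) R"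
    using A2_surjective[OF R P] by (metis imageE)
  let ?e = "Comp T R P R \<psi>\<^sub>0 \<chi>'"
  have eH': "?e \<in> Hom T R R" using Comp_in_Hom P R \<psi>\<^sub>0 \<chi>' by (simp add: Obj_T)
  have "fmor \<pi> R R ?e = (\<lambda>x\<in>R. x)"
    unfolding pi_Comp[OF R P R \<chi>'(1) \<psi>\<^sub>0] \<pi>\<psi>\<^sub>0 \<chi>'(2)
    by (auto simp: compose_def R_def f_inv_into_f)
  then obtain e' where e': "e' \<in> E R" "Id T R = Comp T R R R ?e e'"
    using A2_orbits[OF R R eH', of "Id T R"] pi_Id[OF R] Id_in_Hom[of R] R by (auto simp: Obj_T)
  have e'H: "e' \<in> Hom T R R" using e' by (simp add: E_def)
  have "Comp T R P R \<psi>\<^sub>0 (Comp T R R P \<chi>' e') = Id T R"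
    using e'(2) Comp_assoc P R \<psi>\<^sub>0 \<chi>' e'H by (simp add: Obj_T)
  moreover have "Comp T R R P \<chi>' e' \<in> Hom T R P" using Comp_in_Hom P R \<chi>' e'H by (simp add: Obj_T)
  ultimately show ?thesis using that R RQ \<psi>\<^sub>0 fac by blast
qed

text \<open>Cancelling the split epimorphism \<open>\<psi>\<^sub>0\<close> leaves
  \<open>\<delta>\<^bsub>R,W\<^esub>(g) = \<delta>\<^bsub>R,W\<^esub>(h)\<close>.\<close>

lemma delta_right_cancel:
  assumes P: "P \<in> \<Delta>" and Q: "Q \<in> \<Delta>" and W: "W \<in> \<Delta>" and \<psi>: "\<psi> \<in> Hom T P Q"
    and g: "g \<in> transporter S Q W" and h: "h \<in> transporter S Q W"
    and eq: "Comp T P Q W (fmor \<delta> Q W g) \<psi> = Comp T P Q W (fmor \<delta> Q W h) \<psi>"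
  shows "g = h"
proof -
  obtain R \<psi>\<^sub>0 \<chi> where R: "R \<in> \<Delta>" "R \<subseteq> Q" and \<psi>\<^sub>0: "\<psi>\<^sub>0 \<in> Hom T P R" and \<chi>: "\<chi> \<in> Hom T R P"
    and fac: "\<psi> = Comp T P R Q (fmor \<delta> R Q \<one>\<^bsub>S\<^esub>) \<psi>\<^sub>0" and inv: "Comp T R P R \<psi>\<^sub>0 \<chi> = Id T R"
    using mor_factorization[OF P Q \<psi>] by metis
  have one: "fmor \<delta> R Q \<one>\<^bsub>S\<^esub> \<in> Hom T R Q"
    using delta_in_Hom[OF R(1) Q one_in_transporter[OF R]] .
  have key: "Comp T R P W (Comp T P Q W (fmor \<delta> Q W k) \<psi>) \<chi> = fmor \<delta> R W k"
    and RW: "k \<in> transporter S R W" if k: "k \<in> transporter S Q W" for k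
  proof -
    show RW: "k \<in> transporter S R W" using k R(2) by (auto simp: transporter_iff)
    have kH: "fmor \<delta> Q W k \<in> Hom T Q W" "fmor \<delta> R W k \<in> Hom T R W"
      using delta_in_Hom k RW Q R W by simp_all
    have "Comp T P Q W (fmor \<delta> Q W k) \<psi> = Comp T P R W (fmor \<delta> R W k) \<psi>\<^sub>0"
      unfolding fac using Comp_assoc[of P R Q W \<psi>\<^sub>0 _ "fmor \<delta> Q W k"] \<psi>\<^sub>0 one kH P Q R W
        delta_compose_inclusion[OF R(1) Q W R(2) k] by (simp add: Obj_T)
    then have "Comp T R P W (Comp T P Q W (fmor \<delta> Q W k) \<psi>) \<chi> =
        Comp T R R W (fmor \<delta> R W k) (Comp T R P R \<psi>\<^sub>0 \<chi>)"
      using Comp_assoc[of R P R W \<chi> \<psi>\<^sub>0 "fmor \<delta> R W k"] \<psi>\<^sub>0 \<chi> kH P R W by (simp add: Obj_T)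
    then show "Comp T R P W (Comp T P Q W (fmor \<delta> Q W k) \<psi>) \<chi> = fmor \<delta> R W k"
      using inv kH R W by (simp add: Comp_Id_right Obj_T)
  qed
  have "fmor \<delta> R W g = fmor \<delta> R W h" using key g h eq by metis
  then show ?thesis using B_injective[OF R(1) W] RW g h by (meson inj_onD)
qed

end

section \<open>Transport of fusion systems along a group isomorphism\<close>

text \<open>This is \<open>\<beta> \<phi> \<beta>\<^sup>-\<^sup>1\<close>, as a morphism from \<open>\<beta>(P)\<close>; the parameter \<open>\<gamma>\<close> stands for the inverse of \<open>\<beta>\<close>.\<close>

definition conj_along :: "('a \<Rightarrow> 'b) \<Rightarrow> ('b \<Rightarrow> 'a) \<Rightarrow> 'a set \<Rightarrow> ('a \<Rightarrow> 'a) \<Rightarrow> 'b \<Rightarrow> 'b" where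
  "conj_along \<beta> \<gamma> P \<phi> = (\<lambda>y\<in>\<beta> ` P. \<beta> (\<phi> (\<gamma> y)))"

definition transported_fusion ::
    "('a \<Rightarrow> 'b) \<Rightarrow> ('b \<Rightarrow> 'a) \<Rightarrow> 'a fusion \<Rightarrow> 'b fusion" where
  "transported_fusion \<beta> \<gamma> \<F> P Q = conj_along \<beta> \<gamma> (\<gamma> ` P) ` \<F> (\<gamma> ` P) (\<gamma> ` Q)"

text \<open>Having \<open>\<beta>\<close> and its inverse as symmetric parameters makes every result available in both
  directions.\<close>

locale mutually_inverse_homs = S: group S + S': group S'
  for S :: "'a monoid" and S' :: "'b monoid" +
  fixes \<beta> :: "'a \<Rightarrow> 'b" and \<gamma> :: "'b \<Rightarrow> 'a"
  assumes \<beta>_hom: "\<beta> \<in> hom S S'" and \<gamma>_hom: "\<gamma> \<in> hom S' S"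
    and \<gamma>\<beta> [simp]: "x \<in> carrier S \<Longrightarrow> \<gamma> (\<beta> x) = x"
    and \<beta>\<gamma> [simp]: "y \<in> carrier S' \<Longrightarrow> \<beta> (\<gamma> y) = y"
begin

lemma swap: "mutually_inverse_homs S' S \<gamma> \<beta>"
  by unfold_locales (auto simp: \<beta>_hom \<gamma>_hom)

sublocale \<beta>: group_hom S S' \<beta> by unfold_locales (rule \<beta>_hom)

lemma \<gamma>_closed: "y \<in> carrier S' \<Longrightarrow> \<gamma> y \<in> carrier S"
  using \<gamma>_hom by (auto simp: hom_def)

lemma \<gamma>_image [simp]: "P \<subseteq> carrier S \<Longrightarrow> \<gamma> ` (\<beta> ` P) = P"
  by (auto simp: image_iff subset_iff)

lemma \<beta>_image [simp]: "P \<subseteq> carrier S' \<Longrightarrow> \<beta> ` (\<gamma> ` P) = P"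
  by (auto simp: image_iff subset_iff)

lemma \<beta>_inj: "\<lbrakk>x \<in> carrier S; y \<in> carrier S; \<beta> x = \<beta> y\<rbrakk> \<Longrightarrow> x = y"
  by (metis \<gamma>\<beta>)

lemma \<beta>_subgroup: "subgroup P S \<Longrightarrow> subgroup (\<beta> ` P) S'"
  by (rule \<beta>.subgroup_img_is_subgroup)

lemma \<gamma>_subgroup: "subgroup P S' \<Longrightarrow> subgroup (\<gamma> ` P) S"
  by (rule mutually_inverse_homs.\<beta>_subgroup[OF swap])

lemma mem_image_iff: "\<lbrakk>P \<subseteq> carrier S; x \<in> carrier S\<rbrakk> \<Longrightarrow> \<beta> x \<in> \<beta> ` P \<longleftrightarrow> x \<in> P"
  using \<beta>_inj by (auto simp: image_iff subset_iff)

lemma conj_along_apply: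
  "\<lbrakk>P \<subseteq> carrier S; x \<in> P\<rbrakk> \<Longrightarrow> conj_along \<beta> \<gamma> P \<phi> (\<beta> x) = \<beta> (\<phi> x)"
  by (auto simp: conj_along_def subset_iff)

lemma conj_along_eqI:
  assumes "P \<subseteq> carrier S" "\<theta> \<in> extensional (\<beta> ` P)" "\<And>x. x \<in> P \<Longrightarrow> \<theta> (\<beta> x) = \<beta> (\<phi> x)"
  shows "conj_along \<beta> \<gamma> P \<phi> = \<theta>"
  using assms conj_along_apply[of P _ \<phi>]
  by (intro extensionalityI[of _ "\<beta> ` P"]) (auto simp: conj_along_def)

lemma conj_along_inverse:
  assumes "P \<subseteq> carrier S" "\<phi> \<in> extensional P" "\<phi> ` P \<subseteq> carrier S"
  shows "conj_along \<gamma> \<beta> (\<beta> ` P) (conj_along \<beta> \<gamma> P \<phi>) = \<phi>"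
proof (rule mutually_inverse_homs.conj_along_eqI[OF swap])
  show "\<beta> ` P \<subseteq> carrier S'" using assms by auto
  show "\<phi> \<in> extensional (\<gamma> ` \<beta> ` P)" using assms by simp
  show "\<phi> (\<gamma> y) = \<gamma> (conj_along \<beta> \<gamma> P \<phi> y)" if "y \<in> \<beta> ` P" for y
    using that assms by (auto simp: conj_along_def subset_iff image_subset_iff)
qed

lemma conj_along_in_transported:
  "\<lbrakk>P \<subseteq> carrier S; Q \<subseteq> carrier S; \<phi> \<in> \<F> P Q\<rbrakk>
    \<Longrightarrow> conj_along \<beta> \<gamma> P \<phi> \<in> transported_fusion \<beta> \<gamma> \<F> (\<beta> ` P) (\<beta> ` Q)"
  by (auto simp: transported_fusion_def)

lemma transportedE:
  assumes "\<theta> \<in> transported_fusion \<beta> \<gamma> \<F> P' Q'" "subgroup P' S'" "subgroup Q' S'"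
  obtains P Q \<phi> where "subgroup P S" "subgroup Q S" "P' = \<beta> ` P" "Q' = \<beta> ` Q" "\<phi> \<in> \<F> P Q"
    "\<theta> = conj_along \<beta> \<gamma> P \<phi>"
proof -
  obtain \<phi> where "\<phi> \<in> \<F> (\<gamma> ` P') (\<gamma> ` Q')" "\<theta> = conj_along \<beta> \<gamma> (\<gamma> ` P') \<phi>"
    using assms(1) by (auto simp: transported_fusion_def)
  then show ?thesis
    using that[of "\<gamma> ` P'" "\<gamma> ` Q'" \<phi>] assms(2,3) \<gamma>_subgroup by (simp add: subgroup.subset)
qed

lemma transported_fusion_system:
  assumes "fusion_system p S \<F>"
  shows "fusion_system p S' (transported_fusion \<beta> \<gamma> \<F>)"
proof -
  interpret F: fusion_system p S \<F> by (rule assms)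
  have sub: "P \<subseteq> carrier S" if "subgroup P S" for P using that by (rule subgroup.subset)
  have im: "conj_along \<beta> \<gamma> P \<phi> ` \<beta> ` P = \<beta> ` \<phi> ` P" if "subgroup P S" for P \<phi>
    using conj_along_apply[OF sub[OF that]] by (force simp: image_iff)
  show ?thesis
  proof
    show "Factorial_Ring.prime p" by (rule F.prime_p)
    have "bij_betw \<beta> (carrier S) (carrier S')"
      by (rule bij_betwI[where g = \<gamma>]) (auto simp: \<gamma>_closed)
    then have "order S' = order S" by (simp add: order_def bij_betw_same_card)
    then show "finite_p_group p S'"
      using F.p_group S'.is_group by (simp add: finite_p_group_def)
  next
    fix P' Q' \<theta> assume sg: "subgroup P' S'" "subgroup Q' S'"
      and \<theta>: "\<theta> \<in> transported_fusion \<beta> \<gamma> \<F> P' Q'"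
    obtain P Q \<phi> where P: "subgroup P S" and Q: "subgroup Q S" and e: "P' = \<beta> ` P" "Q' = \<beta> ` Q"
      and \<phi>: "\<phi> \<in> \<F> P Q" and \<theta>e: "\<theta> = conj_along \<beta> \<gamma> P \<phi>"
      using transportedE[OF \<theta> sg] .
    have val: "\<theta> (\<beta> x) = \<beta> (\<phi> x)" if "x \<in> P" for x
      using conj_along_apply[OF sub[OF P] that] \<theta>e by simp
    have \<phi>Q: "\<phi> x \<in> Q" if "x \<in> P" for x using F.hom_in[OF P Q \<phi> that] .
    have Pc: "x \<in> carrier S" if "x \<in> P" for x using that sub[OF P] by blast
    have Qc: "x \<in> carrier S" if "x \<in> Q" for x using that sub[OF Q] by blast
    have "\<theta> \<in> hom (S'\<lparr>carrier := P'\<rparr>) (S'\<lparr>carrier := Q'\<rparr>)"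
    proof (rule homI; clarsimp simp: e)
      fix x assume x: "x \<in> P"
      then show "\<theta> (\<beta> x) \<in> \<beta> ` Q" using val \<phi>Q by auto
      fix y assume y: "y \<in> P"
      have "\<theta> (\<beta> (x \<otimes>\<^bsub>S\<^esub> y)) = \<beta> (\<phi> x) \<otimes>\<^bsub>S'\<^esub> \<beta> (\<phi> y)"
        using val[OF subgroup.m_closed[OF P x y]] F.hom_mult[OF P Q \<phi> x y] \<phi>Q x y Qc by simp
      then show "\<theta> (\<beta> x \<otimes>\<^bsub>S'\<^esub> \<beta> y) = \<theta> (\<beta> x) \<otimes>\<^bsub>S'\<^esub> \<theta> (\<beta> y)"
        using val x y Pc by simp
    qed
    moreover have "inj_on \<theta> P'"
    proof (rule inj_onI; clarsimp simp: e)
      fix x y assume x: "x \<in> P" and y: "y \<in> P" and "\<theta> (\<beta> x) = \<theta> (\<beta> y)"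
      then have "\<phi> x = \<phi> y" using val \<phi>Q Qc \<beta>_inj by simp
      then show "\<beta> x = \<beta> y" using F.hom_inj[OF P Q \<phi>] x y by (auto dest: inj_onD)
    qed
    moreover have "\<theta> \<in> extensional P'" using \<theta>e e by (simp add: conj_along_def)
    ultimately show "\<theta> \<in> hom (S'\<lparr>carrier := P'\<rparr>) (S'\<lparr>carrier := Q'\<rparr>) \<and> inj_on \<theta> P' \<and> \<theta> \<in> extensional P'"
      by blast
    have i: "\<theta> ` P' = \<beta> ` \<phi> ` P" using im[OF P] \<theta>e e by simp
    show "\<theta> \<in> transported_fusion \<beta> \<gamma> \<F> P' (\<theta> ` P')"
      unfolding i unfolding e \<theta>e
      using conj_along_in_transported[OF sub[OF P] sub[OF F.image_subgroup[OF P Q \<phi>]]]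
        F.onto_image_in[OF P Q \<phi>] by blast
    have "restrict (inv_into P \<phi>) (\<phi> ` P) \<in> \<F> (\<phi> ` P) P" by (rule F.inverse_in[OF P Q \<phi>])
    then have "conj_along \<beta> \<gamma> (\<phi> ` P) (restrict (inv_into P \<phi>) (\<phi> ` P))
        \<in> transported_fusion \<beta> \<gamma> \<F> (\<beta> ` \<phi> ` P) (\<beta> ` P)"
      using conj_along_in_transported sub[OF P] sub[OF F.image_subgroup[OF P Q \<phi>]] by blast
    moreover have "conj_along \<beta> \<gamma> (\<phi> ` P) (restrict (inv_into P \<phi>) (\<phi> ` P)) =
        restrict (inv_into P' \<theta>) (\<beta> ` \<phi> ` P)"
    proof (rule conj_along_eqI)
      show "\<phi> ` P \<subseteq> carrier S" by (rule sub[OF F.image_subgroup[OF P Q \<phi>]])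
      fix z assume "z \<in> \<phi> ` P"
      then obtain x where x: "x \<in> P" "z = \<phi> x" by blast
      have "inv_into P' \<theta> (\<beta> z) = \<beta> x"
        using inv_into_f_f[OF \<open>inj_on \<theta> P'\<close>, of "\<beta> x"] x val e by simp
      moreover have "inv_into P \<phi> z = x" using inv_into_f_f[OF F.hom_inj[OF P Q \<phi>]] x by simp
      ultimately show "restrict (inv_into P' \<theta>) (\<beta> ` \<phi> ` P) (\<beta> z) =
          \<beta> (restrict (inv_into P \<phi>) (\<phi> ` P) z)"
        using x by simp
    qed simp
    ultimately show "restrict (inv_into P' \<theta>) (\<theta> ` P') \<in> transported_fusion \<beta> \<gamma> \<F> (\<theta> ` P') P'"
      unfolding i by (simp add: e)
  next
    fix P' Q' s' assume P': "subgroup P' S'" and Q': "subgroup Q' S'" and s': "s' \<in> transporter S' P' Q'"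
    define P Q s where "P = \<gamma> ` P'" and "Q = \<gamma> ` Q'" and "s = \<gamma> s'"
    have P: "subgroup P S" and Q: "subgroup Q S" using \<gamma>_subgroup P' Q' by (simp_all add: P_def Q_def)
    have e: "P' = \<beta> ` P" "Q' = \<beta> ` Q" "s' = \<beta> s" and s: "s \<in> carrier S"
      using P' Q' s' \<gamma>_closed by (simp_all add: P_def Q_def s_def subgroup.subset transporter_def)
    have bc: "\<beta> (s \<otimes>\<^bsub>S\<^esub> x \<otimes>\<^bsub>S\<^esub> inv\<^bsub>S\<^esub> s) = s' \<otimes>\<^bsub>S'\<^esub> \<beta> x \<otimes>\<^bsub>S'\<^esub> inv\<^bsub>S'\<^esub> s'" if "x \<in> P" for x
      using that s subgroup.mem_carrier[OF P that] e(3) by simp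
    have "s \<otimes>\<^bsub>S\<^esub> x \<otimes>\<^bsub>S\<^esub> inv\<^bsub>S\<^esub> s \<in> Q" if x: "x \<in> P" for x
    proof -
      have "\<beta> (s \<otimes>\<^bsub>S\<^esub> x \<otimes>\<^bsub>S\<^esub> inv\<^bsub>S\<^esub> s) \<in> \<beta> ` Q" using bc[OF x] s' x e by (simp add: transporter_iff)
      then show ?thesis
        using mem_image_iff[OF sub[OF Q], of "s \<otimes>\<^bsub>S\<^esub> x \<otimes>\<^bsub>S\<^esub> inv\<^bsub>S\<^esub> s"] s subgroup.mem_carrier[OF P x]
        by (simp del: \<beta>.hom_mult)
    qed
    then have "s \<in> transporter S P Q" using s by (simp add: transporter_iff)
    then have "conj_along \<beta> \<gamma> P (conj_map S P s) \<in> transported_fusion \<beta> \<gamma> \<F> P' Q'"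
      using F.conj_map_in[OF P Q] conj_along_in_transported[OF sub[OF P] sub[OF Q]] e by blast
    moreover have "conj_along \<beta> \<gamma> P (conj_map S P s) = conj_map S' P' s'"
      using bc e by (intro conj_along_eqI[OF sub[OF P]]) (auto simp: conj_map_def)
    ultimately show "conj_map S' P' s' \<in> transported_fusion \<beta> \<gamma> \<F> P' Q'" by simp
  next
    fix P' Q' R' \<theta> \<zeta> assume P': "subgroup P' S'" and Q': "subgroup Q' S'" and R': "subgroup R' S'"
      and \<theta>: "\<theta> \<in> transported_fusion \<beta> \<gamma> \<F> P' Q'" and \<zeta>: "\<zeta> \<in> transported_fusion \<beta> \<gamma> \<F> Q' R'"
    define P Q R where "P = \<gamma> ` P'" and "Q = \<gamma> ` Q'" and "R = \<gamma> ` R'"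
    have P: "subgroup P S" and Q: "subgroup Q S" and R: "subgroup R S"
      using \<gamma>_subgroup P' Q' R' by (simp_all add: P_def Q_def R_def)
    have e: "P' = \<beta> ` P" "Q' = \<beta> ` Q" "R' = \<beta> ` R"
      using P' Q' R' by (simp_all add: P_def Q_def R_def subgroup.subset)
    obtain \<phi> where \<phi>: "\<phi> \<in> \<F> P Q" "\<theta> = conj_along \<beta> \<gamma> P \<phi>"
      using \<theta> by (auto simp: transported_fusion_def P_def Q_def)
    obtain \<psi> where \<psi>: "\<psi> \<in> \<F> Q R" "\<zeta> = conj_along \<beta> \<gamma> Q \<psi>"
      using \<zeta> by (auto simp: transported_fusion_def R_def Q_def)
    have "conj_along \<beta> \<gamma> P (compose P \<psi> \<phi>) \<in> transported_fusion \<beta> \<gamma> \<F> P' R'"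
      using F.compose_in[OF P Q R \<phi>(1) \<psi>(1)] conj_along_in_transported[OF sub[OF P] sub[OF R]] e
      by blast
    moreover have "conj_along \<beta> \<gamma> P (compose P \<psi> \<phi>) = compose P' \<zeta> \<theta>"
      using F.hom_in[OF P Q \<phi>(1)] \<phi>(2) \<psi>(2) e conj_along_apply[OF sub[OF P]] conj_along_apply[OF sub[OF Q]]
      by (intro conj_along_eqI[OF sub[OF P]]) (auto simp: compose_def)
    ultimately show "compose P' \<zeta> \<theta> \<in> transported_fusion \<beta> \<gamma> \<F> P' R'" by simp
  qed
qed

end

subsection \<open>The isomorphism of fusion systems induced by conjugation\<close>

lemma (in fusion_system) category_fusion_cat: "category (fusion_cat S \<F>)"
proof
  fix P Q \<phi>
  assume "P \<in> Obj (fusion_cat S \<F>)" "Q \<in> Obj (fusion_cat S \<F>)" "\<phi> \<in> Hom (fusion_cat S \<F>) P Q"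
  then have P: "subgroup P S" and Q: "subgroup Q S" and \<phi>: "\<phi> \<in> \<F> P Q"
    by (auto simp: fusion_cat_def)
  show "Comp (fusion_cat S \<F>) P P Q \<phi> (Id (fusion_cat S \<F>) P) = \<phi>"
    "Comp (fusion_cat S \<F>) P Q Q (Id (fusion_cat S \<F>) Q) \<phi> = \<phi>"
    using extensional_arb[OF hom_ext[OF P Q \<phi>]] hom_in[OF P Q \<phi>]
    by (auto simp: fusion_cat_def compose_def fun_eq_iff)
next
  fix P Q R W \<phi> \<psi> \<theta>
  assume "P \<in> Obj (fusion_cat S \<F>)" "Q \<in> Obj (fusion_cat S \<F>)" "\<phi> \<in> Hom (fusion_cat S \<F>) P Q"
  then have "\<phi> x \<in> Q" if "x \<in> P" for x
    using that hom_in by (auto simp: fusion_cat_def)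
  then show "Comp (fusion_cat S \<F>) P R W \<theta> (Comp (fusion_cat S \<F>) P Q R \<psi> \<phi>) =
      Comp (fusion_cat S \<F>) P Q W (Comp (fusion_cat S \<F>) Q R W \<theta> \<psi>) \<phi>"
    by (auto simp: fusion_cat_def compose_def intro!: restrict_ext)
qed (use inclusion_in compose_in in \<open>auto simp: fusion_cat_def\<close>)

definition conj_func ::
    "('a \<Rightarrow> 'b) \<Rightarrow> ('b \<Rightarrow> 'a) \<Rightarrow> 'a monoid \<Rightarrow> 'a fusion \<Rightarrow> ('a set, 'a \<Rightarrow> 'a, 'b set, 'b \<Rightarrow> 'b) func" where
  "conj_func \<beta> \<gamma> S \<F> = restrict_func (fusion_cat S \<F>)
     \<lparr>fobj = (\<lambda>P. \<beta> ` P), fmor = (\<lambda>P Q \<phi>. conj_along \<beta> \<gamma> P \<phi>)\<rparr>"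

lemma normalized_conj_func [simp]:
  "restrict_func (fusion_cat S \<F>) (conj_func \<beta> \<gamma> S \<F>) = conj_func \<beta> \<gamma> S \<F>"
  by (simp add: conj_func_def)

lemma fobj_conj_func [simp]: "subgroup P S \<Longrightarrow> fobj (conj_func \<beta> \<gamma> S \<F>) P = \<beta> ` P"
  by (simp add: conj_func_def fusion_cat_def)

lemma fmor_conj_func [simp]:
  "\<lbrakk>subgroup P S; subgroup Q S; \<phi> \<in> \<F> P Q\<rbrakk>
    \<Longrightarrow> fmor (conj_func \<beta> \<gamma> S \<F>) P Q \<phi> = conj_along \<beta> \<gamma> P \<phi>"
  by (simp add: conj_func_def fusion_cat_def)

context mutually_inverse_homs
begin

lemma conj_func_morphism:
  assumes F: "fusion_system p S \<F>" and F': "fusion_system q S' \<F>'"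
    and ext: "\<beta> \<in> extensional (carrier S)"
    and closed: "\<And>P Q \<phi>. \<lbrakk>subgroup P S; subgroup Q S; \<phi> \<in> \<F> P Q\<rbrakk>
      \<Longrightarrow> conj_along \<beta> \<gamma> P \<phi> \<in> \<F>' (\<beta> ` P) (\<beta> ` Q)"
  shows "fusion_morphism S \<F> S' \<F>' \<beta> (conj_func \<beta> \<gamma> S \<F>)"
proof -
  interpret F: fusion_system p S \<F> by (rule F)
  interpret F': fusion_system q S' \<F>' by (rule F')
  have sub: "P \<subseteq> carrier S" if "subgroup P S" for P using that by (rule subgroup.subset)
  have "cat_functor (fusion_cat S \<F>) (fusion_cat S' \<F>') (conj_func \<beta> \<gamma> S \<F>)"
  proof (intro cat_functor.intro cat_functor_axioms.intro)
    show "category (fusion_cat S \<F>)" by (rule F.category_fusion_cat)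
    show "category (fusion_cat S' \<F>')" by (rule F'.category_fusion_cat)
    fix P assume "P \<in> Obj (fusion_cat S \<F>)"
    then have P: "subgroup P S" by (simp add: fusion_cat_def)
    then show "fobj (conj_func \<beta> \<gamma> S \<F>) P \<in> Obj (fusion_cat S' \<F>')"
      using \<beta>_subgroup by (simp add: fusion_cat_def)
    have "conj_along \<beta> \<gamma> P (\<lambda>x\<in>P. x) = (\<lambda>y\<in>\<beta> ` P. y)"
      by (rule conj_along_eqI[OF sub[OF P]]) auto
    then show "fmor (conj_func \<beta> \<gamma> S \<F>) P P (Id (fusion_cat S \<F>) P) =
        Id (fusion_cat S' \<F>') (fobj (conj_func \<beta> \<gamma> S \<F>) P)"
      using P F.inclusion_in[OF P P] by (simp add: fusion_cat_def)
    fix Q \<phi> assume "Q \<in> Obj (fusion_cat S \<F>)" "\<phi> \<in> Hom (fusion_cat S \<F>) P Q"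
    then have Q: "subgroup Q S" and \<phi>: "\<phi> \<in> \<F> P Q" by (simp_all add: fusion_cat_def)
    then show "fmor (conj_func \<beta> \<gamma> S \<F>) P Q \<phi> \<in>
        Hom (fusion_cat S' \<F>') (fobj (conj_func \<beta> \<gamma> S \<F>) P) (fobj (conj_func \<beta> \<gamma> S \<F>) Q)"
      using P closed by (simp add: fusion_cat_def)
    fix R \<psi> assume "R \<in> Obj (fusion_cat S \<F>)" "\<psi> \<in> Hom (fusion_cat S \<F>) Q R"
    then have R: "subgroup R S" and \<psi>: "\<psi> \<in> \<F> Q R" by (simp_all add: fusion_cat_def)
    have "conj_along \<beta> \<gamma> P (compose P \<psi> \<phi>) =
        compose (\<beta> ` P) (conj_along \<beta> \<gamma> Q \<psi>) (conj_along \<beta> \<gamma> P \<phi>)"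
      using F.hom_in[OF P Q \<phi>] conj_along_apply[OF sub[OF P]] conj_along_apply[OF sub[OF Q]]
      by (intro conj_along_eqI[OF sub[OF P]]) (auto simp: compose_def)
    then show "fmor (conj_func \<beta> \<gamma> S \<F>) P R (Comp (fusion_cat S \<F>) P Q R \<psi> \<phi>) =
        Comp (fusion_cat S' \<F>') (fobj (conj_func \<beta> \<gamma> S \<F>) P) (fobj (conj_func \<beta> \<gamma> S \<F>) Q)
          (fobj (conj_func \<beta> \<gamma> S \<F>) R)
          (fmor (conj_func \<beta> \<gamma> S \<F>) Q R \<psi>) (fmor (conj_func \<beta> \<gamma> S \<F>) P Q \<phi>)"
      using P Q R \<phi> \<psi> F.compose_in[OF P Q R \<phi> \<psi>] by (simp add: fusion_cat_def)
  qed simp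
  then show ?thesis
    using \<beta>_hom ext conj_along_apply[OF sub] by (simp add: fusion_morphism_def)
qed

lemma conj_func_inverse:
  assumes F: "fusion_system p S \<F>"
    and closed: "\<And>P Q \<phi>. \<lbrakk>subgroup P S; subgroup Q S; \<phi> \<in> \<F> P Q\<rbrakk>
      \<Longrightarrow> conj_along \<beta> \<gamma> P \<phi> \<in> \<F>' (\<beta> ` P) (\<beta> ` Q)"
  shows "comp_func (fusion_cat S \<F>) (conj_func \<gamma> \<beta> S' \<F>') (conj_func \<beta> \<gamma> S \<F>) = id_func (fusion_cat S \<F>)"
proof (rule functor_eqI[of "fusion_cat S \<F>"])
  interpret F: fusion_system p S \<F> by (rule F)
  have sub: "P \<subseteq> carrier S" if "subgroup P S" for P using that by (rule subgroup.subset)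
  fix P assume "P \<in> Obj (fusion_cat S \<F>)"
  then have P: "subgroup P S" by (simp add: fusion_cat_def)
  have "fobj (comp_func (fusion_cat S \<F>) (conj_func \<gamma> \<beta> S' \<F>') (conj_func \<beta> \<gamma> S \<F>)) P = P"
    using P \<beta>_subgroup[OF P] sub[OF P] \<open>P \<in> Obj (fusion_cat S \<F>)\<close> by simp
  then show "fobj (comp_func (fusion_cat S \<F>) (conj_func \<gamma> \<beta> S' \<F>') (conj_func \<beta> \<gamma> S \<F>)) P =
      fobj (id_func (fusion_cat S \<F>)) P"
    using \<open>P \<in> Obj (fusion_cat S \<F>)\<close> by simp
  fix Q \<phi> assume Qo: "Q \<in> Obj (fusion_cat S \<F>)" and \<phi>h: "\<phi> \<in> Hom (fusion_cat S \<F>) P Q"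
  then have Q: "subgroup Q S" and \<phi>: "\<phi> \<in> \<F> P Q" by (simp_all add: fusion_cat_def)
  have "conj_along \<gamma> \<beta> (\<beta> ` P) (conj_along \<beta> \<gamma> P \<phi>) = \<phi>"
    using sub[OF Q] F.hom_in[OF P Q \<phi>]
    by (intro conj_along_inverse[OF sub[OF P] F.hom_ext[OF P Q \<phi>]]) auto
  then show "fmor (comp_func (fusion_cat S \<F>) (conj_func \<gamma> \<beta> S' \<F>') (conj_func \<beta> \<gamma> S \<F>)) P Q \<phi> =
      fmor (id_func (fusion_cat S \<F>)) P Q \<phi>"
    using P Q \<phi> \<beta>_subgroup[OF P] \<beta>_subgroup[OF Q] closed[OF P Q \<phi>] Qo \<phi>h \<open>P \<in> Obj (fusion_cat S \<F>)\<close>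
    by simp
qed simp_all

end

lemma (in mutually_inverse_homs) conj_func_isomorphism:
  assumes F: "fusion_system p S \<F>" and F': "fusion_system q S' \<F>'"
    and ext: "\<beta> \<in> extensional (carrier S)" "\<gamma> \<in> extensional (carrier S')"
    and closed: "\<And>P Q \<phi>. \<lbrakk>subgroup P S; subgroup Q S; \<phi> \<in> \<F> P Q\<rbrakk>
      \<Longrightarrow> conj_along \<beta> \<gamma> P \<phi> \<in> \<F>' (\<beta> ` P) (\<beta> ` Q)"
    and closed': "\<And>P Q \<phi>. \<lbrakk>subgroup P S'; subgroup Q S'; \<phi> \<in> \<F>' P Q\<rbrakk>
      \<Longrightarrow> conj_along \<gamma> \<beta> P \<phi> \<in> \<F> (\<gamma> ` P) (\<gamma> ` Q)"
  shows "fusion_isomorphism S \<F> S' \<F>' \<beta> (conj_func \<beta> \<gamma> S \<F>)"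
proof -
  interpret I: mutually_inverse_homs S' S \<gamma> \<beta> by (rule swap)
  have "fusion_morphism S \<F> S' \<F>' \<beta> (conj_func \<beta> \<gamma> S \<F>)"
    by (rule conj_func_morphism[OF F F' ext(1) closed])
  moreover have "fusion_morphism S' \<F>' S \<F> \<gamma> (conj_func \<gamma> \<beta> S' \<F>')"
    by (rule I.conj_func_morphism[OF F' F ext(2) closed'])
  moreover have "compose (carrier S) \<gamma> \<beta> = (\<lambda>x\<in>carrier S. x)"
    "compose (carrier S') \<beta> \<gamma> = (\<lambda>x\<in>carrier S'. x)"
    by (auto simp: compose_def)
  moreover have "comp_func (fusion_cat S \<F>) (conj_func \<gamma> \<beta> S' \<F>') (conj_func \<beta> \<gamma> S \<F>) = id_func (fusion_cat S \<F>)"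
    by (rule conj_func_inverse[OF F]) (rule closed)
  moreover have "comp_func (fusion_cat S' \<F>') (conj_func \<beta> \<gamma> S \<F>) (conj_func \<gamma> \<beta> S' \<F>') = id_func (fusion_cat S' \<F>')"
    by (rule I.conj_func_inverse[OF F']) (rule closed')
  ultimately show ?thesis unfolding fusion_isomorphism_def by blast
qed

section \<open>The isomorphisms induced by an isomorphism of transporter systems\<close>

text \<open>The parameters \<open>E\<close> and \<open>E'\<close> are the families of kernels of \<open>\<pi>\<close> and \<open>\<pi>'\<close>, which the two transporter
  systems determine.\<close>

locale transporter_system_isomorphism =
  source: transporter_system p S \<F> T \<Delta> \<delta> \<pi> E +
  target: transporter_system p S' \<F>' T' \<Delta>' \<delta>' \<pi>' E'
  for p :: nat
    and S :: "'a monoid" and \<F> :: "'a fusion" and T :: "('a set, 'm) cat" and \<Delta> :: "'a set set"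
    and \<delta> :: "('a set, 'a, 'a set, 'm) func" and \<pi> :: "('a set, 'm, 'a set, 'a \<Rightarrow> 'a) func"
    and S' :: "'b monoid" and \<F>' :: "'b fusion" and T' :: "('b set, 'n) cat" and \<Delta>' :: "'b set set"
    and \<delta>' :: "('b set, 'b, 'b set, 'n) func" and \<pi>' :: "('b set, 'n, 'b set, 'b \<Rightarrow> 'b) func"
    and E :: "'a set \<Rightarrow> 'm set" and E' :: "'b set \<Rightarrow> 'n set" +
  fixes \<alpha> :: "('a set, 'm, 'b set, 'n) func"
  assumes \<alpha>_isomorphism: "transporter_isomorphism S T \<delta> S' T' \<delta>' \<alpha>"
    and centric_radicals_source: "centric_radicals p S \<F> \<subseteq> \<Delta>"
    and centric_radicals_target: "centric_radicals p S' \<F>' \<subseteq> \<Delta>'"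
begin

abbreviation (input) "\<alpha>\<^sub>o \<equiv> fobj \<alpha>"

lemma \<alpha>_equivalence: "cat_equivalence T T' \<alpha>"
  using \<alpha>_isomorphism by (simp add: transporter_isomorphism_def)

sublocale \<alpha>: cat_functor T T' \<alpha>
  using \<alpha>_equivalence by (simp add: cat_equivalence_def)

lemma \<alpha>_obj: "P \<in> \<Delta> \<Longrightarrow> \<alpha>\<^sub>o P \<in> \<Delta>'"
  using \<alpha>.fobj_in_Obj by (simp add: source.Obj_T target.Obj_T)

lemma \<alpha>_Hom: "\<lbrakk>P \<in> \<Delta>; Q \<in> \<Delta>; \<phi> \<in> Hom T P Q\<rbrakk> \<Longrightarrow> fmor \<alpha> P Q \<phi> \<in> Hom T' (\<alpha>\<^sub>o P) (\<alpha>\<^sub>o Q)"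
  using \<alpha>.fmor_in_Hom by (simp add: source.Obj_T)

lemma \<alpha>_Comp:
  "\<lbrakk>P \<in> \<Delta>; Q \<in> \<Delta>; R \<in> \<Delta>; \<phi> \<in> Hom T P Q; \<psi> \<in> Hom T Q R\<rbrakk> \<Longrightarrow>
    fmor \<alpha> P R (Comp T P Q R \<psi> \<phi>) = Comp T' (\<alpha>\<^sub>o P) (\<alpha>\<^sub>o Q) (\<alpha>\<^sub>o R) (fmor \<alpha> Q R \<psi>) (fmor \<alpha> P Q \<phi>)"
  using \<alpha>.fmor_Comp by (simp add: source.Obj_T)

lemma \<alpha>_isotypical:
  "P \<in> \<Delta> \<Longrightarrow> fmor \<alpha> P P ` fmor \<delta> P P ` P = fmor \<delta>' (\<alpha>\<^sub>o P) (\<alpha>\<^sub>o P) ` \<alpha>\<^sub>o P"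
  using \<alpha>_isomorphism by (simp add: transporter_isomorphism_def source.Obj_T)

lemma \<alpha>_inclusion:
  assumes "P \<in> \<Delta>" "Q \<in> \<Delta>" "P \<subseteq> Q"
  shows "\<alpha>\<^sub>o P \<subseteq> \<alpha>\<^sub>o Q"
    and "fmor \<alpha> P Q (fmor \<delta> P Q \<one>\<^bsub>S\<^esub>) = fmor \<delta>' (\<alpha>\<^sub>o P) (\<alpha>\<^sub>o Q) \<one>\<^bsub>S'\<^esub>"
  using \<alpha>_isomorphism assms by (auto simp: transporter_isomorphism_def source.Obj_T)

lemma \<alpha>_faithful:
  "\<lbrakk>P \<in> \<Delta>; Q \<in> \<Delta>; \<phi> \<in> Hom T P Q; \<psi> \<in> Hom T P Q; fmor \<alpha> P Q \<phi> = fmor \<alpha> P Q \<psi>\<rbrakk> \<Longrightarrow> \<phi> = \<psi>"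
  using equivalence_faithful[OF \<alpha>_equivalence, of P Q \<phi> \<psi>] by (simp add: source.Obj_T)

lemma \<alpha>_full:
  "\<lbrakk>P \<in> \<Delta>; Q \<in> \<Delta>; \<theta> \<in> Hom T' (\<alpha>\<^sub>o P) (\<alpha>\<^sub>o Q)\<rbrakk> \<Longrightarrow> \<exists>\<phi>\<in>Hom T P Q. fmor \<alpha> P Q \<phi> = \<theta>"
  using equivalence_full[OF \<alpha>_equivalence, of P Q \<theta>] by (simp add: source.Obj_T)

lemma \<alpha>_essentially_surjective:
  assumes "P' \<in> \<Delta>'" shows "\<exists>P\<in>\<Delta>. F_conjugate S' \<F>' (\<alpha>\<^sub>o P) P'"
proof -
  obtain P where P: "P \<in> \<Delta>" "Iso T' (\<alpha>\<^sub>o P) P' \<noteq> {}"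
    using equivalence_essentially_surjective[OF \<alpha>_equivalence, of P'] assms
    by (auto simp: source.Obj_T target.Obj_T)
  then show ?thesis using target.isomorphic_imp_F_conjugate[OF \<alpha>_obj[OF P(1)] assms] by blast
qed

lemma \<alpha>_delta_inj:
  assumes "P \<in> \<Delta>" "Q \<in> \<Delta>"
  shows "inj_on (\<lambda>g. fmor \<alpha> P Q (fmor \<delta> P Q g)) (transporter S P Q)"
proof (rule inj_onI)
  fix g h assume g: "g \<in> transporter S P Q" and h: "h \<in> transporter S P Q"
    and "fmor \<alpha> P Q (fmor \<delta> P Q g) = fmor \<alpha> P Q (fmor \<delta> P Q h)"
  then have "fmor \<delta> P Q g = fmor \<delta> P Q h"
    using \<alpha>_faithful[OF assms source.delta_in_Hom[OF assms g] source.delta_in_Hom[OF assms h]] by blast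
  then show "g = h" using inj_onD[OF source.B_injective[OF assms]] g h by blast
qed

lemma subset_transporter: "P \<in> \<Delta> \<Longrightarrow> P \<subseteq> transporter S P P"
  using source.S.subgroup_subset_transporter source.A1_subgroups by blast

lemma subset_transporter': "P \<in> \<Delta>' \<Longrightarrow> P \<subseteq> transporter S' P P"
  using target.S.subgroup_subset_transporter target.A1_subgroups by blast

lemma card_\<alpha>: assumes P: "P \<in> \<Delta>" shows "card (\<alpha>\<^sub>o P) = card P"
proof -
  have "card (fmor \<alpha> P P ` fmor \<delta> P P ` P) = card P"
    unfolding image_image using inj_on_subset[OF \<alpha>_delta_inj[OF P P] subset_transporter[OF P]]
    by (rule card_image)
  moreover have "card (fmor \<delta>' (\<alpha>\<^sub>o P) (\<alpha>\<^sub>o P) ` \<alpha>\<^sub>o P) = card (\<alpha>\<^sub>o P)"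
    using inj_on_subset[OF target.B_injective subset_transporter'] \<alpha>_obj[OF P] by (simp add: card_image)
  ultimately show ?thesis using \<alpha>_isotypical[OF P] by simp
qed

text \<open>Some \<open>\<alpha>(P)\<close> is isomorphic to \<open>S'\<close> and therefore equal to it, by finiteness; inclusions are preserved,
  so \<open>\<alpha>(S)\<close> contains \<open>\<alpha>(P)\<close>.\<close>

lemma \<alpha>_carrier: "\<alpha>\<^sub>o (carrier S) = carrier S'"
proof -
  obtain P where P: "P \<in> \<Delta>" "F_conjugate S' \<F>' (\<alpha>\<^sub>o P) (carrier S')"
    using \<alpha>_essentially_surjective[OF target.carrier_in_Delta] by blast
  have sub: "\<alpha>\<^sub>o P \<subseteq> carrier S'" using target.A1_subgroups[OF \<alpha>_obj[OF P(1)]] subgroup.subset by blast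
  then have "\<alpha>\<^sub>o P = carrier S'"
    using target.F_conjugate_card[OF P(2)] card_subset_eq[OF target.finite_S] by blast
  moreover have "P \<subseteq> carrier S" using source.A1_subgroups[OF P(1)] subgroup.subset by blast
  ultimately have "carrier S' \<subseteq> \<alpha>\<^sub>o (carrier S)"
    using \<alpha>_inclusion(1)[OF P(1) source.carrier_in_Delta] by blast
  then show ?thesis
    using target.A1_subgroups[OF \<alpha>_obj[OF source.carrier_in_Delta]] subgroup.subset by blast
qed

text \<open>On \<open>S\<close> this is \<open>(\<delta>'\<^sub>S)\<^sup>-\<^sup>1 \<circ> \<alpha>\<^sub>S \<circ> \<delta>\<^sub>S\<close>, which exists by isotypicality.\<close>

definition \<beta> :: "'a \<Rightarrow> 'b" where
  "\<beta> = (\<lambda>g\<in>carrier S. inv_into (carrier S') (fmor \<delta>' (carrier S') (carrier S'))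
     (fmor \<alpha> (carrier S) (carrier S) (fmor \<delta> (carrier S) (carrier S) g)))"

definition \<gamma> :: "'b \<Rightarrow> 'a" where
  "\<gamma> = (\<lambda>h\<in>carrier S'. inv_into (carrier S) \<beta> h)"

lemma \<beta>_closed: "g \<in> carrier S \<Longrightarrow> \<beta> g \<in> carrier S'"
  and \<alpha>_delta_carrier: "g \<in> carrier S \<Longrightarrow>
    fmor \<alpha> (carrier S) (carrier S) (fmor \<delta> (carrier S) (carrier S) g) =
    fmor \<delta>' (carrier S') (carrier S') (\<beta> g)"
proof -
  assume g: "g \<in> carrier S"
  let ?x = "fmor \<alpha> (carrier S) (carrier S) (fmor \<delta> (carrier S) (carrier S) g)"
  have "?x \<in> fmor \<delta>' (carrier S') (carrier S') ` carrier S'"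
    using \<alpha>_isotypical[OF source.carrier_in_Delta] g by (auto simp: \<alpha>_carrier)
  then show "\<beta> g \<in> carrier S'" "?x = fmor \<delta>' (carrier S') (carrier S') (\<beta> g)"
    using g by (simp_all add: \<beta>_def inv_into_into f_inv_into_f)
qed

lemma delta'_carrier_inj:
  "\<lbrakk>g \<in> carrier S'; h \<in> carrier S';
    fmor \<delta>' (carrier S') (carrier S') g = fmor \<delta>' (carrier S') (carrier S') h\<rbrakk> \<Longrightarrow> g = h"
  using target.B_injective[OF target.carrier_in_Delta target.carrier_in_Delta]
  by (simp add: target.S.transporter_carrier inj_on_def)

lemma \<beta>_hom: "\<beta> \<in> hom S S'"
proof (rule homI)
  fix g h assume g: "g \<in> carrier S" and h: "h \<in> carrier S"
  let ?\<delta> = "fmor \<delta> (carrier S) (carrier S)" and ?\<delta>' = "fmor \<delta>' (carrier S') (carrier S')"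
  note S = source.carrier_in_Delta and S' = target.carrier_in_Delta
  have "?\<delta>' (\<beta> (g \<otimes>\<^bsub>S\<^esub> h)) = fmor \<alpha> (carrier S) (carrier S) (?\<delta> (g \<otimes>\<^bsub>S\<^esub> h))"
    using g h by (simp add: \<alpha>_delta_carrier)
  also have "\<dots> = fmor \<alpha> (carrier S) (carrier S)
      (Comp T (carrier S) (carrier S) (carrier S) (?\<delta> g) (?\<delta> h))"
    using source.delta_mult[OF S S S] g h by (simp add: source.S.transporter_carrier)
  also have "\<dots> = Comp T' (carrier S') (carrier S') (carrier S') (?\<delta>' (\<beta> g)) (?\<delta>' (\<beta> h))"
    using \<alpha>_Comp[OF S S S] source.delta_in_Hom[OF S S] g h
    by (simp add: source.S.transporter_carrier \<alpha>_delta_carrier \<alpha>_carrier)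
  also have "\<dots> = ?\<delta>' (\<beta> g \<otimes>\<^bsub>S'\<^esub> \<beta> h)"
    using target.delta_mult[OF S' S' S'] g h by (simp add: target.S.transporter_carrier \<beta>_closed)
  finally show "\<beta> (g \<otimes>\<^bsub>S\<^esub> h) = \<beta> g \<otimes>\<^bsub>S'\<^esub> \<beta> h"
    using delta'_carrier_inj g h by (simp add: \<beta>_closed)
qed (rule \<beta>_closed)

lemma \<beta>_bij: "bij_betw \<beta> (carrier S) (carrier S')"
proof (rule bij_betw_imageI)
  note S = source.carrier_in_Delta
  show "inj_on \<beta> (carrier S)"
  proof (rule inj_onI)
    fix g h assume g: "g \<in> carrier S" and h: "h \<in> carrier S" and "\<beta> g = \<beta> h"
    then have "fmor \<alpha> (carrier S) (carrier S) (fmor \<delta> (carrier S) (carrier S) g) =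
        fmor \<alpha> (carrier S) (carrier S) (fmor \<delta> (carrier S) (carrier S) h)"
      by (simp add: \<alpha>_delta_carrier)
    then show "g = h"
      using \<alpha>_delta_inj[OF S S] g h by (simp add: inj_on_def source.S.transporter_carrier)
  qed
  show "\<beta> ` carrier S = carrier S'"
  proof
    show "carrier S' \<subseteq> \<beta> ` carrier S"
    proof
      fix h assume h: "h \<in> carrier S'"
      then have "fmor \<delta>' (carrier S') (carrier S') h \<in>
          fmor \<alpha> (carrier S) (carrier S) ` fmor \<delta> (carrier S) (carrier S) ` carrier S"
        using \<alpha>_isotypical[OF S] by (simp add: \<alpha>_carrier)
      then obtain g where g: "g \<in> carrier S"
        "fmor \<delta>' (carrier S') (carrier S') h = fmor \<delta>' (carrier S') (carrier S') (\<beta> g)"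
        by (auto simp: \<alpha>_delta_carrier)
      then show "h \<in> \<beta> ` carrier S" using delta'_carrier_inj[OF h \<beta>_closed] by blast
    qed
  qed (auto simp: \<beta>_closed)
qed

sublocale iso: mutually_inverse_homs S S' \<beta> \<gamma>
proof
  have im: "\<beta> ` carrier S = carrier S'" and inj: "inj_on \<beta> (carrier S)"
    using \<beta>_bij by (auto simp: bij_betw_def)
  show \<gamma>\<beta>: "\<gamma> (\<beta> x) = x" if "x \<in> carrier S" for x
    using that inj by (simp add: \<gamma>_def \<beta>_closed)
  show \<beta>\<gamma>: "\<beta> (\<gamma> y) = y" if "y \<in> carrier S'" for y
    using that im by (simp add: \<gamma>_def f_inv_into_f)
  have \<gamma>_closed: "\<gamma> y \<in> carrier S" if "y \<in> carrier S'" for y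
    using that im by (simp add: \<gamma>_def inv_into_into)
  show "\<gamma> \<in> hom S' S"
  proof (rule homI)
    fix x y assume x: "x \<in> carrier S'" and y: "y \<in> carrier S'"
    have "\<beta> (\<gamma> x \<otimes>\<^bsub>S\<^esub> \<gamma> y) = x \<otimes>\<^bsub>S'\<^esub> y"
      using \<beta>_hom \<gamma>_closed x y \<beta>\<gamma> by (simp add: hom_def)
    then show "\<gamma> (x \<otimes>\<^bsub>S'\<^esub> y) = \<gamma> x \<otimes>\<^bsub>S\<^esub> \<gamma> y"
      using \<gamma>\<beta>[of "\<gamma> x \<otimes>\<^bsub>S\<^esub> \<gamma> y"] \<gamma>_closed x y by simp
  qed (rule \<gamma>_closed)
qed (rule \<beta>_hom)

text \<open>Both \<open>\<delta>\<^sub>P(x)\<close> and \<open>\<delta>\<^sub>S(x)\<close> give \<open>\<delta>\<^bsub>P,S\<^esub>(x)\<close> when composed with the inclusion of \<open>P\<close> into \<open>S\<close>, which \<open>\<alpha>\<close>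
  maps to an inclusion; injectivity of \<open>\<delta>'\<close> on the transporter does the rest.\<close>

lemma \<alpha>_delta_subgroup:
  assumes P: "P \<in> \<Delta>" and x: "x \<in> P" and h: "h \<in> \<alpha>\<^sub>o P"
    and eq: "fmor \<alpha> P P (fmor \<delta> P P x) = fmor \<delta>' (\<alpha>\<^sub>o P) (\<alpha>\<^sub>o P) h"
  shows "h = \<beta> x"
proof -
  note S = source.carrier_in_Delta and S' = target.carrier_in_Delta
  note P' = \<alpha>_obj[OF P]
  have sP: "P \<subseteq> carrier S" and sP': "\<alpha>\<^sub>o P \<subseteq> carrier S'"
    using source.A1_subgroups[OF P] target.A1_subgroups[OF P'] subgroup.subset by blast+
  have xc: "x \<in> carrier S" using x sP by blast
  have xP: "x \<in> transporter S P P" using x subset_transporter[OF P] by blast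
  have hP: "h \<in> transporter S' (\<alpha>\<^sub>o P) (\<alpha>\<^sub>o P)" using h subset_transporter'[OF P'] by blast
  let ?\<iota> = "fmor \<delta> P (carrier S) \<one>\<^bsub>S\<^esub>" and ?\<iota>' = "fmor \<delta>' (\<alpha>\<^sub>o P) (carrier S') \<one>\<^bsub>S'\<^esub>"
  have \<iota>H: "?\<iota> \<in> Hom T P (carrier S)"
    using source.delta_in_Hom[OF P S source.one_in_transporter[OF P sP]] .
  have \<alpha>\<iota>: "fmor \<alpha> P (carrier S) ?\<iota> = ?\<iota>'" using \<alpha>_inclusion(2)[OF P S sP] by (simp add: \<alpha>_carrier)
  have "fmor \<delta>' (\<alpha>\<^sub>o P) (carrier S') h = Comp T' (\<alpha>\<^sub>o P) (\<alpha>\<^sub>o P) (carrier S') ?\<iota>' (fmor \<delta>' (\<alpha>\<^sub>o P) (\<alpha>\<^sub>o P) h)"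
    using target.inclusion_compose_delta[OF P' P' S' sP' hP] by simp
  also have "\<dots> = fmor \<alpha> P (carrier S) (Comp T P P (carrier S) ?\<iota> (fmor \<delta> P P x))"
    using \<alpha>_Comp[OF P P S source.delta_in_Hom[OF P P xP] \<iota>H] eq \<alpha>\<iota> by (simp add: \<alpha>_carrier)
  also have "Comp T P P (carrier S) ?\<iota> (fmor \<delta> P P x) =
      Comp T P (carrier S) (carrier S) (fmor \<delta> (carrier S) (carrier S) x) ?\<iota>"
    using source.inclusion_compose_delta[OF P P S sP xP] source.delta_compose_inclusion[OF P S S sP, of x] xc
    by (simp add: source.S.transporter_carrier)
  also have "fmor \<alpha> P (carrier S) \<dots> =
      Comp T' (\<alpha>\<^sub>o P) (carrier S') (carrier S') (fmor \<delta>' (carrier S') (carrier S') (\<beta> x)) ?\<iota>'"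
    using \<alpha>_Comp[OF P S S \<iota>H source.delta_in_Hom[OF S S]] xc
    by (simp add: source.S.transporter_carrier \<alpha>_carrier \<alpha>\<iota> \<alpha>_delta_carrier)
  also have "\<dots> = fmor \<delta>' (\<alpha>\<^sub>o P) (carrier S') (\<beta> x)"
    using target.delta_compose_inclusion[OF P' S' S' sP', of "\<beta> x"] xc
    by (simp add: target.S.transporter_carrier \<beta>_closed)
  finally have "fmor \<delta>' (\<alpha>\<^sub>o P) (carrier S') h = fmor \<delta>' (\<alpha>\<^sub>o P) (carrier S') (\<beta> x)" .
  moreover have "h \<in> transporter S' (\<alpha>\<^sub>o P) (carrier S')" "\<beta> x \<in> transporter S' (\<alpha>\<^sub>o P) (carrier S')"
    using h sP' \<beta>_closed[OF xc] by (auto simp: transporter_iff subset_iff)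
  ultimately show ?thesis using inj_onD[OF target.B_injective[OF P' S']] by blast
qed

lemma \<alpha>_obj_eq: assumes P: "P \<in> \<Delta>" shows "\<alpha>\<^sub>o P = \<beta> ` P"
proof
  show "\<alpha>\<^sub>o P \<subseteq> \<beta> ` P"
  proof
    fix h assume h: "h \<in> \<alpha>\<^sub>o P"
    then have "fmor \<delta>' (\<alpha>\<^sub>o P) (\<alpha>\<^sub>o P) h \<in> fmor \<alpha> P P ` fmor \<delta> P P ` P" using \<alpha>_isotypical[OF P] by simp
    then obtain x where "x \<in> P" "fmor \<alpha> P P (fmor \<delta> P P x) = fmor \<delta>' (\<alpha>\<^sub>o P) (\<alpha>\<^sub>o P) h" by force
    then show "h \<in> \<beta> ` P" using \<alpha>_delta_subgroup[OF P _ h] by blast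
  qed
  show "\<beta> ` P \<subseteq> \<alpha>\<^sub>o P"
  proof
    fix y assume "y \<in> \<beta> ` P"
    then obtain x where x: "x \<in> P" "y = \<beta> x" by blast
    then have "fmor \<alpha> P P (fmor \<delta> P P x) \<in> fmor \<delta>' (\<alpha>\<^sub>o P) (\<alpha>\<^sub>o P) ` \<alpha>\<^sub>o P" using \<alpha>_isotypical[OF P] by blast
    then obtain h where h: "h \<in> \<alpha>\<^sub>o P" "fmor \<alpha> P P (fmor \<delta> P P x) = fmor \<delta>' (\<alpha>\<^sub>o P) (\<alpha>\<^sub>o P) h" by blast
    then show "y \<in> \<alpha>\<^sub>o P" using \<alpha>_delta_subgroup[OF P x(1) h] x by simp
  qed
qed

lemma \<beta>_transporter:
  assumes P: "P \<in> \<Delta>" and Q: "Q \<in> \<Delta>" and g: "g \<in> transporter S P Q"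
  shows "\<beta> g \<in> transporter S' (\<alpha>\<^sub>o P) (\<alpha>\<^sub>o Q)"
proof -
  have gc: "g \<in> carrier S" using g by (simp add: transporter_def)
  have "\<beta> g \<otimes>\<^bsub>S'\<^esub> \<beta> x \<otimes>\<^bsub>S'\<^esub> inv\<^bsub>S'\<^esub> (\<beta> g) \<in> \<beta> ` Q" if x: "x \<in> P" for x
  proof -
    have xc: "x \<in> carrier S" using subgroup.mem_carrier[OF source.A1_subgroups[OF P] x] .
    have "\<beta> g \<otimes>\<^bsub>S'\<^esub> \<beta> x \<otimes>\<^bsub>S'\<^esub> inv\<^bsub>S'\<^esub> (\<beta> g) = \<beta> (g \<otimes>\<^bsub>S\<^esub> x \<otimes>\<^bsub>S\<^esub> inv\<^bsub>S\<^esub> g)" using gc xc by simp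
    moreover have "g \<otimes>\<^bsub>S\<^esub> x \<otimes>\<^bsub>S\<^esub> inv\<^bsub>S\<^esub> g \<in> Q" using g x by (simp add: transporter_iff)
    ultimately show ?thesis by blast
  qed
  then show ?thesis using \<beta>_closed[OF gc] by (auto simp: transporter_iff \<alpha>_obj_eq P Q)
qed

text \<open>After composition with the inclusion of \<open>\<alpha>(Q)\<close> into \<open>S'\<close>, which is a monomorphism, both sides become
  \<open>\<delta>'\<^bsub>\<alpha>(P),S'\<^esub>(\<beta>(g))\<close>.\<close>

lemma \<alpha>_delta:
  assumes P: "P \<in> \<Delta>" and Q: "Q \<in> \<Delta>" and g: "g \<in> transporter S P Q"
  shows "fmor \<alpha> P Q (fmor \<delta> P Q g) = fmor \<delta>' (\<alpha>\<^sub>o P) (\<alpha>\<^sub>o Q) (\<beta> g)"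
proof -
  note S = source.carrier_in_Delta and S' = target.carrier_in_Delta
  note P' = \<alpha>_obj[OF P] and Q' = \<alpha>_obj[OF Q]
  have sP: "P \<subseteq> carrier S" and sP': "\<alpha>\<^sub>o P \<subseteq> carrier S'" and sQ: "Q \<subseteq> carrier S" and sQ': "\<alpha>\<^sub>o Q \<subseteq> carrier S'"
    using source.A1_subgroups[OF P] target.A1_subgroups[OF P'] source.A1_subgroups[OF Q]
      target.A1_subgroups[OF Q'] subgroup.subset by blast+
  have gc: "g \<in> carrier S" using g by (simp add: transporter_def)
  note \<beta>g = \<beta>_transporter[OF P Q g]
  let ?\<iota> = "\<lambda>R. fmor \<delta> R (carrier S) \<one>\<^bsub>S\<^esub>" and ?\<iota>' = "\<lambda>R. fmor \<delta>' (\<alpha>\<^sub>o R) (carrier S') \<one>\<^bsub>S'\<^esub>"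
  have \<iota>H: "?\<iota> P \<in> Hom T P (carrier S)" "?\<iota> Q \<in> Hom T Q (carrier S)"
    using source.delta_in_Hom[OF P S source.one_in_transporter[OF P sP]]
      source.delta_in_Hom[OF Q S source.one_in_transporter[OF Q sQ]] .
  have \<alpha>\<iota>: "fmor \<alpha> P (carrier S) (?\<iota> P) = ?\<iota>' P" "fmor \<alpha> Q (carrier S) (?\<iota> Q) = ?\<iota>' Q"
    using \<alpha>_inclusion(2)[OF P S sP] \<alpha>_inclusion(2)[OF Q S sQ] by (simp_all add: \<alpha>_carrier)
  have \<iota>'H: "?\<iota>' Q \<in> Hom T' (\<alpha>\<^sub>o Q) (carrier S')"
    using target.delta_in_Hom[OF Q' S' target.one_in_transporter[OF Q' sQ']] .
  have "Comp T' (\<alpha>\<^sub>o P) (\<alpha>\<^sub>o Q) (carrier S') (?\<iota>' Q) (fmor \<alpha> P Q (fmor \<delta> P Q g)) =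
      fmor \<alpha> P (carrier S) (Comp T P Q (carrier S) (?\<iota> Q) (fmor \<delta> P Q g))"
    using \<alpha>_Comp[OF P Q S source.delta_in_Hom[OF P Q g] \<iota>H(2)] \<alpha>\<iota> by (simp add: \<alpha>_carrier)
  also have "Comp T P Q (carrier S) (?\<iota> Q) (fmor \<delta> P Q g) =
      Comp T P (carrier S) (carrier S) (fmor \<delta> (carrier S) (carrier S) g) (?\<iota> P)"
    using source.inclusion_compose_delta[OF P Q S sQ g] source.delta_compose_inclusion[OF P S S sP, of g] gc
    by (simp add: source.S.transporter_carrier)
  also have "fmor \<alpha> P (carrier S) \<dots> =
      Comp T' (\<alpha>\<^sub>o P) (carrier S') (carrier S') (fmor \<delta>' (carrier S') (carrier S') (\<beta> g)) (?\<iota>' P)"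
    using \<alpha>_Comp[OF P S S \<iota>H(1) source.delta_in_Hom[OF S S]] gc
    by (simp add: source.S.transporter_carrier \<alpha>_carrier \<alpha>\<iota> \<alpha>_delta_carrier)
  also have "\<dots> = fmor \<delta>' (\<alpha>\<^sub>o P) (carrier S') (\<beta> g)"
    using target.delta_compose_inclusion[OF P' S' S' sP', of "\<beta> g"] gc
    by (simp add: target.S.transporter_carrier \<beta>_closed)
  also have "\<dots> = Comp T' (\<alpha>\<^sub>o P) (\<alpha>\<^sub>o Q) (carrier S') (?\<iota>' Q) (fmor \<delta>' (\<alpha>\<^sub>o P) (\<alpha>\<^sub>o Q) (\<beta> g))"
    using target.inclusion_compose_delta[OF P' Q' S' sQ' \<beta>g] by simp
  finally show ?thesis
    using target.mor_mono[OF P' Q' S' \<iota>'H \<alpha>_Hom[OF P Q source.delta_in_Hom[OF P Q g]]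
        target.delta_in_Hom[OF P' Q' \<beta>g]] by blast
qed

text \<open>By axiom (C) in \<open>T'\<close> and by the image under \<open>\<alpha>\<close> of axiom (C) in \<open>T\<close>, the elements
  of \<open>\<alpha>(Q)\<close> on the two sides have the same composite with \<open>\<alpha>(\<phi>)\<close>, so \<open>delta_right_cancel\<close> applies.\<close>

lemma \<pi>_\<alpha>_apply:
  assumes P: "P \<in> \<Delta>" and Q: "Q \<in> \<Delta>" and \<phi>: "\<phi> \<in> Hom T P Q" and x: "x \<in> P"
  shows "fmor \<pi>' (\<alpha>\<^sub>o P) (\<alpha>\<^sub>o Q) (fmor \<alpha> P Q \<phi>) (\<beta> x) = \<beta> (fmor \<pi> P Q \<phi> x)"
proof -
  note P' = \<alpha>_obj[OF P] and Q' = \<alpha>_obj[OF Q] and \<phi>' = \<alpha>_Hom[OF P Q \<phi>]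
  let ?y = "fmor \<pi> P Q \<phi> x" and ?z = "fmor \<pi>' (\<alpha>\<^sub>o P) (\<alpha>\<^sub>o Q) (fmor \<alpha> P Q \<phi>) (\<beta> x)"
  have y: "?y \<in> Q"
    using source.hom_in[OF source.A1_subgroups[OF P] source.A1_subgroups[OF Q] source.pi_in_F[OF P Q \<phi>] x] .
  have \<beta>x: "\<beta> x \<in> \<alpha>\<^sub>o P" and \<beta>y: "\<beta> ?y \<in> \<alpha>\<^sub>o Q" using x y \<alpha>_obj_eq P Q by auto
  have z: "?z \<in> \<alpha>\<^sub>o Q"
    using target.hom_in[OF target.A1_subgroups[OF P'] target.A1_subgroups[OF Q']
        target.pi_in_F[OF P' Q' \<phi>'] \<beta>x] .
  have xP: "x \<in> transporter S P P" and yQ: "?y \<in> transporter S Q Q"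
    using x y subset_transporter P Q by blast+
  have "Comp T' (\<alpha>\<^sub>o P) (\<alpha>\<^sub>o Q) (\<alpha>\<^sub>o Q) (fmor \<delta>' (\<alpha>\<^sub>o Q) (\<alpha>\<^sub>o Q) ?z) (fmor \<alpha> P Q \<phi>) =
      Comp T' (\<alpha>\<^sub>o P) (\<alpha>\<^sub>o P) (\<alpha>\<^sub>o Q) (fmor \<alpha> P Q \<phi>) (fmor \<delta>' (\<alpha>\<^sub>o P) (\<alpha>\<^sub>o P) (\<beta> x))"
    using target.C[OF P' Q' \<phi>' \<beta>x] by simp
  also have "\<dots> = fmor \<alpha> P Q (Comp T P P Q \<phi> (fmor \<delta> P P x))"
    using \<alpha>_Comp[OF P P Q source.delta_in_Hom[OF P P xP] \<phi>] \<alpha>_delta[OF P P xP] by simp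
  also have "\<dots> = fmor \<alpha> P Q (Comp T P Q Q (fmor \<delta> Q Q ?y) \<phi>)"
    using source.C[OF P Q \<phi> x] by simp
  also have "\<dots> = Comp T' (\<alpha>\<^sub>o P) (\<alpha>\<^sub>o Q) (\<alpha>\<^sub>o Q) (fmor \<delta>' (\<alpha>\<^sub>o Q) (\<alpha>\<^sub>o Q) (\<beta> ?y)) (fmor \<alpha> P Q \<phi>)"
    using \<alpha>_Comp[OF P Q Q \<phi> source.delta_in_Hom[OF Q Q yQ]] \<alpha>_delta[OF Q Q yQ] by simp
  finally show ?thesis
    using target.delta_right_cancel[OF P' Q' Q' \<phi>'] subset_transporter'[OF Q'] z \<beta>y by blast
qed

lemma conj_along_\<pi>:
  assumes P: "P \<in> \<Delta>" and Q: "Q \<in> \<Delta>" and \<phi>: "\<phi> \<in> Hom T P Q"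
  shows "conj_along \<beta> \<gamma> P (fmor \<pi> P Q \<phi>) = fmor \<pi>' (\<alpha>\<^sub>o P) (\<alpha>\<^sub>o Q) (fmor \<alpha> P Q \<phi>)"
proof (rule iso.conj_along_eqI)
  show "P \<subseteq> carrier S" using source.A1_subgroups[OF P] by (rule subgroup.subset)
  show "fmor \<pi>' (\<alpha>\<^sub>o P) (\<alpha>\<^sub>o Q) (fmor \<alpha> P Q \<phi>) \<in> extensional (\<beta> ` P)"
    using target.hom_ext[OF target.A1_subgroups target.A1_subgroups target.pi_in_F[OF _ _ \<alpha>_Hom[OF P Q \<phi>]]]
      \<alpha>_obj[OF P] \<alpha>_obj[OF Q] by (simp flip: \<alpha>_obj_eq[OF P])
qed (rule \<pi>_\<alpha>_apply[OF assms])

text \<open>Essential surjectivity gives an isomorphism \<open>\<theta>\<close> from some \<open>\<alpha>(R)\<close> to \<open>P'\<close> in \<open>\<F>'\<close>. Fullness lifts \<open>\<theta>\<close> to a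
  morphism of \<open>T\<close>, whose image in \<open>S\<close> is a conjugate \<open>Q\<close> of \<open>R\<close> with \<open>\<beta>(Q) = P'\<close>.\<close>

lemma \<alpha>_surj_obj: assumes P': "P' \<in> \<Delta>'" shows "\<exists>P\<in>\<Delta>. \<alpha>\<^sub>o P = P'"
proof -
  obtain R where R: "R \<in> \<Delta>" "F_conjugate S' \<F>' (\<alpha>\<^sub>o R) P'" using \<alpha>_essentially_surjective[OF P'] by blast
  note S = source.carrier_in_Delta and S' = target.carrier_in_Delta
  have sR: "subgroup R S" and sR': "subgroup (\<alpha>\<^sub>o R) S'" and sP': "subgroup P' S'"
    using source.A1_subgroups R target.A1_subgroups \<alpha>_obj P' by blast+
  obtain \<theta> where \<theta>: "\<theta> \<in> \<F>' (\<alpha>\<^sub>o R) P'" "\<theta> ` \<alpha>\<^sub>o R = P'" using R(2) target.F_conjugate_iff by blast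
  have "\<theta> \<in> \<F>' (\<alpha>\<^sub>o R) (carrier S')"
    using target.enlarge_codomain[OF sR' sP' \<theta>(1) target.S.subgroup_self subgroup.subset[OF sP']] .
  then obtain \<psi> where \<psi>: "\<psi> \<in> Hom T' (\<alpha>\<^sub>o R) (\<alpha>\<^sub>o (carrier S))"
    "\<theta> = fmor \<pi>' (\<alpha>\<^sub>o R) (\<alpha>\<^sub>o (carrier S)) \<psi>"
    using target.A2_surjective[OF \<alpha>_obj[OF R(1)] S'] \<alpha>_carrier by (metis imageE)
  obtain \<phi> where \<phi>: "\<phi> \<in> Hom T R (carrier S)" "\<psi> = fmor \<alpha> R (carrier S) \<phi>"
    using \<alpha>_full[OF R(1) S \<psi>(1)] by blast
  let ?Q = "fmor \<pi> R (carrier S) \<phi> ` R"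
  have "F_conjugate S \<F> R ?Q"
    using source.F_conjugate_image[OF sR source.S.subgroup_self source.pi_in_F[OF R(1) S \<phi>(1)]] .
  then have Q: "?Q \<in> \<Delta>" by (rule source.A1_conjugates[OF R(1)])
  have "P' = \<theta> ` \<beta> ` R" using \<theta>(2) \<alpha>_obj_eq[OF R(1)] by simp
  also have "\<dots> = \<beta> ` ?Q" using \<pi>_\<alpha>_apply[OF R(1) S \<phi>(1)] \<psi>(2) \<phi>(2) by (force simp: image_iff)
  finally show ?thesis using \<alpha>_obj_eq[OF Q] Q by blast
qed

lemma Delta'_eq: "\<Delta>' = (\<lambda>P. \<beta> ` P) ` \<Delta>"
  using \<alpha>_surj_obj \<alpha>_obj \<alpha>_obj_eq by (auto simp: image_iff) metis+

text \<open>Alperin's theorem for \<open>\<F>\<close> and the pullback of \<open>\<F>'\<close> along \<open>\<beta>\<close>: automorphisms of centric radical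
  subgroups lift to \<open>T\<close>, where \<open>\<alpha>\<close> is available.\<close>

lemma conj_along_closed:
  assumes P: "subgroup P S" and Q: "subgroup Q S" and \<phi>: "\<phi> \<in> \<F> P Q"
  shows "conj_along \<beta> \<gamma> P \<phi> \<in> \<F>' (\<beta> ` P) (\<beta> ` Q)"
proof -
  interpret inv: mutually_inverse_homs S' S \<gamma> \<beta> by (rule iso.swap)
  have "\<F> R R \<subseteq> transported_fusion \<gamma> \<beta> \<F>' R R" if "R \<in> centric_radicals p S \<F>" for R
  proof
    have R: "R \<in> \<Delta>" using that centric_radicals_source by blast
    have sR: "R \<subseteq> carrier S" using source.A1_subgroups[OF R] by (rule subgroup.subset)
    fix \<chi> assume \<chi>: "\<chi> \<in> \<F> R R"
    then obtain \<psi> where \<psi>: "\<psi> \<in> Hom T R R" "\<chi> = fmor \<pi> R R \<psi>"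
      using source.A2_surjective[OF R R] by (metis imageE)
    have "conj_along \<beta> \<gamma> R \<chi> \<in> \<F>' (\<beta> ` R) (\<beta> ` R)"
      using conj_along_\<pi>[OF R R \<psi>(1)] \<psi>(2) target.pi_in_F[OF _ _ \<alpha>_Hom[OF R R \<psi>(1)]] \<alpha>_obj[OF R] \<alpha>_obj_eq[OF R]
      by simp
    then have "conj_along \<gamma> \<beta> (\<beta> ` R) (conj_along \<beta> \<gamma> R \<chi>) \<in> transported_fusion \<gamma> \<beta> \<F>' R R"
      unfolding transported_fusion_def by blast
    moreover have "conj_along \<gamma> \<beta> (\<beta> ` R) (conj_along \<beta> \<gamma> R \<chi>) = \<chi>"
      using source.hom_in[OF _ _ \<chi>] source.A1_subgroups[OF R] sR
      by (intro iso.conj_along_inverse[OF sR source.hom_ext[OF _ _ \<chi>]]) auto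
    ultimately show "\<chi> \<in> transported_fusion \<gamma> \<beta> \<F>' R R" by simp
  qed
  then have "\<phi> \<in> transported_fusion \<gamma> \<beta> \<F>' P Q"
    using source.alperin_fusion[OF inv.transported_fusion_system[OF target.fusion_system_axioms]] P Q \<phi>
    by blast
  then obtain \<theta> where \<theta>: "\<theta> \<in> \<F>' (\<beta> ` P) (\<beta> ` Q)" "\<phi> = conj_along \<gamma> \<beta> (\<beta> ` P) \<theta>"
    by (auto simp: transported_fusion_def)
  note P' = iso.\<beta>_subgroup[OF P] and Q' = iso.\<beta>_subgroup[OF Q]
  have "conj_along \<beta> \<gamma> (\<gamma> ` \<beta> ` P) (conj_along \<gamma> \<beta> (\<beta> ` P) \<theta>) = \<theta>"
    using target.hom_in[OF P' Q' \<theta>(1)] subgroup.subset[OF Q']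
    by (intro inv.conj_along_inverse[OF subgroup.subset[OF P'] target.hom_ext[OF P' Q' \<theta>(1)]]) auto
  then show ?thesis using \<theta> subgroup.subset[OF P] by simp
qed

text \<open>The same argument for \<open>\<F>'\<close>, with fullness of \<open>\<alpha>\<close> providing the lifts to \<open>T\<close>.\<close>

lemma conj_along_closed':
  assumes P': "subgroup P' S'" and Q': "subgroup Q' S'" and \<theta>: "\<theta> \<in> \<F>' P' Q'"
  shows "conj_along \<gamma> \<beta> P' \<theta> \<in> \<F> (\<gamma> ` P') (\<gamma> ` Q')"
proof -
  have "\<F>' R' R' \<subseteq> transported_fusion \<beta> \<gamma> \<F> R' R'" if R': "R' \<in> centric_radicals p S' \<F>'" for R'
  proof
    obtain R where R: "R \<in> \<Delta>" "R' = \<alpha>\<^sub>o R" using \<alpha>_surj_obj R' centric_radicals_target by blast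
    have sR: "R \<subseteq> carrier S" using source.A1_subgroups[OF R(1)] by (rule subgroup.subset)
    fix \<chi> assume "\<chi> \<in> \<F>' R' R'"
    then obtain \<zeta> where \<zeta>: "\<zeta> \<in> Hom T' R' R'" "\<chi> = fmor \<pi>' R' R' \<zeta>"
      using target.A2_surjective[of R' R'] \<alpha>_obj[OF R(1)] R(2) by (metis imageE)
    obtain \<psi> where \<psi>: "\<psi> \<in> Hom T R R" "\<zeta> = fmor \<alpha> R R \<psi>"
      using \<alpha>_full[OF R(1) R(1)] \<zeta>(1) R(2) by blast
    have "\<chi> = conj_along \<beta> \<gamma> R (fmor \<pi> R R \<psi>)"
      using conj_along_\<pi>[OF R(1) R(1) \<psi>(1)] \<zeta>(2) \<psi>(2) R(2) by simp
    then show "\<chi> \<in> transported_fusion \<beta> \<gamma> \<F> R' R'"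
      using iso.conj_along_in_transported[OF sR sR] source.pi_in_F[OF R(1) R(1) \<psi>(1)]
        \<alpha>_obj_eq[OF R(1)] R(2) by auto
  qed
  then have "\<theta> \<in> transported_fusion \<beta> \<gamma> \<F> P' Q'"
    using target.alperin_fusion[OF iso.transported_fusion_system[OF source.fusion_system_axioms]] P' Q' \<theta>
    by blast
  then obtain \<phi> where \<phi>: "\<phi> \<in> \<F> (\<gamma> ` P') (\<gamma> ` Q')" "\<theta> = conj_along \<beta> \<gamma> (\<gamma> ` P') \<phi>"
    by (auto simp: transported_fusion_def)
  note P = iso.\<gamma>_subgroup[OF P'] and Q = iso.\<gamma>_subgroup[OF Q']
  have "conj_along \<gamma> \<beta> (\<beta> ` \<gamma> ` P') (conj_along \<beta> \<gamma> (\<gamma> ` P') \<phi>) = \<phi>"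
    using source.hom_in[OF P Q \<phi>(1)] subgroup.subset[OF Q]
    by (intro iso.conj_along_inverse[OF subgroup.subset[OF P] source.hom_ext[OF P Q \<phi>(1)]]) auto
  then show ?thesis using \<phi> subgroup.subset[OF P'] by simp
qed

end

lemma Obj_transporter_cat [simp]: "Obj (transporter_cat S \<Delta>) = \<Delta>"
  and Hom_transporter_cat [simp]: "Hom (transporter_cat S \<Delta>) = transporter S"
  and Comp_transporter_cat [simp]: "Comp (transporter_cat S \<Delta>) P Q R h g = h \<otimes>\<^bsub>S\<^esub> g"
  and Id_transporter_cat [simp]: "Id (transporter_cat S \<Delta>) P = \<one>\<^bsub>S\<^esub>"
  by (simp_all add: transporter_cat_def)

context transporter_system_isomorphism
begin

definition \<beta>_star :: "('a set, 'a, 'b set, 'b) func" where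
  "\<beta>_star = restrict_func (transporter_cat S \<Delta>) \<lparr>fobj = (\<lambda>P. \<beta> ` P), fmor = (\<lambda>P Q g. \<beta> g)\<rparr>"

abbreviation c\<^sub>\<beta> :: "('a set, 'a \<Rightarrow> 'a, 'b set, 'b \<Rightarrow> 'b) func" where
  "c\<^sub>\<beta> \<equiv> conj_func \<beta> \<gamma> S \<F>"

lemma \<beta>_star_obj: "P \<in> \<Delta> \<Longrightarrow> fobj \<beta>_star P = \<beta> ` P"
  by (simp add: \<beta>_star_def)

lemma \<beta>_star_mor:
  "\<lbrakk>P \<in> \<Delta>; Q \<in> \<Delta>; g \<in> transporter S P Q\<rbrakk> \<Longrightarrow> fmor \<beta>_star P Q g = \<beta> g"
  by (simp add: \<beta>_star_def)

lemma \<beta>_star_normalized: "restrict_func (transporter_cat S \<Delta>) \<beta>_star = \<beta>_star"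
  by (simp add: \<beta>_star_def)

lemma \<beta>_star_functor: "cat_functor (transporter_cat S \<Delta>) (transporter_cat S' \<Delta>') \<beta>_star"
proof (intro cat_functor.intro cat_functor_axioms.intro)
  show "category (transporter_cat S \<Delta>)" "category (transporter_cat S' \<Delta>')"
    by (rule source.delta.source.category_axioms target.delta.source.category_axioms)+
  show "restrict_func (transporter_cat S \<Delta>) \<beta>_star = \<beta>_star" by (rule \<beta>_star_normalized)
  fix P assume "P \<in> Obj (transporter_cat S \<Delta>)"
  then have P: "P \<in> \<Delta>" by simp
  show "fobj \<beta>_star P \<in> Obj (transporter_cat S' \<Delta>')"
    using P \<alpha>_obj[OF P] by (simp add: \<beta>_star_obj \<alpha>_obj_eq)
  show "fmor \<beta>_star P P (Id (transporter_cat S \<Delta>) P) = Id (transporter_cat S' \<Delta>') (fobj \<beta>_star P)"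
    using P source.one_in_transporter[OF P subset_refl] by (simp add: \<beta>_star_mor)
  fix Q g assume "Q \<in> Obj (transporter_cat S \<Delta>)" "g \<in> Hom (transporter_cat S \<Delta>) P Q"
  then have Q: "Q \<in> \<Delta>" and g: "g \<in> transporter S P Q" by simp_all
  show "fmor \<beta>_star P Q g \<in> Hom (transporter_cat S' \<Delta>') (fobj \<beta>_star P) (fobj \<beta>_star Q)"
    using \<beta>_transporter[OF P Q g] P Q g by (simp add: \<beta>_star_mor \<beta>_star_obj \<alpha>_obj_eq)
  fix R h assume "R \<in> Obj (transporter_cat S \<Delta>)" "h \<in> Hom (transporter_cat S \<Delta>) Q R"
  then have R: "R \<in> \<Delta>" and h: "h \<in> transporter S Q R" by simp_all
  have "h \<otimes>\<^bsub>S\<^esub> g \<in> transporter S P R"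
    using source.S.transporter_mult[OF h g subgroup.subset[OF source.A1_subgroups[OF P]]] .
  then show "fmor \<beta>_star P R (Comp (transporter_cat S \<Delta>) P Q R h g) =
      Comp (transporter_cat S' \<Delta>') (fobj \<beta>_star P) (fobj \<beta>_star Q) (fobj \<beta>_star R) (fmor \<beta>_star Q R h) (fmor \<beta>_star P Q g)"
    using P Q R g h source.transporter_in_carrier[OF g] source.transporter_in_carrier[OF h]
    by (simp add: \<beta>_star_mor)
qed

lemma \<beta>_star_carrier: "fmor \<beta>_star (carrier S) (carrier S) = \<beta>"
proof
  fix g show "fmor \<beta>_star (carrier S) (carrier S) g = \<beta> g"
    using source.carrier_in_Delta
    by (cases "g \<in> carrier S")
      (simp_all add: \<beta>_star_def restrict_func_def source.S.transporter_carrier \<beta>_def)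
qed

lemma delta_\<beta>_star:
  "comp_func (transporter_cat S \<Delta>) \<delta>' \<beta>_star = comp_func (transporter_cat S \<Delta>) \<alpha> \<delta>"
proof (rule functor_eqI[of "transporter_cat S \<Delta>"])
  fix P assume "P \<in> Obj (transporter_cat S \<Delta>)"
  then have P: "P \<in> \<Delta>" by simp
  show "fobj (comp_func (transporter_cat S \<Delta>) \<delta>' \<beta>_star) P = fobj (comp_func (transporter_cat S \<Delta>) \<alpha> \<delta>) P"
    using P target.A1_delta[OF \<alpha>_obj[OF P]]
    by (simp add: source.A1_delta \<beta>_star_obj \<alpha>_obj_eq)
  fix Q g assume "Q \<in> Obj (transporter_cat S \<Delta>)" "g \<in> Hom (transporter_cat S \<Delta>) P Q"
  then have Q: "Q \<in> \<Delta>" and g: "g \<in> transporter S P Q" by simp_all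
  show "fmor (comp_func (transporter_cat S \<Delta>) \<delta>' \<beta>_star) P Q g =
      fmor (comp_func (transporter_cat S \<Delta>) \<alpha> \<delta>) P Q g"
    using P Q g \<alpha>_delta[OF P Q g]
    by (simp add: source.A1_delta \<beta>_star_obj \<beta>_star_mor \<alpha>_obj_eq)
qed simp_all

text \<open>On objects \<open>\<delta>'\<close> is the identity and on morphisms it is injective, so the equation determines \<open>B\<close>.\<close>

lemma \<beta>_star_unique:
  assumes B: "cat_functor (transporter_cat S \<Delta>) (transporter_cat S' \<Delta>') B"
    and eq: "comp_func (transporter_cat S \<Delta>) \<delta>' B = comp_func (transporter_cat S \<Delta>) \<alpha> \<delta>"
  shows "B = \<beta>_star"
proof (rule functor_eqI[of "transporter_cat S \<Delta>", OF cat_functor.normalized[OF B] \<beta>_star_normalized])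
  have obj: "fobj B P = \<beta> ` P" if P: "P \<in> \<Delta>" for P
  proof -
    have "fobj B P \<in> \<Delta>'" using cat_functor.fobj_in_Obj[OF B, of P] P by simp
    moreover have "fobj \<delta>' (fobj B P) = \<alpha>\<^sub>o P"
      using arg_cong[OF eq, of "\<lambda>F. fobj F P"] P by (simp add: source.A1_delta)
    ultimately show ?thesis using target.A1_delta \<alpha>_obj_eq[OF P] by simp
  qed
  fix P assume "P \<in> Obj (transporter_cat S \<Delta>)"
  then have P: "P \<in> \<Delta>" by simp
  show "fobj B P = fobj \<beta>_star P" using obj P by (simp add: \<beta>_star_obj)
  fix Q g assume "Q \<in> Obj (transporter_cat S \<Delta>)" "g \<in> Hom (transporter_cat S \<Delta>) P Q"
  then have Q: "Q \<in> \<Delta>" and g: "g \<in> transporter S P Q" by simp_all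
  have "fmor B P Q g \<in> transporter S' (\<alpha>\<^sub>o P) (\<alpha>\<^sub>o Q)"
    using cat_functor.fmor_in_Hom[OF B, of P Q g] P Q g by (simp add: obj \<alpha>_obj_eq)
  moreover have "fmor \<delta>' (\<alpha>\<^sub>o P) (\<alpha>\<^sub>o Q) (fmor B P Q g) = fmor \<delta>' (\<alpha>\<^sub>o P) (\<alpha>\<^sub>o Q) (\<beta> g)"
    using arg_cong[OF eq, of "\<lambda>F. fmor F P Q g"] P Q g \<alpha>_delta[OF P Q g]
    by (simp add: source.A1_delta obj \<alpha>_obj_eq)
  ultimately have "fmor B P Q g = \<beta> g"
    using inj_onD[OF target.B_injective[OF \<alpha>_obj[OF P] \<alpha>_obj[OF Q]]] \<beta>_transporter[OF P Q g] by blast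
  then show "fmor B P Q g = fmor \<beta>_star P Q g" using P Q g by (simp add: \<beta>_star_mor)
qed

lemma c_\<beta>_isomorphism: "fusion_isomorphism S \<F> S' \<F>' \<beta> c\<^sub>\<beta>"
  using source.fusion_system_axioms target.fusion_system_axioms conj_along_closed conj_along_closed'
  by (intro iso.conj_func_isomorphism) (auto simp: \<beta>_def \<gamma>_def)

text \<open>The compatibility with \<open>\<beta>\<close> determines the values of \<open>c(\<phi>)\<close> on \<open>\<beta>(P)\<close>, which is its whole domain.\<close>

lemma c_\<beta>_unique:
  assumes c: "fusion_isomorphism S \<F> S' \<F>' \<beta> c"
  shows "c = c\<^sub>\<beta>"
proof (rule functor_eqI[of "fusion_cat S \<F>"])
  have c: "cat_functor (fusion_cat S \<F>) (fusion_cat S' \<F>') c"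
    and obj: "\<And>P. subgroup P S \<Longrightarrow> fobj c P = \<beta> ` P"
    and mor: "\<And>P Q \<phi> x. \<lbrakk>subgroup P S; subgroup Q S; \<phi> \<in> \<F> P Q; x \<in> P\<rbrakk>
      \<Longrightarrow> fmor c P Q \<phi> (\<beta> x) = \<beta> (\<phi> x)"
    using c by (auto simp: fusion_isomorphism_def fusion_morphism_def)
  show "restrict_func (fusion_cat S \<F>) c = c" by (rule cat_functor.normalized[OF c])
  fix P assume "P \<in> Obj (fusion_cat S \<F>)"
  then have P: "subgroup P S" by (simp add: fusion_cat_def)
  show "fobj c P = fobj c\<^sub>\<beta> P" using obj P by simp
  fix Q \<phi> assume "Q \<in> Obj (fusion_cat S \<F>)" "\<phi> \<in> Hom (fusion_cat S \<F>) P Q"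
  then have Q: "subgroup Q S" and \<phi>: "\<phi> \<in> \<F> P Q" by (simp_all add: fusion_cat_def)
  have "fmor c P Q \<phi> \<in> \<F>' (\<beta> ` P) (\<beta> ` Q)"
    using cat_functor.fmor_in_Hom[OF c, of P Q \<phi>] P Q \<phi> by (simp add: fusion_cat_def obj)
  then have "conj_along \<beta> \<gamma> P \<phi> = fmor c P Q \<phi>"
    using target.hom_ext[OF iso.\<beta>_subgroup[OF P] iso.\<beta>_subgroup[OF Q]] mor[OF P Q \<phi>]
    by (intro iso.conj_along_eqI[OF subgroup.subset[OF P]]) auto
  then show "fmor c P Q \<phi> = fmor c\<^sub>\<beta> P Q \<phi>" using P Q \<phi> by simp
qed simp

lemma pi_comp_\<alpha>: "comp_func T \<pi>' \<alpha> = comp_func T c\<^sub>\<beta> \<pi>"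
proof (rule functor_eqI[of T])
  fix P assume "P \<in> Obj T"
  then have P: "P \<in> \<Delta>" by (simp add: source.Obj_T)
  show "fobj (comp_func T \<pi>' \<alpha>) P = fobj (comp_func T c\<^sub>\<beta> \<pi>) P"
    using P \<alpha>_obj[OF P] source.A1_subgroups[OF P]
    by (simp add: source.Obj_T source.A1_pi target.A1_pi \<alpha>_obj_eq)
  fix Q \<phi> assume "Q \<in> Obj T" and \<phi>: "\<phi> \<in> Hom T P Q"
  then have Q: "Q \<in> \<Delta>" by (simp add: source.Obj_T)
  show "fmor (comp_func T \<pi>' \<alpha>) P Q \<phi> = fmor (comp_func T c\<^sub>\<beta> \<pi>) P Q \<phi>"
    using P Q \<phi> source.A1_subgroups source.pi_in_F conj_along_\<pi>[OF P Q \<phi>]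
    by (simp add: source.Obj_T source.A1_pi)
qed simp_all

lemma induced_isomorphisms_exist:
  "induced_isomorphisms S \<F> \<Delta> T \<delta> \<pi> S' \<F>' \<Delta>' \<delta>' \<pi>' \<alpha> \<beta> \<beta>_star c\<^sub>\<beta>"
  unfolding induced_isomorphisms_def
proof (intro conjI)
  show "\<beta> \<in> Group.iso S S'" using \<beta>_hom \<beta>_bij by (simp add: Group.iso_def)
  show "\<beta> \<in> extensional (carrier S)" by (simp add: \<beta>_def)
  show "fobj \<beta>_star (carrier S) = carrier S'"
    using \<alpha>_obj_eq[OF source.carrier_in_Delta] \<alpha>_carrier source.carrier_in_Delta by (simp add: \<beta>_star_obj)
qed (simp_all add: \<beta>_star_functor c_\<beta>_isomorphism delta_\<beta>_star pi_comp_\<alpha> \<beta>_star_carrier)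

lemma induced_isomorphisms_unique:
  assumes "induced_isomorphisms S \<F> \<Delta> T \<delta> \<pi> S' \<F>' \<Delta>' \<delta>' \<pi>' \<alpha> \<beta>' B c"
  shows "\<beta>' = \<beta> \<and> B = \<beta>_star \<and> c = c\<^sub>\<beta>"
proof -
  have "B = \<beta>_star" using assms \<beta>_star_unique by (simp add: induced_isomorphisms_def)
  moreover from this have "\<beta>' = \<beta>" using assms \<beta>_star_carrier by (simp add: induced_isomorphisms_def)
  moreover have "fusion_isomorphism S \<F> S' \<F>' \<beta>' c"
    using assms unfolding induced_isomorphisms_def by blast
  ultimately show ?thesis using c_\<beta>_unique by metis
qed

end

lemma same_cat_imp_same_group:
  assumes "same_cat (transporter_cat S \<Delta>) (transporter_cat S' \<Delta>')"
    and "carrier S \<in> \<Delta>" "group S"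
    and "carrier S = carrier S'"
  shows "same_group S S'"
proof -
  interpret S: unextended_group S using assms(3) by (simp add: unextended_group_def)
  have "x \<otimes>\<^bsub>S\<^esub> y = x \<otimes>\<^bsub>S'\<^esub> y" if "x \<in> carrier S" "y \<in> carrier S" for x y
    using assms(1,2) that S.transporter_carrier unfolding same_cat_def by fastforce
  then show ?thesis using assms(4) by (simp add: same_group_def)
qed

text \<open>As \<open>\<delta>'\<^sub>S\<close> is injective, rigidity says that \<open>S\<close> and \<open>S'\<close> are the same group and \<open>\<beta>\<close> is
  the identity. Then \<open>\<Delta>' = \<beta>(\<Delta>) = \<Delta>\<close>, and \<open>\<F>' = \<F>\<close>
  because conjugation by \<open>\<beta>\<close> maps the two fusion systems into each other. Conversely, \<open>\<beta>\<close> is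
  the action of \<open>\<beta>\<^sub>*\<close> on the automorphisms of \<open>S\<close>, and the two multiplications agree because they are the
  compositions at the object \<open>S\<close>.\<close>

lemma rigid_iff_identity:
  fixes S S' :: "'a monoid"
  assumes "transporter_system_isomorphism p S \<F> T \<Delta> \<delta> \<pi> S' \<F>' T' \<Delta>' \<delta>' \<pi>' \<alpha>"
    and ind: "induced_isomorphisms S \<F> \<Delta> T \<delta> \<pi> S' \<F>' \<Delta>' \<delta>' \<pi>' \<alpha> \<beta> B c"
  shows "rigid S \<delta> S' \<delta>' \<alpha> \<longleftrightarrow>
    is_identity_functor (transporter_cat S \<Delta>) (transporter_cat S' \<Delta>') B \<and>
    is_identity_functor (fusion_cat S \<F>) (fusion_cat S' \<F>') c"
proof -
  interpret I: transporter_system_isomorphism p S \<F> T \<Delta> \<delta> \<pi> S' \<F>' T' \<Delta>' \<delta>' \<pi>'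
    "\<lambda>P. {e \<in> Hom T P P. fmor \<pi> P P e = (\<lambda>x\<in>P. x)}"
    "\<lambda>P. {e \<in> Hom T' P P. fmor \<pi>' P P e = (\<lambda>x\<in>P. x)}" \<alpha> by (rule assms(1))
  have e: "B = I.\<beta>_star" "c = I.c\<^sub>\<beta>" using I.induced_isomorphisms_unique[OF ind] by simp_all
  note Sd = I.source.carrier_in_Delta
  show ?thesis unfolding e
  proof
    assume r: "rigid S \<delta> S' \<delta>' \<alpha>"
    then have mult: "x \<otimes>\<^bsub>S\<^esub> y = x \<otimes>\<^bsub>S'\<^esub> y" if "x \<in> carrier S" "y \<in> carrier S" for x y
      using that by (simp add: rigid_def same_group_def)
    have car: "carrier S' = carrier S" using r by (simp add: rigid_def same_group_def)
    have \<beta>id: "I.\<beta> g = g" if g: "g \<in> carrier S" for g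
      using I.delta'_carrier_inj[of "I.\<beta> g" g] I.\<alpha>_delta_carrier[OF g] I.\<beta>_closed[OF g] r g car
      by (simp add: rigid_def)
    have \<gamma>id: "I.\<gamma> g = g" if "g \<in> carrier S" for g using I.iso.\<gamma>\<beta>[OF that] \<beta>id[OF that] by simp
    have \<beta>im: "I.\<beta> ` P = P" if "P \<subseteq> carrier S" for P
      using that image_cong[of P P I.\<beta> "\<lambda>x. x"] \<beta>id by (simp add: subset_iff)
    have \<gamma>im: "I.\<gamma> ` P = P" if "P \<subseteq> carrier S" for P
      using that image_cong[of P P I.\<gamma> "\<lambda>x. x"] \<gamma>id by (simp add: subset_iff)
    have one: "\<one>\<^bsub>S'\<^esub> = \<one>\<^bsub>S\<^esub>" using I.iso.\<beta>.hom_one \<beta>id[OF I.source.S.one_closed] by simp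
    have inv: "inv\<^bsub>S'\<^esub> g = inv\<^bsub>S\<^esub> g" if "g \<in> carrier S" for g
      using I.iso.\<beta>.hom_inv[OF that] \<beta>id that by simp
    have sub: "P \<subseteq> carrier S" if "P \<in> \<Delta>" for P
      using I.source.A1_subgroups[OF that] by (rule subgroup.subset)
    have \<Delta>: "\<Delta>' = \<Delta>" using I.Delta'_eq \<beta>im sub by simp
    have tr: "transporter S' P Q = transporter S P Q" if "P \<subseteq> carrier S" for P Q
    proof -
      have "g \<otimes>\<^bsub>S'\<^esub> x \<otimes>\<^bsub>S'\<^esub> inv\<^bsub>S'\<^esub> g = g \<otimes>\<^bsub>S\<^esub> x \<otimes>\<^bsub>S\<^esub> inv\<^bsub>S\<^esub> g"
        if g: "g \<in> carrier S" and "x \<in> P" for g x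
      proof -
        have x: "x \<in> carrier S" using \<open>x \<in> P\<close> \<open>P \<subseteq> carrier S\<close> by blast
        show ?thesis
          using inv[OF g] mult[OF g x] mult[OF I.source.S.m_closed[OF g x] I.source.S.inv_closed[OF g]]
          by metis
      qed
      then show ?thesis by (auto simp: transporter_iff car)
    qed
    have B: "I.\<beta>_star = id_func (transporter_cat S \<Delta>)"
      by (rule functor_eqI[of "transporter_cat S \<Delta>"])
        (use \<beta>im sub \<beta>id I.source.transporter_in_carrier in
          \<open>auto simp: I.\<beta>_star_normalized I.\<beta>_star_obj I.\<beta>_star_mor\<close>)
    have "same_cat (transporter_cat S \<Delta>) (transporter_cat S' \<Delta>')"
      using tr[OF sub] mult I.source.transporter_in_carrier by (auto simp: same_cat_def \<Delta> one)
    then have 1: "is_identity_functor (transporter_cat S \<Delta>) (transporter_cat S' \<Delta>') I.\<beta>_star"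
      using B by (simp add: is_identity_functor_def)
    have ssub: "P \<subseteq> carrier S" if "subgroup P S" for P using that by (rule subgroup.subset)
    have sg: "subgroup P S' \<longleftrightarrow> subgroup P S" for P
    proof
      assume "subgroup P S'"
      then show "subgroup P S"
        using I.iso.\<gamma>_subgroup[of P] \<gamma>im[of P] subgroup.subset[of P S'] car by simp
    next
      assume "subgroup P S"
      then show "subgroup P S'" using I.iso.\<beta>_subgroup[of P] \<beta>im[of P] ssub by simp
    qed
    have cid: "conj_along I.\<beta> I.\<gamma> P \<phi> = \<phi>" if P: "subgroup P S" and Q: "subgroup Q S" and \<phi>: "\<phi> \<in> \<F> P Q" for P Q \<phi>
    proof (rule I.iso.conj_along_eqI[OF ssub[OF P]])
      show "\<phi> \<in> extensional (I.\<beta> ` P)" using I.source.hom_ext[OF P Q \<phi>] \<beta>im[OF ssub[OF P]] by simp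
      show "\<phi> (I.\<beta> x) = I.\<beta> (\<phi> x)" if "x \<in> P" for x
        using that \<beta>id ssub[OF P] ssub[OF Q] I.source.hom_in[OF P Q \<phi> that] by (simp add: subset_iff)
    qed
    have FF: "\<F> P Q = \<F>' P Q" if P: "subgroup P S" and Q: "subgroup Q S" for P Q
    proof
      show "\<F> P Q \<subseteq> \<F>' P Q"
        using I.conj_along_closed[OF P Q] cid[OF P Q] \<beta>im[OF ssub[OF P]] \<beta>im[OF ssub[OF Q]] by auto
      show "\<F>' P Q \<subseteq> \<F> P Q"
      proof
        fix \<theta> assume \<theta>: "\<theta> \<in> \<F>' P Q"
        have P': "subgroup P S'" and Q': "subgroup Q S'" using P Q sg by simp_all
        have "conj_along I.\<gamma> I.\<beta> P \<theta> \<in> \<F> P Q"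
          using I.conj_along_closed'[OF P' Q' \<theta>] \<gamma>im[OF ssub[OF P]] \<gamma>im[OF ssub[OF Q]] by simp
        moreover have "conj_along I.\<gamma> I.\<beta> P \<theta> = \<theta>"
        proof (rule mutually_inverse_homs.conj_along_eqI[OF I.iso.swap subgroup.subset[OF P']])
          show "\<theta> \<in> extensional (I.\<gamma> ` P)"
            using I.target.hom_ext[OF P' Q' \<theta>] \<gamma>im[OF ssub[OF P]] by simp
          show "\<theta> (I.\<gamma> x) = I.\<gamma> (\<theta> x)" if "x \<in> P" for x
            using that \<gamma>id ssub[OF P] ssub[OF Q] I.target.hom_in[OF P' Q' \<theta> that] by (simp add: subset_iff)
        qed
        ultimately show "\<theta> \<in> \<F> P Q" by simp
      qed
    qed
    have C: "I.c\<^sub>\<beta> = id_func (fusion_cat S \<F>)"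
    proof (rule functor_eqI[of "fusion_cat S \<F>"])
      fix P assume Po: "P \<in> Obj (fusion_cat S \<F>)"
      then have P: "subgroup P S" by (simp add: fusion_cat_def)
      show "fobj I.c\<^sub>\<beta> P = fobj (id_func (fusion_cat S \<F>)) P"
        using P Po \<beta>im[OF ssub[OF P]] by simp
      fix Q \<phi> assume Qo: "Q \<in> Obj (fusion_cat S \<F>)" and \<phi>h: "\<phi> \<in> Hom (fusion_cat S \<F>) P Q"
      then have Q: "subgroup Q S" and \<phi>: "\<phi> \<in> \<F> P Q" by (simp_all add: fusion_cat_def)
      show "fmor I.c\<^sub>\<beta> P Q \<phi> = fmor (id_func (fusion_cat S \<F>)) P Q \<phi>"
        using P Q \<phi> Po Qo \<phi>h cid[OF P Q \<phi>] by simp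
    qed simp_all
    have "same_cat (fusion_cat S \<F>) (fusion_cat S' \<F>')"
      using sg FF by (auto simp: same_cat_def fusion_cat_def)
    then have "is_identity_functor (fusion_cat S \<F>) (fusion_cat S' \<F>') I.c\<^sub>\<beta>"
      using C by (simp add: is_identity_functor_def)
    with 1 show "is_identity_functor (transporter_cat S \<Delta>) (transporter_cat S' \<Delta>') I.\<beta>_star \<and>
        is_identity_functor (fusion_cat S \<F>) (fusion_cat S' \<F>') I.c\<^sub>\<beta>" by blast
  next
    assume "is_identity_functor (transporter_cat S \<Delta>) (transporter_cat S' \<Delta>') I.\<beta>_star \<and>
        is_identity_functor (fusion_cat S \<F>) (fusion_cat S' \<F>') I.c\<^sub>\<beta>"
    then have sc: "same_cat (transporter_cat S \<Delta>) (transporter_cat S' \<Delta>')"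
      and id: "I.\<beta>_star = id_func (transporter_cat S \<Delta>)"
      by (simp_all add: is_identity_functor_def)
    have "fobj I.\<beta>_star (carrier S) = carrier S" using id Sd by simp
    then have ao: "fobj \<alpha> (carrier S) = carrier S"
      using I.\<beta>_star_obj[OF Sd] I.\<alpha>_obj_eq[OF Sd] by simp
    then have car: "carrier S = carrier S'" using I.\<alpha>_carrier by simp
    have "I.\<beta> g = g" if "g \<in> carrier S" for g
      using I.\<beta>_star_mor[OF Sd Sd, of g] id Sd that by (simp add: I.source.S.transporter_carrier)
    then show "rigid S \<delta> S' \<delta>' \<alpha>"
      using same_cat_imp_same_group[OF sc Sd I.source.S.is_group car] ao I.\<alpha>_delta_carrier car
      by (simp add: rigid_def)
  qed
qed

theorem proposition2p5:
  fixes p :: nat and S S' :: "'a monoid" and \<F> \<F>' :: "'a fusion" and \<Delta> \<Delta>' :: "'a set set"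
    and T :: "('a set, 'm) cat" and T' :: "('a set, 'n) cat"
    and \<delta> :: "('a set, 'a, 'a set, 'm) func" and \<delta>' :: "('a set, 'a, 'a set, 'n) func"
    and \<pi> :: "('a set, 'm, 'a set, 'a \<Rightarrow> 'a) func" and \<pi>' :: "('a set, 'n, 'a set, 'a \<Rightarrow> 'a) func"
    and \<alpha> :: "('a set, 'm, 'a set, 'n) func"
  assumes "Factorial_Ring.prime p"
    and "saturated_fusion_system p S \<F>"
    and "saturated_fusion_system p S' \<F>'"
    and "transporter_system p S \<F> T \<Delta> \<delta> \<pi>"
    and "transporter_system p S' \<F>' T' \<Delta>' \<delta>' \<pi>'"
    and "centric_radicals p S \<F> \<subseteq> \<Delta>"
    and "centric_radicals p S' \<F>' \<subseteq> \<Delta>'"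
    and "transporter_isomorphism S T \<delta> S' T' \<delta>' \<alpha>"
  shows "\<exists>\<beta> B c.
      induced_isomorphisms S \<F> \<Delta> T \<delta> \<pi> S' \<F>' \<Delta>' \<delta>' \<pi>' \<alpha> \<beta> B c \<and>
      (\<forall>\<beta>' B' c'. induced_isomorphisms S \<F> \<Delta> T \<delta> \<pi> S' \<F>' \<Delta>' \<delta>' \<pi>' \<alpha> \<beta>' B' c' \<longrightarrow>
         \<beta>' = \<beta> \<and> B' = B \<and> c' = c) \<and>
      (rigid S \<delta> S' \<delta>' \<alpha> \<longleftrightarrow>
         is_identity_functor (transporter_cat S \<Delta>) (transporter_cat S' \<Delta>') B \<and>
         is_identity_functor (fusion_cat S \<F>) (fusion_cat S' \<F>') c)"
proof -
  have iso: "transporter_system_isomorphism p S \<F> T \<Delta> \<delta> \<pi> S' \<F>' T' \<Delta>' \<delta>' \<pi>' \<alpha>"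
    using assms by (simp add: transporter_system_isomorphism_def transporter_system_isomorphism_axioms_def)
  interpret I: transporter_system_isomorphism p S \<F> T \<Delta> \<delta> \<pi> S' \<F>' T' \<Delta>' \<delta>' \<pi>'
    "\<lambda>P. {e \<in> Hom T P P. fmor \<pi> P P e = (\<lambda>x\<in>P. x)}"
    "\<lambda>P. {e \<in> Hom T' P P. fmor \<pi>' P P e = (\<lambda>x\<in>P. x)}" \<alpha> by (rule iso)
  show ?thesis
    using I.induced_isomorphisms_exist I.induced_isomorphisms_unique rigid_iff_identity[OF iso I.induced_isomorphisms_exist] by blast
qed

end
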